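(* Let $\eta,\gamma\in\mathbb{R}$ with $\gamma\neq-\eta$, and suppose that one of the following three cases holds. (i) $\phi(z)=z+\sqrt{1+z^2}$ and both $$-\frac{\gamma}{\cosh 1}\le \eta\le -\frac{\gamma}{\cosh 1}+\frac{\sinh 1}{2\cosh 1\,(1+\sqrt2-\cosh 1)}$$ and $$-\frac{\gamma}{\cos 1}-\frac{\sin 1}{2\cos 1\,(1+\sqrt2-\cos 1)}\le \eta\le -\frac{\gamma}{\cos 1}$$ hold. (ii) $\phi(z)=(1+sz)^2$ with $0<s\le 1/\sqrt2$, $$-\frac{\gamma}{\cos 1}-\frac{\sin 1}{2\cos 1\,((1+s)^2-\cos 1)}\le\eta\le-\frac{\gamma}{\cos 1},$$ and moreover $$\eta\ge-\frac{\gamma}{\cosh 1}\quad\text{if } 0<s\le -1+\sqrt{\cosh 1},$$ $$-\frac{\gamma}{\cosh 1}\le\eta\le-\frac{\gamma}{\cosh 1}+\frac{\sinh 1}{2\cosh 1\,((1+s)^2-\cosh 1)}\quad\text{if } -1+\sqrt{\cosh 1}<s\le 1/\sqrt2 .$$ (iii) $\phi(z)=e^z$ and both $$-\frac{\gamma}{\cosh 1}<\eta\le-\frac{\gamma}{\cosh 1}+\frac{\sinh 1}{2\cosh 1\,(e-\cosh 1)}$$ and $$-\frac{\gamma}{\cos 1}-\frac{\sin 1}{2\cos 1\,(e-\cos 1)}\le\eta<-\frac{\gamma}{\cos 1}$$ hold. If $p$ is an analytic function on $\mathbb{D}$ with $p(0)=1$ satisfying $$p(z)+\frac{zp'(z)}{\eta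 p(z)+\gamma}\prec\phi(z),$$ then $p(z)\prec\cosh\sqrt z$.
   Context: $\mathbb{D}=\{z\in\mathbb{C}:|z|<1\}$. For analytic functions $f,g$ on $\mathbb{D}$, $f\prec g$ ($f$ is subordinate to $g$) means that $f(z)=g(w(z))$ for some analytic $w:\mathbb{D}\to\mathbb{D}$ with $w(0)=0$. The function $\cosh\sqrt z$ denotes the analytic function $\sum_{n=0}^\infty z^n/(2n)!$. The square root in $z+\sqrt{1+z^2}$ is the branch equal to $1$ at $z=0$. *)

theory Defs
  imports "HOL-Complex_Analysis.Complex_Analysis"
begin

abbreviation unit_disc :: "complex set" where
  "unit_disc \<equiv> ball 0 1"

text \<open>Subordination is a relation between analytic functions on the unit disc, so analyticity of
  both sides is part of the definition.\<close>

definition subordinate :: "(complex \<Rightarrow> complex) \<Rightarrow> (complex \<Rightarrow> complex) \<Rightarrow> bool" (infix "\<prec>\<^sub>D" 50) where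
  "f \<prec>\<^sub>D g \<longleftrightarrow>
     f holomorphic_on unit_disc \<and> g holomorphic_on unit_disc \<and>
     (\<exists>w. w holomorphic_on unit_disc \<and> w ` unit_disc \<subseteq> unit_disc \<and> w 0 = 0 \<and>
          (\<forall>z\<in>unit_disc. f z = g (w z)))"

definition cosh_sqrt :: "complex \<Rightarrow> complex" where
  "cosh_sqrt z = (\<Sum>n. z ^ n / fact (2 * n))"

text \<open>For \<open>z\<close> in the unit disc, \<open>1 + z\<^sup>2\<close> has positive real part, so the principal root
  is the analytic branch with value \<open>1\<close> at \<open>z = 0\<close>.\<close>

definition phi_lune :: "complex \<Rightarrow> complex" where
  "phi_lune z = z + csqrt (1 + z\<^sup>2)"

end

theory Submission
  imports Defs
begin

text \<open>Write \<open>F = p + z p' / (\<eta> p + \<gamma>)\<close>. The two conditions on \<open>(\<eta>, \<gamma>)\<close> bound the values of \<open>\<eta> w + \<gamma>\<close> at the two real boundary points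
  \<open>w = cos 1\<close> and \<open>w = cosh 1\<close> of \<open>cosh_sqrt (D)\<close>. For a suitable quadratic polynomial \<open>Q\<close>, univalent on the disc \<open>D\<close>
  and with \<open>Q (D) \<subseteq> cosh_sqrt (D)\<close>, one shows \<open>p (D) \<subseteq> Q (D)\<close>: if \<open>p\<close> leaves \<open>Q (D)\<close>, then by Jack's lemma
  \<open>F = Q \<zeta> + M \<zeta> Q' \<zeta> / (\<eta> Q \<zeta> + \<gamma>)\<close> at some point, where \<open>|\<zeta>| = 1\<close> and \<open>M \<ge> 1\<close>, and this value lies outside \<open>\<phi> (D)\<close>. Since \<open>cosh_sqrt\<close> is
  univalent, \<open>p (D) \<subseteq> cosh_sqrt (D)\<close> is the subordination. With \<open>E = \<phi> 1 - 1\<close>, \<open>\<phi> (D)\<close> lies in the disc of radius \<open>E\<close>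
  about \<open>1\<close>, and that suffices for \<open>E \<ge> 5/4\<close>; there \<open>Q\<close> is chosen so that \<open>\<eta> Q + \<gamma>\<close> is a square. For smaller \<open>E\<close>, where
  \<open>\<phi> z = (1 + s z)\<^sup>2\<close>, the limacon \<open>\<phi> (D)\<close> is enclosed in a disc adapted to \<open>\<zeta>\<close>, and \<open>Q\<close> is a disc or itself a limacon.\<close>

text \<open>The derivative of \<open>cosh_sqrt\<close> is \<open>sinh 1 / 2\<close> at
  \<open>1\<close> and \<open>sin 1 / 2\<close> at \<open>-1\<close>. So the bounds say that an exit
  of \<open>p\<close> through \<open>cosh 1\<close> or \<open>cos 1\<close> with multiplier 1 would
  send F to a real point at or beyond \<open>\<phi> 1\<close>. The obstacle is that
  \<open>\<eta> w + \<gamma>\<close> is nonpositive at \<open>cos 1\<close> and nonnegative at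
  \<open>cosh 1\<close>: it vanishes somewhere between, so no positivity of its real part on the
  target is available. That \<open>\<eta> p + \<gamma>\<close> has no zero must come from the
  analyticity of F, and F must be estimated along a whole boundary curve, not at two points only.
  Quadratic curves keep this estimate polynomial in \<open>Re \<zeta>\<close>; the boundary of
  \<open>cosh_sqrt (D)\<close> itself would bring in transcendental functions. For every
  \<open>E\<close> the disc of radius \<open>2 - cosh 1\<close> about \<open>1\<close> is tried as
  well. Its failure is useful: it forces \<open>\<eta> w + \<gamma>\<close> to be large at
  \<open>w = 3 - cosh 1\<close>, and this lower bound drives the limacon cases.\<close>

section \<open>Jack's lemma and the first exit from a quadratic image\<close>

text \<open>Schwarz's lemma gives \<open>|v z| \<le> |z| / |z0|\<close>, with equality at
  \<open>z0\<close>. Comparing both sides along every inward direction \<open>z0 d\<close> with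
  \<open>Re d < 0\<close> yields \<open>Re (d D) \<le> Re d\<close> for
  \<open>D = z0 v' / v z0\<close>, and a number \<open>D\<close> with this property is real and at
  least 1.\<close>

lemma jack_boundary:
  fixes v :: "complex \<Rightarrow> complex"
  assumes "z0 \<noteq> 0" and hol: "v holomorphic_on ball 0 (norm z0)" and "v 0 = 0"
    and lt1: "\<And>z. norm z < norm z0 \<Longrightarrow> norm (v z) < 1"
    and der: "(v has_field_derivative v') (at z0)" and one: "norm (v z0) = 1"
  obtains M :: real where "M \<ge> 1" "z0 * v' = of_real M * v z0"
proof -
  define R where "R = norm z0"
  have "R > 0" using assms by (simp add: R_def)
  have vne: "v z0 \<noteq> 0" using one by auto
  have sch: "norm (v z) \<le> norm z / R" if "norm z < R" for z
  proof -
    have "(\<lambda>u::complex. of_real R * u) ` ball 0 1 \<subseteq> ball 0 (norm z0)"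
      using \<open>R > 0\<close> by (auto simp: dist_norm norm_mult R_def)
    moreover have "(\<lambda>u. of_real R * u :: complex) holomorphic_on ball 0 1"
      by (intro holomorphic_intros)
    ultimately have "(v \<circ> (\<lambda>u. of_real R * u)) holomorphic_on ball 0 1"
      using hol holomorphic_on_compose holomorphic_on_subset by blast
    then have "norm ((v \<circ> (\<lambda>u. of_real R * u)) (z / of_real R)) \<le> norm (z / of_real R)"
    proof (rule Schwarz_Lemma(1))
      show "norm ((v \<circ> (\<lambda>u. of_real R * u)) w) < 1" if "norm w < 1" for w
        using that lt1 \<open>R > 0\<close> by (auto simp: norm_mult R_def)
    qed (use that \<open>R > 0\<close> \<open>v 0 = 0\<close> in \<open>auto simp: norm_divide\<close>)
    then show ?thesis using \<open>R > 0\<close> by (simp add: norm_divide)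
  qed
  define D where "D = z0 * v' / v z0"
  have key: "Re (d * D) \<le> Re d" if "Re d < 0" for d :: complex
  proof -
    have d0: "d \<noteq> 0" using that by auto
    have lim0: "filterlim (\<lambda>t::real. of_real t * (z0 * d)) (at 0) (at_right 0)"
      unfolding filterlim_at
    proof
      show "((\<lambda>t::real. of_real t * (z0 * d)) \<longlongrightarrow> 0) (at_right 0)"
        by (auto intro!: tendsto_eq_intros)
      show "\<forall>\<^sub>F t::real in at_right 0. of_real t * (z0 * d) \<in> UNIV \<and> of_real t * (z0 * d) \<noteq> 0"
        using d0 \<open>z0 \<noteq> 0\<close> by (auto simp: eventually_at_filter)
    qed
    have "((\<lambda>h. (v (z0 + h) - v z0) / h) \<longlongrightarrow> v') (at 0)"
      using der by (simp add: DERIV_def)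
    from filterlim_compose[OF this lim0]
    have "((\<lambda>t::real. (v (z0 + of_real t * (z0 * d)) - v z0) / (of_real t * (z0 * d))) \<longlongrightarrow> v') (at_right 0)" .
    then have "((\<lambda>t::real. Re ((v (z0 + of_real t * (z0 * d)) - v z0) / (of_real t * (z0 * d)) * (z0 * d / v z0))) 
        \<longlongrightarrow> Re (v' * (z0 * d / v z0))) (at_right 0)"
      by (intro tendsto_intros)
    moreover have "v' * (z0 * d / v z0) = d * D" by (simp add: D_def)
    ultimately have lim1: "((\<lambda>t::real. Re ((v (z0 + of_real t * (z0 * d)) - v z0) / (of_real t * (z0 * d)) * (z0 * d / v z0))) 
        \<longlongrightarrow> Re (d * D)) (at_right 0)" by simp
    have lim2: "((\<lambda>t::real. Re d + t * (norm d)\<^sup>2 / 2) \<longlongrightarrow> Re d) (at_right 0)"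
      by (auto intro!: tendsto_eq_intros)
    have "\<forall>\<^sub>F t::real in at_right 0. 0 < t \<and> t < - 2 * Re d / (norm d)\<^sup>2"
      using eventually_at_right_real[of 0 "- 2 * Re d / (norm d)\<^sup>2"] that d0 by (auto simp: divide_neg_pos elim: eventually_mono)
    then have "\<forall>\<^sub>F t::real in at_right 0. Re ((v (z0 + of_real t * (z0 * d)) - v z0) / (of_real t * (z0 * d)) * (z0 * d / v z0)) \<le> Re d + t * (norm d)\<^sup>2 / 2"
    proof (rule eventually_mono)
      fix t :: real assume t: "0 < t \<and> t < - 2 * Re d / (norm d)\<^sup>2"
      have d2: "(norm d)\<^sup>2 > 0" using d0 by simp
      have n2: "(norm (1 + of_real t * d))\<^sup>2 = 1 + 2 * t * Re d + t\<^sup>2 * (norm d)\<^sup>2"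
        unfolding cmod_power2 by (simp add: power2_eq_square algebra_simps)
      have "t < (- 2 * Re d) / (norm d)\<^sup>2" using t by simp
      then have "t * (norm d)\<^sup>2 < - 2 * Re d" using d2 by (simp only: pos_less_divide_eq)
      then have "t * (t * (norm d)\<^sup>2) < t * (- 2 * Re d)" using t by (intro mult_strict_left_mono) auto
      then have "(norm (1 + of_real t * d))\<^sup>2 < 1" unfolding n2 by (simp add: power2_eq_square algebra_simps)
      then have lt: "norm (1 + of_real t * d) < 1" by (simp add: power_less_one_iff)
      have eq: "z0 + of_real t * (z0 * d) = z0 * (1 + of_real t * d)" by (simp add: algebra_simps)
      have "norm (z0 * (1 + of_real t * d)) < R"
        using lt \<open>R > 0\<close> by (simp add: norm_mult R_def[symmetric])
      from sch[OF this] have "norm (v (z0 * (1 + of_real t * d))) \<le> norm (1 + of_real t * d)"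
        using \<open>R > 0\<close> by (simp add: norm_mult R_def[symmetric])
      then have "norm (v (z0 * (1 + of_real t * d)) / v z0) \<le> norm (1 + of_real t * d)"
        using one by (simp add: norm_divide)
      then have "Re (v (z0 * (1 + of_real t * d)) / v z0) \<le> norm (1 + of_real t * d)"
        using complex_Re_le_cmod order_trans by blast
      \<comment> \<open>From \<open>2 a \<le> 1 + a^2\<close> for the modulus \<open>a\<close>. This
        avoids the square root, keeps the first-order term exact and leaves an error of order
        \<open>t^2\<close>.\<close>
      also have "\<dots> \<le> 1 + t * Re d + t\<^sup>2 * (norm d)\<^sup>2 / 2"
        using n2 zero_le_power2[of "norm (1 + of_real t * d) - 1"] by (simp add: power2_eq_square algebra_simps)
      finally have "Re (v (z0 * (1 + of_real t * d)) / v z0) - 1 \<le> t * (Re d + t * (norm d)\<^sup>2 / 2)"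
        by (simp add: algebra_simps power2_eq_square)
      then have *: "(Re (v (z0 * (1 + of_real t * d)) / v z0) - 1) / t \<le> Re d + t * (norm d)\<^sup>2 / 2"
        using t by (simp add: pos_divide_le_eq mult.commute)
      have "(v (z0 + of_real t * (z0 * d)) - v z0) / (of_real t * (z0 * d)) * (z0 * d / v z0)
          = (v (z0 * (1 + of_real t * d)) / v z0 - 1) / of_real t"
        using d0 \<open>z0 \<noteq> 0\<close> vne t unfolding eq by (simp add: field_simps)
      then show "Re ((v (z0 + of_real t * (z0 * d)) - v z0) / (of_real t * (z0 * d)) * (z0 * d / v z0)) \<le> Re d + t * (norm d)\<^sup>2 / 2"
        using * by simp
    qed
    from tendsto_le[OF _ lim2 lim1 this] show ?thesis by simp
  qed
  have "Im D = 0"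
  proof (rule ccontr)
    assume "Im D \<noteq> 0"
    \<comment> \<open>With this slope \<open>Re ((-1 + i n) D) = 0\<close>, although
      \<open>key\<close> bounds it by \<open>-1\<close>.\<close>
    define n where "n = - Re D / Im D"
    have "Re (Complex (-1) n * D) \<le> -1" by (rule order_trans[OF key]) auto
    then show False using \<open>Im D \<noteq> 0\<close> by (simp add: n_def)
  qed
  moreover have "Re D \<ge> 1" using key[of "-1"] by simp
  ultimately show ?thesis
    using vne by (intro that[of "Re D"]) (auto simp: D_def complex_eq_iff field_simps complex_is_Real_iff of_real_Re)
qed

text \<open>One family serves all comparison domains: \<open>\<beta> = 0\<close> gives discs about
  1, and \<open>\<alpha> = 2 s\<close>, \<open>\<beta> = s^2\<close> gives the limacon
  \<open>(1 + s v)^2\<close>. The map is univalent on the closed disc if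
  \<open>0 \<le> 2 \<beta> < \<alpha>\<close>.\<close>

definition qcurve :: "real \<Rightarrow> real \<Rightarrow> complex \<Rightarrow> complex" where
  "qcurve \<alpha> \<beta> v = 1 + of_real \<alpha> * v + of_real \<beta> * v\<^sup>2"

text \<open>By compactness there is a point of least modulus that \<open>p\<close> maps outside the
  open image, and its value lies on the boundary curve. Around it \<open>p\<close> can be composed
  with the inverse of the quadratic, and Jack's lemma applies to the composition.\<close>

lemma qcurve_exit:
  fixes \<alpha> \<beta> :: real
  assumes ab: "0 \<le> \<beta>" "2 * \<beta> < \<alpha>" and hol: "p holomorphic_on unit_disc" and p0: "p 0 = 1"
    and no: "\<not> p ` unit_disc \<subseteq> qcurve \<alpha> \<beta> ` unit_disc"
  obtains z0 \<zeta> and M :: real where "z0 \<in> unit_disc" "norm \<zeta> = 1" "M \<ge> 1" "p z0 = qcurve \<alpha> \<beta> \<zeta>"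
    "z0 * deriv p z0 = of_real M * (of_real \<alpha> * \<zeta> + 2 * of_real \<beta> * \<zeta>\<^sup>2)"
proof -
  let ?Q = "qcurve \<alpha> \<beta>"
  \<comment> \<open>The strict inequality leaves room for a disc of radius \<open>R > 1\<close> on
    which the quadratic is still univalent, so its inverse is holomorphic around every boundary
    value.\<close>
  obtain R where R: "R > 1" "2 * \<beta> * R < \<alpha>"
  proof (cases "\<beta> = 0")
    case True then show ?thesis using that[of 2] ab by auto
  next
    case False
    then have "1 < \<alpha> / (2 * \<beta>)" using ab by (simp add: field_simps)
    from dense[OF this] show ?thesis using that ab False by (auto simp: field_simps)
  qed
  have holQ: "?Q holomorphic_on S" for S
    unfolding qcurve_def by (intro holomorphic_intros)
  have contQ: "continuous_on S ?Q" for S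
    using holQ holomorphic_on_imp_continuous_on by blast
  have inj: "inj_on ?Q (ball 0 R)"
  proof (rule inj_onI)
    fix u w assume u: "u \<in> ball 0 R" and w: "w \<in> ball 0 R" and eq: "?Q u = ?Q w"
    have "(u - w) * (of_real \<alpha> + of_real \<beta> * (u + w)) = 0"
      using eq by (simp add: qcurve_def power2_eq_square algebra_simps)
    moreover have "of_real \<alpha> + of_real \<beta> * (u + w) \<noteq> 0"
    proof
      assume "of_real \<alpha> + of_real \<beta> * (u + w) = 0"
      then have "norm (of_real \<alpha> :: complex) = norm (of_real \<beta> * (u + w))"
        by (metis add_eq_0_iff norm_minus_cancel)
      also have "\<dots> \<le> \<beta> * (norm u + norm w)"
        using ab by (simp add: norm_mult mult_left_mono norm_triangle_ineq)
      also have "\<dots> \<le> \<beta> * (R + R)"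
        using ab u w by (intro mult_left_mono add_mono) auto
      finally show False using R ab by (simp add: algebra_simps)
    qed
    ultimately show "u = w" by simp
  qed
  obtain G where holG: "G holomorphic_on (?Q ` ball 0 R)"
    and dG: "\<And>z. z \<in> ball 0 R \<Longrightarrow> deriv ?Q z * deriv G (?Q z) = 1"
    and GQ: "\<And>z. z \<in> ball 0 R \<Longrightarrow> G (?Q z) = z"
    using holomorphic_has_inverse[OF holQ open_ball inj] by metis
  have op: "open (?Q ` ball 0 R)" by (rule open_mapping_thm3[OF holQ open_ball inj])
  have op1: "open (?Q ` ball 0 1)"
    by (rule open_mapping_thm3[OF holQ open_ball]) (use inj R in \<open>auto elim: inj_on_subset\<close>)
  have contp: "continuous_on (ball 0 1) p"
    using hol holomorphic_on_imp_continuous_on by blast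
  obtain z1 where z1: "z1 \<in> ball 0 1" "p z1 \<notin> ?Q ` ball 0 1" using no by blast
  define B where "B = cball 0 (norm z1) \<inter> (p -` (- (?Q ` ball 0 1)))"
  have "compact B"
  proof -
    have "closedin (top_of_set (cball 0 (norm z1))) (cball 0 (norm z1) \<inter> p -` (- (?Q ` ball 0 1)))"
      using z1 op1 by (intro continuous_closedin_preimage continuous_on_subset[OF contp]) auto
    then show ?thesis unfolding B_def by (rule closedin_compact[OF compact_cball])
  qed
  moreover have "B \<noteq> {}" using z1 by (auto simp: B_def)
  ultimately obtain z0 where z0: "z0 \<in> B" "\<And>z. z \<in> B \<Longrightarrow> norm z0 \<le> norm z"
    using continuous_attains_inf[of B norm] by (auto intro: continuous_intros)
  have z0in: "z0 \<in> ball 0 1" using z0(1) z1 by (auto simp: B_def)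
  have inside: "p z \<in> ?Q ` ball 0 1" if "norm z < norm z0" for z
  proof (rule ccontr)
    assume "p z \<notin> ?Q ` ball 0 1"
    then have "z \<in> B" using that z0(1) by (auto simp: B_def)
    then show False using z0(2) that by fastforce
  qed
  have "z0 \<noteq> 0"
  proof
    assume "z0 = 0"
    moreover have "1 \<in> ?Q ` ball 0 1" by (auto simp: qcurve_def intro!: image_eqI[of _ _ 0])
    ultimately show False using z0(1) p0 by (auto simp: B_def)
  qed
  have "p z0 \<in> ?Q ` cball 0 1"
  proof -
    have "closed (?Q ` cball 0 1)"
      by (intro compact_imp_closed compact_continuous_image contQ compact_cball)
    \<comment> \<open>Radial approach from inside, where the values of \<open>p\<close> already lie
      in the image; the image of the closed disc is closed, so the limit lies in it.\<close>
    moreover have lim: "((\<lambda>n. p (of_real (1 - 1 / real (Suc (Suc n))) * z0)) \<longlonglongrightarrow> p z0)"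
    proof -
      have "(\<lambda>n. of_real (1 - 1 / real (Suc (Suc n))) * z0) \<longlonglongrightarrow> of_real (1 - 0) * z0"
        using LIMSEQ_Suc[OF LIMSEQ_inverse_real_of_nat] 
        by (intro tendsto_intros) (simp add: inverse_eq_divide)
      then show ?thesis
        using contp z0in by (intro isCont_tendsto_compose[of z0 p]) (auto simp: continuous_on_eq_continuous_at)
    qed
    moreover have "p (of_real (1 - 1 / real (Suc (Suc n))) * z0) \<in> ?Q ` cball 0 1" for n
    proof -
      have "norm (of_real (1 - 1 / real (Suc (Suc n))) * z0) < norm z0"
        using \<open>z0 \<noteq> 0\<close> unfolding norm_mult norm_of_real by (simp add: field_simps)
      from inside[OF this] show ?thesis by auto
    qed
    ultimately show ?thesis using closed_sequentially[OF _ _ lim] by blast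
  qed
  then obtain \<zeta> where \<zeta>: "norm \<zeta> \<le> 1" "p z0 = ?Q \<zeta>" by auto
  moreover have "\<not> norm \<zeta> < 1" using z0(1) \<zeta> by (auto simp: B_def)
  ultimately have n1: "norm \<zeta> = 1" by simp
  then have \<zeta>R: "\<zeta> \<in> ball 0 R" using R by simp
  define v where "v = G \<circ> p"
  have holv: "v holomorphic_on ball 0 (norm z0)"
    unfolding v_def
  proof (rule holomorphic_on_compose)
    show "p holomorphic_on ball 0 (norm z0)"
      by (rule holomorphic_on_subset[OF hol]) (use z0in in auto)
    show "G holomorphic_on p ` ball 0 (norm z0)"
    proof (rule holomorphic_on_subset[OF holG])
      show "p ` ball 0 (norm z0) \<subseteq> ?Q ` ball 0 R"
        using inside R by (auto simp: dist_norm) (smt (verit) image_iff mem_ball_0)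
    qed
  qed
  have vlt: "norm (v z) < 1" if "norm z < norm z0" for z
    using inside[OF that] GQ R by (auto simp: v_def)
  have v0: "v 0 = 0"
    using GQ[of 0] R p0 by (simp add: v_def qcurve_def)
  have vz0: "v z0 = \<zeta>" using GQ[OF \<zeta>R] \<zeta> by (simp add: v_def)
  have dp: "(p has_field_derivative deriv p z0) (at z0)"
    using hol z0in holomorphic_derivI open_ball by blast
  have "(G has_field_derivative deriv G (p z0)) (at (p z0))"
    using holomorphic_derivI[OF holG op] \<zeta> \<zeta>R by auto
  from DERIV_chain[OF this dp] have dv: "(v has_field_derivative deriv G (p z0) * deriv p z0) (at z0)"
    by (simp add: v_def)
  obtain M :: real where M: "M \<ge> 1" "z0 * (deriv G (p z0) * deriv p z0) = of_real M * v z0"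
    using jack_boundary[OF \<open>z0 \<noteq> 0\<close> holv v0 vlt dv] vz0 n1 by auto
  have "(?Q has_field_derivative of_real \<alpha> + 2 * of_real \<beta> * \<zeta>) (at \<zeta>)"
    unfolding qcurve_def[abs_def] by (auto intro!: derivative_eq_intros)
  then have dQ: "deriv ?Q \<zeta> = of_real \<alpha> + 2 * of_real \<beta> * \<zeta>" by (rule DERIV_imp_deriv)
  have "z0 * deriv p z0 = deriv ?Q \<zeta> * (z0 * (deriv G (p z0) * deriv p z0))"
    using dG[OF \<zeta>R] \<zeta> by (simp add: algebra_simps)
  also have "\<dots> = of_real M * (of_real \<alpha> * \<zeta> + 2 * of_real \<beta> * \<zeta>\<^sup>2)"
    unfolding M(2) dQ vz0 by (simp add: power2_eq_square algebra_simps)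
  finally show ?thesis using that z0in n1 M(1) \<zeta>(2) by blast
qed

section \<open>The function \<open>cosh_sqrt\<close>: univalence, image of the disc, boundary
  curve\<close>

lemma summable_cosh_sqrt: "summable (\<lambda>n. z ^ n / fact (2 * n) :: complex)"
proof (rule summable_comparison_test')
  show "summable (\<lambda>n. norm z ^ n / fact n)"
    using summable_exp[of "norm z"] by (simp add: field_simps)
  show "norm (z ^ n / fact (2 * n)) \<le> norm z ^ n / fact n" if "n \<ge> 0" for n
    by (simp add: norm_divide norm_power frac_le fact_mono)
qed

lemma holomorphic_cosh_sqrt: "cosh_sqrt holomorphic_on S"
proof -
  have "cosh_sqrt = (\<lambda>z. \<Sum>n. (1 / fact (2 * n)) * z ^ n)"
    by (simp add: cosh_sqrt_def fun_eq_iff)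
  moreover have "((\<lambda>z::complex. \<Sum>n. (1 / fact (2 * n)) * z ^ n) has_field_derivative
      (\<Sum>n. diffs (\<lambda>n. 1 / fact (2 * n)) n * z ^ n)) (at z)" for z
    by (rule termdiffs_strong_converges_everywhere) (use summable_cosh_sqrt in simp)
  ultimately have "(cosh_sqrt has_field_derivative (\<Sum>n. diffs (\<lambda>n. 1 / fact (2 * n)) n * z ^ n)) (at z)" for z
    by simp
  then show ?thesis
    using field_differentiable_at_within field_differentiable_def holomorphic_on_def by metis
qed

lemma cosh_sqrt_1: "cosh_sqrt 1 = of_real (cosh 1)"
proof -
  have "(\<lambda>n. if even n then 1 ^ n /\<^sub>R fact n else 0 :: real) sums cosh 1"
    by (rule cosh_converges)
  then have "(\<lambda>n. 1 / fact (2 * n) :: real) sums cosh 1"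
    by (subst (asm) sums_mono_reindex[of "\<lambda>n. 2 * n", symmetric])
      (auto simp: strict_mono_def inverse_eq_divide elim: evenE)
  then have "(\<lambda>n. complex_of_real (1 / fact (2 * n))) sums of_real (cosh 1)"
    by (rule sums_of_real)
  then show ?thesis
    by (simp add: cosh_sqrt_def sums_iff)
qed

text \<open>The first term, at \<open>n = 4\<close>, is \<open>16 / 8! = 1 / 2520\<close>, and
  consecutive ratios stay below \<open>1 / 50\<close>. The factor \<open>n^2\<close> pays both for
  \<open>|z^n - w^n| \<le> n |z - w|\<close> and, on the circle, for
  \<open>1 - Re (z^n) \<le> n^2 (1 - Re z)\<close>.\<close>

lemma sq_div_fact_le:
  "n \<ge> 4 \<Longrightarrow> (real n)\<^sup>2 / fact (2 * n) \<le> (1 / 2520) * (1 / 50) ^ (n - 4)"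
proof (induction n rule: nat_induct_at_least)
  case base
  show ?case by (simp add: fact_numeral)
next
  case (Suc n)
  have "50 * (real (Suc n))\<^sup>2 \<le> (real n)\<^sup>2 * ((2 * real n + 2) * (2 * real n + 1))"
  proof -
    have n4: "real n \<ge> 4" using Suc by simp
    have "4 * real n \<le> real n * real n" using n4 by (intro mult_right_mono) auto
    moreover have "16 \<le> real n * real n" using n4 mult_mono[of 4 "real n" 4 "real n"] by simp
    moreover have "90 \<le> (2 * real n + 2) * (2 * real n + 1)"
      using n4 mult_mono[of 10 "2 * real n + 2" 9 "2 * real n + 1"] by auto
    then have "(real n)\<^sup>2 * 90 \<le> (real n)\<^sup>2 * ((2 * real n + 2) * (2 * real n + 1))"
      by (intro mult_left_mono) auto
    moreover have "50 * (real (Suc n))\<^sup>2 \<le> (real n)\<^sup>2 * 90"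
      using calculation(1,2) by (simp add: power2_eq_square algebra_simps)
    ultimately show ?thesis by linarith
  qed
  moreover have "(fact (2 * Suc n) :: real) = (2 * real n + 2) * (2 * real n + 1) * fact (2 * n)"
    by (simp add: algebra_simps)
  ultimately have "(real (Suc n))\<^sup>2 / fact (2 * Suc n) \<le> (1 / 50) * ((real n)\<^sup>2 / fact (2 * n))"
    by (simp add: divide_simps mult.commute mult.left_commute add_pos_pos)
  also have "\<dots> \<le> (1 / 50) * ((1 / 2520) * (1 / 50) ^ (n - 4))"
    by (rule mult_left_mono[OF Suc.IH]) simp
  also have "\<dots> = (1 / 2520) * (1 / 50) ^ (Suc n - 4)"
    using Suc.hyps by (simp only: Suc_diff_le power_Suc)
  finally show ?case .
qed

text \<open>The cubic Taylor polynomial with a tail \<open>e\<close> that is bounded in two ways. On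
  the circle the real part of \<open>1 - z^n\<close> is of second order in \<open>|z - 1|\<close>,
  so \<open>Re e\<close> is bounded by a multiple of \<open>1 - Re z\<close>. This finer order is
  needed near \<open>cosh 1\<close>, where the compared domains touch.\<close>

lemma cosh_sqrt_diff:
  fixes z w :: complex
  assumes z: "norm z \<le> 1" and w: "norm w \<le> 1"
  obtains e where "cosh_sqrt z - cosh_sqrt w = (z - w) / 2 + (z\<^sup>2 - w\<^sup>2) / 24 + (z ^ 3 - w ^ 3) / 720 + e"
    "norm e \<le> norm (z - w) / 9800"
    "w = 1 \<Longrightarrow> norm z = 1 \<Longrightarrow> \<bar>Re e\<bar> \<le> (1 - Re z) / 2450"
proof -
  define c :: "nat \<Rightarrow> real" where "c n = 1 / fact (2 * n)" for n
  define f where "f n = of_real (c n) * (z ^ n - w ^ n)" for n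
  have f: "f = (\<lambda>n. z ^ n / fact (2 * n) - w ^ n / fact (2 * n))"
    by (simp add: f_def c_def fun_eq_iff diff_divide_distrib)
  have sf: "summable f" unfolding f by (intro summable_diff summable_cosh_sqrt)
  have "cosh_sqrt z - cosh_sqrt w = suminf f"
    unfolding cosh_sqrt_def f by (intro suminf_diff summable_cosh_sqrt)
  also have "\<dots> = (\<Sum>n. f (n + 4)) + (\<Sum>n<4. f n)"
    by (rule suminf_split_initial_segment[OF sf])
  also have "(\<Sum>n<4. f n) = (z - w) / 2 + (z\<^sup>2 - w\<^sup>2) / 24 + (z ^ 3 - w ^ 3) / 720"
    by (simp add: f_def c_def eval_nat_numeral fact_numeral)
  finally have eq: "cosh_sqrt z - cosh_sqrt w = (z - w) / 2 + (z\<^sup>2 - w\<^sup>2) / 24 + (z ^ 3 - w ^ 3) / 720 + (\<Sum>n. f (n + 4))"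
    by simp
  \<comment> \<open>\<open>(1 / 2520) / (1 - 1 / 50) = 5 / 12348\<close>, slightly less than
    \<open>1 / 2450\<close>. The Lipschitz bound gains another factor 4 from
    \<open>n \<le> n^2 / 4\<close> for \<open>n \<ge> 4\<close>.\<close>
  have geo: "(\<lambda>n. (1 / 2520) * (1 / 50) ^ n :: real) sums (5 / 12348)"
    using sums_mult[OF geometric_sums[of "1/50 :: real"], of "1 / 2520"] by simp
  have c4: "(real (n + 4))\<^sup>2 * c (n + 4) \<le> (1 / 2520) * (1 / 50) ^ n" for n
    using sq_div_fact_le[of "n + 4"] by (simp add: c_def)
  have c0: "c n \<ge> 0" for n by (simp add: c_def)
  have sum_le: "norm (suminf g) \<le> B * (5 / 12348)" "summable g"
    if "\<And>n. norm (g n) \<le> B * ((1 / 2520) * (1 / 50) ^ n)" for g :: "nat \<Rightarrow> 'a :: banach" and B :: real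
  proof -
    have s: "(\<lambda>n. B * ((1 / 2520) * (1 / 50) ^ n)) sums (B * (5 / 12348))" by (intro sums_mult geo)
    have sn: "summable (\<lambda>n. norm (g n))"
      by (rule summable_comparison_test'[OF sums_summable[OF s], of 0]) (use that in auto)
    then show "summable g" by (rule summable_norm_cancel)
    have "norm (suminf g) \<le> (\<Sum>n. norm (g n))" by (rule summable_norm[OF sn])
    also have "\<dots> \<le> (\<Sum>n. B * ((1 / 2520) * (1 / 50) ^ n))"
      using that sn sums_summable[OF s] by (intro suminf_le) auto
    finally show "norm (suminf g) \<le> B * (5 / 12348)" using s by (simp add: sums_iff)
  qed
  have "norm (f (n + 4)) \<le> (norm (z - w) / 4) * ((1 / 2520) * (1 / 50) ^ n)" for n
  proof -
    have "norm (f (n + 4)) \<le> c (n + 4) * (real (n + 4) * norm (z - w))"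
      unfolding f_def norm_mult using c0[of "n+4"] norm_power_diff[OF z w, of "n + 4"]
      by (simp add: mult_left_mono)
    also have "\<dots> \<le> (norm (z - w) / 4) * ((real (n + 4))\<^sup>2 * c (n + 4))"
    proof -
      have "real (n + 4) * 4 \<le> (real (n + 4))\<^sup>2" by (simp add: power2_eq_square algebra_simps)
      then have "(real (n + 4) * 4) * (c (n + 4) * norm (z - w)) \<le> (real (n + 4))\<^sup>2 * (c (n + 4) * norm (z - w))"
        using c0 by (intro mult_right_mono) auto
      then show ?thesis by (simp add: algebra_simps)
    qed
    also have "\<dots> \<le> (norm (z - w) / 4) * ((1 / 2520) * (1 / 50) ^ n)"
      using c4 by (intro mult_left_mono) auto
    finally show ?thesis .
  qed
  from sum_le(1)[OF this] have n1: "norm (\<Sum>n. f (n + 4)) \<le> norm (z - w) / 9800"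
    by (rule order_trans) simp
  have n2: "\<bar>Re (\<Sum>n. f (n + 4))\<bar> \<le> (1 - Re z) / 2450" if w1: "w = 1" and z1: "norm z = 1"
  proof -
    have re: "0 \<le> 1 - Re u" "(norm (u - 1))\<^sup>2 = 2 * (1 - Re u)" if "norm u = 1" for u
    proof -
      show "0 \<le> 1 - Re u" using complex_Re_le_cmod[of u] that by simp
      have "(Re u)\<^sup>2 + (Im u)\<^sup>2 = 1" using that by (simp add: cmod_def)
      then show "(norm (u - 1))\<^sup>2 = 2 * (1 - Re u)"
        unfolding cmod_power2 by (simp add: power2_eq_square algebra_simps)
    qed
    have "norm (Re (f (n + 4))) \<le> (1 - Re z) * ((1 / 2520) * (1 / 50) ^ n)" for n
    proof -
      have zn: "norm (z ^ (n + 4)) = 1" using z1 by (simp add: norm_power)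
      have "(norm (z ^ (n + 4) - 1))\<^sup>2 \<le> (real (n + 4) * norm (z - 1))\<^sup>2"
        using norm_power_diff[OF z, of 1 "n + 4"] by (intro power_mono) auto
      then have h: "1 - Re (z ^ (n + 4)) \<le> (real (n + 4))\<^sup>2 * (1 - Re z)"
        unfolding power_mult_distrib re(2)[OF zn] re(2)[OF z1] by (simp only: mult.left_commute[of _ 2] mult_le_cancel_left_pos zero_less_numeral)
      from mult_left_mono[OF h c0[of "n + 4"]]
      have "c (n + 4) * (1 - Re (z ^ (n + 4))) \<le> (1 - Re z) * ((real (n + 4))\<^sup>2 * c (n + 4))"
        by (simp only: mult_ac)
      also have "\<dots> \<le> (1 - Re z) * ((1 / 2520) * (1 / 50) ^ n)"
        using c4 re(1)[OF z1] by (intro mult_left_mono) auto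
      finally show ?thesis
        using c0[of "n + 4"] re(1)[OF zn] by (simp add: f_def w1 abs_mult)
    qed
    note * = this
    have "Re (\<Sum>n. f (n + 4)) = (\<Sum>n. Re (f (n + 4)))"
      using sf by (intro Re_suminf) (simp add: summable_iff_shift)
    then show ?thesis
      using sum_le(1)[OF *] re(1)[OF z1] by simp
  qed
  show ?thesis by (rule that[OF eq n1 n2])
qed

text \<open>The linear term dominates the difference of two values, since \<open>1 / 2\<close>
  exceeds \<open>2 / 24 + 3 / 720 + 1 / 9800\<close>.\<close>

lemma inj_on_cosh_sqrt: "inj_on cosh_sqrt (cball 0 1)"
proof (rule inj_onI, rule ccontr)
  fix z w :: complex
  assume zw: "z \<in> cball 0 1" "w \<in> cball 0 1" "cosh_sqrt z = cosh_sqrt w" "z \<noteq> w"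
  then have n: "norm z \<le> 1" "norm w \<le> 1" by auto
  obtain e where e: "cosh_sqrt z - cosh_sqrt w = (z - w) / 2 + (z\<^sup>2 - w\<^sup>2) / 24 + (z ^ 3 - w ^ 3) / 720 + e"
    "norm e \<le> norm (z - w) / 9800"
    by (rule cosh_sqrt_diff[OF n])
  have "(z - w) / 2 = - ((z\<^sup>2 - w\<^sup>2) / 24 + (z ^ 3 - w ^ 3) / 720 + e)"
    using e(1) unfolding zw(3) eq_neg_iff_add_eq_0 by (simp only: diff_self add.assoc)
  then have "norm ((z - w) / 2) = norm (- ((z\<^sup>2 - w\<^sup>2) / 24 + (z ^ 3 - w ^ 3) / 720 + e))"
    by (rule arg_cong)
  also have "\<dots> \<le> norm (z\<^sup>2 - w\<^sup>2) / 24 + norm (z ^ 3 - w ^ 3) / 720 + norm e"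
    unfolding norm_minus_cancel
    by (intro order_trans[OF norm_triangle_ineq] add_mono) (simp_all add: norm_divide)
  also have "\<dots> \<le> 2 * norm (z - w) / 24 + 3 * norm (z - w) / 720 + norm (z - w) / 9800"
    using norm_power_diff[OF n, of 2] norm_power_diff[OF n, of 3] e(2) by (intro add_mono) auto
  finally show False using zw(4) by (simp add: norm_divide)
qed

lemma cosh_sqrt_0: "cosh_sqrt 0 = 1"
  using powser_zero[of "\<lambda>n. 1 / fact (2 * n) :: complex"] by (simp add: cosh_sqrt_def)

lemma open_cosh_sqrt_disc: "open (cosh_sqrt ` unit_disc)"
  by (rule open_mapping_thm3[OF holomorphic_cosh_sqrt open_ball])
    (rule inj_on_subset[OF inj_on_cosh_sqrt], auto)

text \<open>The image of the open disc and the complement of the image of the closed disc are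
  disjoint open sets that cover \<open>T\<close>. Inclusions are thereby reduced to inequalities on
  the boundary curve.\<close>

lemma connected_subset_cosh_sqrt_disc:
  assumes "connected T" "1 \<in> T" and bd: "\<And>z. norm z = 1 \<Longrightarrow> cosh_sqrt z \<notin> T"
  shows "T \<subseteq> cosh_sqrt ` unit_disc"
proof -
  have cl: "closed (cosh_sqrt ` cball 0 1)"
    using holomorphic_cosh_sqrt by (intro compact_imp_closed compact_continuous_image
        holomorphic_on_imp_continuous_on compact_cball)
  have "cosh_sqrt ` cball 0 1 \<inter> T \<subseteq> cosh_sqrt ` unit_disc"
    using bd by (force simp: order_le_less)
  then have "T \<subseteq> cosh_sqrt ` unit_disc \<union> (- (cosh_sqrt ` cball 0 1))" by blast
  moreover have "cosh_sqrt ` unit_disc \<inter> (- (cosh_sqrt ` cball 0 1)) \<inter> T = {}" by auto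
  moreover have "1 \<in> cosh_sqrt ` unit_disc" by (rule image_eqI[of _ _ 0]) (auto simp: cosh_sqrt_0)
  ultimately have "- (cosh_sqrt ` cball 0 1) \<inter> T = {}"
    using connectedD[OF assms(1) open_cosh_sqrt_disc open_Compl[OF cl]] assms(2) by blast
  then show ?thesis using \<open>T \<subseteq> _\<close> by blast
qed

lemma subordinate_cosh_sqrtI:
  assumes hol: "p holomorphic_on unit_disc" and p0: "p 0 = 1" and sub: "p ` unit_disc \<subseteq> cosh_sqrt ` unit_disc"
  shows "p \<prec>\<^sub>D cosh_sqrt"
proof -
  have inj: "inj_on cosh_sqrt unit_disc" by (rule inj_on_subset[OF inj_on_cosh_sqrt]) auto
  obtain g where g: "g holomorphic_on cosh_sqrt ` unit_disc" "\<And>z. z \<in> unit_disc \<Longrightarrow> g (cosh_sqrt z) = z"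
    using holomorphic_has_inverse[OF holomorphic_cosh_sqrt open_ball inj] by metis
  have "(g \<circ> p) holomorphic_on unit_disc"
    by (rule holomorphic_on_compose[OF hol holomorphic_on_subset[OF g(1) sub]])
  moreover have "g (p z) \<in> unit_disc" "cosh_sqrt (g (p z)) = p z" if "z \<in> unit_disc" for z
    using sub that g(2) by force+
  moreover have "g (p 0) = 0" using g(2)[of 0] by (simp add: p0 cosh_sqrt_0)
  ultimately show ?thesis
    unfolding subordinate_def using hol holomorphic_cosh_sqrt
    by (intro conjI exI[of _ "g \<circ> p"]) (auto simp: image_subset_iff)
qed

text \<open>The gap \<open>\<Phi>\<close> vanishes at \<open>z = 1\<close>, where the comparison
  domains touch the image. Both bounds therefore carry the factor \<open>\<xi>\<close>, and only the
  cofactors have to be compared afterwards.\<close>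

lemma cosh_sqrt_circle:
  fixes z :: complex
  assumes z: "norm z = 1"
  defines "\<xi> \<equiv> 1 - Re z" and "\<Phi> \<equiv> of_real (cosh 1) - cosh_sqrt z"
  shows "2 * \<xi> * ((178929 - 27432 * \<xi> + 1564 * \<xi>\<^sup>2) / 518400 - 3 / 24500) \<le> (norm \<Phi>)\<^sup>2"
    and "Re \<Phi> \<le> \<xi> * (2 / 3 - \<xi> / 12 + (9 - 12 * \<xi> + 4 * \<xi>\<^sup>2) / 720 + 1 / 2450)"
    and "0 \<le> \<xi>" "\<xi> \<le> 2"
proof -
  have re: "\<bar>Re z\<bar> \<le> 1" using abs_Re_le_cmod[of z] z by simp
  then show \<xi>: "0 \<le> \<xi>" "\<xi> \<le> 2" by (auto simp: \<xi>_def)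
  obtain e where e: "cosh_sqrt z - cosh_sqrt 1 = (z - 1) / 2 + (z\<^sup>2 - 1\<^sup>2) / 24 + (z ^ 3 - 1 ^ 3) / 720 + e"
    "norm e \<le> norm (z - 1) / 9800" "\<bar>Re e\<bar> \<le> \<xi> / 2450"
    using cosh_sqrt_diff[of z 1] z unfolding \<xi>_def by (metis norm_one order_refl)
  define y where "y = Im z"
  have zxy: "z = Complex (1 - \<xi>) y" by (simp add: \<xi>_def y_def)
  have "(Re z)\<^sup>2 + (Im z)\<^sup>2 = 1" using z by (simp add: cmod_def)
  then have y2: "y\<^sup>2 = 2 * \<xi> - \<xi>\<^sup>2" by (simp add: y_def \<xi>_def power2_eq_square algebra_simps)
  have \<Phi>: "\<Phi> = (1 - z) / 2 + (1 - z\<^sup>2) / 24 + (1 - z ^ 3) / 720 - e"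
    unfolding \<Phi>_def cosh_sqrt_1[symmetric] using e(1) by (simp add: field_simps)
  have Rz2: "Re (z\<^sup>2) = 1 - 4 * \<xi> + 2 * \<xi>\<^sup>2"
    using y2 by (simp add: zxy power2_eq_square algebra_simps)
  have Rz3: "Re (z ^ 3) = 1 - 9 * \<xi> + 12 * \<xi>\<^sup>2 - 4 * \<xi> ^ 3"
  proof -
    have "Re (z ^ 3) = (1 - \<xi>) ^ 3 - 3 * (1 - \<xi>) * y\<^sup>2"
      by (simp add: zxy power2_eq_square power3_eq_cube algebra_simps)
    then show ?thesis unfolding y2 by (simp add: power2_eq_square power3_eq_cube algebra_simps)
  qed
  have "Re \<Phi> = \<xi> / 2 + (4 * \<xi> - 2 * \<xi>\<^sup>2) / 24 + (9 * \<xi> - 12 * \<xi>\<^sup>2 + 4 * \<xi> ^ 3) / 720 - Re e"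
    unfolding \<Phi> using Rz2 Rz3 by (simp add: zxy)
  also have "\<dots> \<le> \<xi> / 2 + (4 * \<xi> - 2 * \<xi>\<^sup>2) / 24 + (9 * \<xi> - 12 * \<xi>\<^sup>2 + 4 * \<xi> ^ 3) / 720 + \<xi> / 2450"
    using e(3) by linarith
  also have "\<dots> = \<xi> * (2 / 3 - \<xi> / 12 + (9 - 12 * \<xi> + 4 * \<xi>\<^sup>2) / 720 + 1 / 2450)"
    by (simp add: field_simps power2_eq_square power3_eq_cube)
  finally show "Re \<Phi> \<le> \<xi> * (2 / 3 - \<xi> / 12 + (9 - 12 * \<xi> + 4 * \<xi>\<^sup>2) / 720 + 1 / 2450)" .
  \<comment> \<open>The cofactor that remains when the cubic part of the gap is divided by
    \<open>1 - z\<close>.\<close>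
  define W where "W = (391 + 31 * z + z\<^sup>2) / 720"
  have \<Phi>W: "\<Phi> = (1 - z) * W - e"
    unfolding \<Phi> W_def by (simp add: field_simps power2_eq_square power3_eq_cube)
  have z1: "(norm (1 - z))\<^sup>2 = 2 * \<xi>"
    unfolding cmod_power2 using y2 by (simp add: zxy power2_eq_square algebra_simps)
  have W2: "(norm W)\<^sup>2 = (178929 - 27432 * \<xi> + 1564 * \<xi>\<^sup>2) / 518400"
  proof -
    have "(norm (391 + 31 * z + z\<^sup>2))\<^sup>2 = (391 + 31 * (1 - \<xi>) + ((1 - \<xi>)\<^sup>2 - y\<^sup>2))\<^sup>2 + (31 + 2 * (1 - \<xi>))\<^sup>2 * y\<^sup>2"
      unfolding cmod_power2 by (simp add: zxy power2_eq_square algebra_simps)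
    also have "\<dots> = 178929 - 27432 * \<xi> + 1564 * \<xi>\<^sup>2"
      unfolding y2 by (simp add: power2_eq_square algebra_simps)
    finally show ?thesis by (simp add: W_def norm_divide power_divide)
  qed
  have W6: "norm W \<le> 3 / 5"
  proof -
    have "norm (391 + 31 * z + z\<^sup>2) \<le> 391 + 31 + 1"
      using z by (intro order_trans[OF norm_triangle_ineq] add_mono) (auto simp: norm_mult norm_power)
    then show ?thesis by (simp add: W_def norm_divide)
  qed
  have W1: "norm W \<ge> 1 / 9800"
  proof -
    have "norm (391 + 31 * z + z\<^sup>2) \<ge> 391 - norm (31 * z + z\<^sup>2)"
      using norm_diff_ineq[of 391 "31 * z + z\<^sup>2"] by (simp add: add.assoc)
    moreover have "norm (31 * z + z\<^sup>2) \<le> 31 + 1"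
      using z by (intro order_trans[OF norm_triangle_ineq] add_mono) (auto simp: norm_mult norm_power)
    ultimately show ?thesis by (simp add: W_def norm_divide)
  qed
  have "norm (1 - z) * (norm W - 1 / 9800) \<le> norm \<Phi>"
  proof -
    have "norm ((1 - z) * W) - norm e \<le> norm \<Phi>" unfolding \<Phi>W by (rule norm_triangle_ineq2)
    moreover have "norm e \<le> norm (1 - z) / 9800" using e(2) by (simp add: norm_minus_commute)
    ultimately show ?thesis by (simp only: norm_mult right_diff_distrib)
  qed
  then have "(norm (1 - z) * (norm W - 1 / 9800))\<^sup>2 \<le> (norm \<Phi>)\<^sup>2"
    using W1 by (intro power_mono) auto
  \<comment> \<open>With \<open>norm W \<le> 3 / 5\<close>, subtracting \<open>1 / 9800\<close>
    before squaring costs at most \<open>2 * (3 / 5) / 9800 = 3 / 24500\<close>.\<close>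
  moreover have "2 * \<xi> * ((norm W)\<^sup>2 - 3 / 24500) \<le> (norm (1 - z) * (norm W - 1 / 9800))\<^sup>2"
  proof -
    have "(norm W)\<^sup>2 - 3 / 24500 \<le> (norm W - 1 / 9800)\<^sup>2"
      using W6 by (simp add: power2_eq_square algebra_simps)
    then show ?thesis unfolding power_mult_distrib z1 using \<xi> by (intro mult_left_mono) auto
  qed
  ultimately show "2 * \<xi> * ((178929 - 27432 * \<xi> + 1564 * \<xi>\<^sup>2) / 518400 - 3 / 24500) \<le> (norm \<Phi>)\<^sup>2"
    unfolding W2 by linarith
qed

text \<open>Geometrically: the boundary curve avoids the open disc with diameter
  \<open>[cosh 1 - 1, cosh 1]\<close>, which touches it at \<open>cosh 1\<close>. After cancelling
  \<open>\<xi>\<close> a quadratic inequality on \<open>[0, 2]\<close> remains.\<close>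

lemma cosh_sqrt_circle_disc:
  assumes z: "norm z = 1"
  shows "Re (of_real (cosh 1) - cosh_sqrt z) \<le> (norm (of_real (cosh 1) - cosh_sqrt z))\<^sup>2"
proof -
  define \<xi> where "\<xi> = 1 - Re z"
  note b = cosh_sqrt_circle[OF z, folded \<xi>_def]
  have "2 / 3 - \<xi> / 12 + (9 - 12 * \<xi> + 4 * \<xi>\<^sup>2) / 720 + 1 / 2450
      \<le> 2 * ((178929 - 27432 * \<xi> + 1564 * \<xi>\<^sup>2) / 518400 - 3 / 24500)"
  proof -
    have "0 \<le> (2 - \<xi>) * (63 / 12500 - \<xi> / 2500)" using b(3,4) by (intro mult_nonneg_nonneg) auto
    moreover have "(2 - \<xi>) * (63 / 12500 - \<xi> / 2500) = 126 / 12500 - 73 / 12500 * \<xi> + \<xi>\<^sup>2 / 2500"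
      by (simp add: power2_eq_square field_simps)
    ultimately show ?thesis using b(3) zero_le_power2[of \<xi>] by argo
  qed
  then have "\<xi> * (2 / 3 - \<xi> / 12 + (9 - 12 * \<xi> + 4 * \<xi>\<^sup>2) / 720 + 1 / 2450)
      \<le> \<xi> * (2 * ((178929 - 27432 * \<xi> + 1564 * \<xi>\<^sup>2) / 518400 - 3 / 24500))"
    using b(3) by (rule mult_left_mono)
  with b(1,2) show ?thesis by (simp add: mult_ac)
qed

section \<open>Numerical enclosures of the constants\<close>

lemma exp_1_bounds: "2718281 / 1000000 < exp (1::real)" "exp (1::real) < 2718282 / 1000000"
  and exp_m1_bounds: "367879 / 1000000 < exp (-1::real)" "exp (-1::real) < 367880 / 1000000"
proof -
  obtain t :: real where t: "\<bar>t\<bar> \<le> 1" "exp 1 = (\<Sum>m<11. 1 ^ m / fact m) + exp t / fact 11 * 1 ^ 11"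
    using Maclaurin_exp_le[of 1 11] by auto
  have "exp t \<le> exp 1" using t(1) by simp
  then have "exp t \<le> 3" using exp_le by linarith
  moreover have e: "exp 1 * 39916800 = exp t + 108505111"
    using t(2) by (simp add: lessThan_nat_numeral lessThan_Suc fact_numeral field_simps)
  ultimately show "2718281 / 1000000 < exp (1::real)" "exp (1::real) < 2718282 / 1000000"
    using e exp_gt_zero[of t] by linarith+
  obtain u :: real where u: "\<bar>u\<bar> \<le> 1" "exp (-1) = (\<Sum>m<11. (-1) ^ m / fact m) + exp u / fact 11 * (-1) ^ 11"
    using Maclaurin_exp_le[of "-1" 11] by auto
  have "exp u \<le> exp 1" using u(1) by simp
  then have "exp u \<le> 3" using exp_le by linarith
  moreover have e: "exp (-1) * 39916800 = 14684571 - exp u"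
    using u(2) by (simp add: lessThan_nat_numeral lessThan_Suc fact_numeral field_simps)
  ultimately show "367879 / 1000000 < exp (-1::real)" "exp (-1::real) < 367880 / 1000000"
    using e exp_gt_zero[of u] by linarith+
qed

lemma cosh_1_bounds: "1543080 / 1000000 < cosh (1::real)" "cosh (1::real) < 1543081 / 1000000"
  and sinh_1_bounds: "11752 / 10000 < sinh (1::real)" "sinh (1::real) < 117521 / 100000"
  using exp_1_bounds exp_m1_bounds by (simp_all add: cosh_field_def sinh_field_def)

lemma cos_1_bounds: "5403 / 10000 < cos (1::real)" "cos (1::real) < 54031 / 100000"
proof -
  obtain t :: real where t: "cos 1 = (\<Sum>m<11. cos_coeff m * 1 ^ m) + cos (t + 1 / 2 * real 11 * pi) / fact 11 * 1 ^ 11"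
    using Maclaurin_cos_expansion[of 1 11] by auto
  define c where "c = cos (t + 1 / 2 * real 11 * pi)"
  have "cos 1 * 39916800 = c + 21567139"
    using t unfolding c_def[symmetric] by (simp add: lessThan_nat_numeral lessThan_Suc fact_numeral cos_coeff_def field_simps)
  moreover have "-1 \<le> c" "c \<le> 1" by (simp_all add: c_def)
  ultimately show "5403 / 10000 < cos (1::real)" "cos (1::real) < 54031 / 100000"
    by - linarith+
qed

lemma sin_1_bounds: "84147 / 100000 < sin (1::real)" "sin (1::real) < 841472 / 1000000"
proof -
  have "\<bar>sin 1 - (\<Sum>m<11. sin_coeff m * 1 ^ m)\<bar> \<le> inverse (fact 11) * \<bar>1::real\<bar> ^ 11"
    by (rule Maclaurin_sin_bound)
  then show "84147 / 100000 < sin (1::real)" "sin (1::real) < 841472 / 1000000"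
    unfolding abs_le_iff by (simp_all add: lessThan_nat_numeral lessThan_Suc fact_numeral sin_coeff_def field_simps)
qed

section \<open>Exit criteria for the Briot-Bouquet expression\<close>

text \<open>Put \<open>g = \<eta> p + \<gamma>\<close>. Wherever \<open>g\<close> is nonzero,
  \<open>g' = h g\<close> with \<open>h = \<eta> (F - p) / z\<close>, and \<open>h\<close> is
  holomorphic near \<open>z1\<close> because F is. Hence \<open>g\<close> is a constant multiple of
  an exponential near \<open>z1\<close>; a zero there would make it vanish identically, against the
  isolation of zeros. At a zero of \<open>g\<close> the convention \<open>x / 0 = 0\<close> still
  gives F a value, so it is the holomorphy of F that excludes the zero.\<close>

lemma briot_bouquet_nonzero:
  fixes \<eta> \<gamma> :: real
  assumes hp: "p holomorphic_on unit_disc" and p0: "p 0 = 1" and ne: "\<gamma> \<noteq> - \<eta>"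
    and hF: "(\<lambda>z. p z + z * deriv p z / (of_real \<eta> * p z + of_real \<gamma>)) holomorphic_on unit_disc"
    and z1: "z1 \<in> unit_disc"
  shows "of_real \<eta> * p z1 + of_real \<gamma> \<noteq> (0 :: complex)"
proof
  define g where "g z = of_real \<eta> * p z + of_real \<gamma>" for z
  define F where "F z = p z + z * deriv p z / g z" for z
  assume "of_real \<eta> * p z1 + of_real \<gamma> = (0 :: complex)"
  then have g1: "g z1 = 0" by (simp add: g_def)
  have hg: "g holomorphic_on unit_disc" unfolding g_def by (intro holomorphic_intros hp)
  have hF': "F holomorphic_on unit_disc" using hF unfolding F_def g_def .
  have g0: "g 0 \<noteq> 0"
    using ne p0 by (simp add: g_def flip: of_real_add)
  then have "z1 \<noteq> 0" using g1 by auto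
  have zero: "(0::complex) \<in> unit_disc" by simp
  have "\<exists>r>0. ball z1 r \<subseteq> unit_disc \<and> (\<forall>z \<in> ball z1 r - {z1}. g z \<noteq> 0)"
    by (rule isolated_zeros[OF hg open_ball connected_ball z1 g1 zero g0]) blast
  then obtain r where r: "0 < r" "ball z1 r \<subseteq> unit_disc" and r0: "\<forall>z \<in> ball z1 r - {z1}. g z \<noteq> 0"
    by (elim exE conjE)
  \<comment> \<open>The smaller ball avoids the origin, so the factor \<open>1 / z\<close> in
    \<open>h\<close> is holomorphic on it.\<close>
  define R where "R = min r (norm z1)"
  have R: "R > 0" "ball z1 R \<subseteq> ball z1 r" using r \<open>z1 \<noteq> 0\<close> by (auto simp: R_def)
  have n0: "z \<noteq> 0" if "z \<in> ball z1 R" for z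
    using that by (auto simp: R_def dist_norm)
  define h where "h z = of_real \<eta> * (F z - p z) / z" for z
  have sub: "ball z1 R \<subseteq> unit_disc" using r(2) R(2) by blast
  have "h holomorphic_on ball z1 R"
    unfolding h_def using n0 by (intro holomorphic_intros holomorphic_on_subset[OF hF' sub] holomorphic_on_subset[OF hp sub]) auto
  then have "\<exists>H. \<forall>z \<in> ball z1 R. (H has_field_derivative h z) (at z within ball z1 R)"
    by (rule holomorphic_convex_primitive'[OF convex_ball open_ball]) blast
  then obtain H where H': "\<forall>z \<in> ball z1 R. (H has_field_derivative h z) (at z within ball z1 R)" ..
  have H: "(H has_field_derivative h z) (at z)" if "z \<in> ball z1 R" for z
    using H'[rule_format, OF that] by (simp only: at_within_open[OF that open_ball])
  define k where "k z = g z * exp (- H z)" for z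
  have dg: "(g has_field_derivative of_real \<eta> * deriv p z) (at z)" if "z \<in> ball z1 R" for z
    unfolding g_def using that sub holomorphic_derivI[OF hp open_ball] by (auto intro!: derivative_eq_intros)
  have dk: "(k has_field_derivative (of_real \<eta> * deriv p z - h z * g z) * exp (- H z)) (at z)" if "z \<in> ball z1 R" for z
    unfolding k_def by (auto intro!: derivative_eq_intros dg[OF that] H[OF that] simp: algebra_simps)
  have "continuous_on (ball z1 R) k"
    by (intro continuous_at_imp_continuous_on ballI DERIV_isCont[OF dk])
  moreover have "(k has_field_derivative 0) (at z)" if "z \<in> ball z1 R - {z1}" for z
  proof -
    have "g z \<noteq> 0" "z \<noteq> 0" using that r0 R(2) n0 by auto
    then have "h z * g z = of_real \<eta> * deriv p z" by (simp add: h_def F_def field_simps)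
    then show ?thesis using dk[of z] that by simp
  qed
  \<comment> \<open>The derivative is known to vanish only off \<open>z1\<close>; continuity takes
    care of the exceptional point.\<close>
  ultimately have "k constant_on ball z1 R"
    by (intro DERIV_zero_connected_constant_on[OF connected_ball open_ball, of "{z1}"]) blast+
  then obtain c where c: "\<And>z. z \<in> ball z1 R \<Longrightarrow> k z = c"
    unfolding constant_on_def by blast
  have "c = 0" using c[of z1] R by (simp add: k_def g1)
  define z2 where "z2 = z1 + of_real (R / 2)"
  have "z2 \<in> ball z1 R - {z1}" using R by (auto simp: z2_def dist_norm)
  then have "g z2 = 0" "g z2 \<noteq> 0" using c[of z2] \<open>c = 0\<close> r0 R by (auto simp: k_def)
  then show False by simp
qed

text \<open>The interface between function theory and estimates: for a given quadratic and a given
  target \<open>T\<close>, only \<open>out\<close> has to be verified, namely that the value forced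
  on F at a first exit is outside \<open>T\<close>.\<close>

lemma briot_bouquet_curve:
  fixes \<eta> \<gamma> \<alpha> \<beta> :: real
  assumes ab: "0 \<le> \<beta>" "2 * \<beta> < \<alpha>"
    and hp: "p holomorphic_on unit_disc" and p0: "p 0 = 1" and ne: "\<gamma> \<noteq> - \<eta>"
    and hF: "(\<lambda>z. p z + z * deriv p z / (of_real \<eta> * p z + of_real \<gamma>)) holomorphic_on unit_disc"
    and T: "\<And>z. z \<in> unit_disc \<Longrightarrow> p z + z * deriv p z / (of_real \<eta> * p z + of_real \<gamma>) \<in> T"
    and out: "\<And>\<zeta> (M::real) P. norm \<zeta> = 1 \<Longrightarrow> M \<ge> 1 \<Longrightarrow> P = of_real \<eta> * qcurve \<alpha> \<beta> \<zeta> + of_real \<gamma> \<Longrightarrow> P \<noteq> 0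
       \<Longrightarrow> qcurve \<alpha> \<beta> \<zeta> + of_real M * (of_real \<alpha> * \<zeta> + 2 * of_real \<beta> * \<zeta>\<^sup>2) / P \<notin> T"
  shows "p ` unit_disc \<subseteq> qcurve \<alpha> \<beta> ` unit_disc"
proof (rule ccontr)
  assume "\<not> ?thesis"
  then show False
  proof (rule qcurve_exit[OF ab hp p0])
    fix z0 \<zeta> and M :: real
    assume *: "z0 \<in> unit_disc" "norm \<zeta> = 1" "M \<ge> 1" "p z0 = qcurve \<alpha> \<beta> \<zeta>"
      "z0 * deriv p z0 = of_real M * (of_real \<alpha> * \<zeta> + 2 * of_real \<beta> * \<zeta>\<^sup>2)"
    have "of_real \<eta> * qcurve \<alpha> \<beta> \<zeta> + of_real \<gamma> \<noteq> 0"
      using briot_bouquet_nonzero[OF hp p0 ne hF *(1)] unfolding *(4) .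
    from out[OF *(2,3) refl this] T[OF *(1)] show False
      unfolding *(4,5) by contradiction
  qed
qed

text \<open>For a disc, \<open>F - 1 = r \<zeta> (P + M) / P\<close> with \<open>P\<close> affine in
  \<open>\<zeta>\<close>. Then \<open>|F - 1| \<ge> E\<close> compares two squared moduli that are
  affine in \<open>Re \<zeta>\<close> on the circle, so only \<open>\<zeta> = 1\<close> and
  \<open>\<zeta> = -1\<close> matter. There \<open>P\<close> is real, and the range allowed by
  \<open>lo\<close> and \<open>hi\<close> gives the inequality.\<close>

lemma briot_bouquet_disc:
  fixes \<eta> \<gamma> r E :: real
  assumes hp: "p holomorphic_on unit_disc" and p0: "p 0 = 1" and ne: "\<gamma> \<noteq> - \<eta>"
    and hF: "(\<lambda>z. p z + z * deriv p z / (of_real \<eta> * p z + of_real \<gamma>)) holomorphic_on unit_disc"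
    and T: "\<And>z. z \<in> unit_disc \<Longrightarrow> p z + z * deriv p z / (of_real \<eta> * p z + of_real \<gamma>) \<in> ball 1 E"
    and "0 < r" "0 < E" "0 \<le> \<eta>"
    and lo: "- (r / (E + r)) \<le> \<eta> * (1 - r) + \<gamma>" and hi: "(E - r) * (\<eta> * (1 + r) + \<gamma>) \<le> r"
  shows "p ` unit_disc \<subseteq> qcurve r 0 ` unit_disc"
proof (rule briot_bouquet_curve[OF _ _ hp p0 ne hF T])
  fix \<zeta> P :: complex and M :: real
  assume \<zeta>: "norm \<zeta> = 1" and M: "M \<ge> 1" and P: "P = of_real \<eta> * qcurve r 0 \<zeta> + of_real \<gamma>" and "P \<noteq> 0"
  define c where "c = \<eta> + \<gamma>"
  have Pc: "P = of_real c + of_real (\<eta> * r) * \<zeta>" by (simp add: P c_def qcurve_def algebra_simps)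
  \<comment> \<open>This is \<open>r^2 |P + M|^2 - E^2 |P|^2\<close> as a function of
    \<open>x = Re \<zeta>\<close>.\<close>
  define G where "G x = r\<^sup>2 * (c\<^sup>2 + 2 * c * (\<eta> * r) * x + (\<eta> * r)\<^sup>2 + 2 * M * (c + \<eta> * r * x) + M\<^sup>2)
      - E\<^sup>2 * (c\<^sup>2 + 2 * c * (\<eta> * r) * x + (\<eta> * r)\<^sup>2)" for x :: real
  have real: "E\<^sup>2 * t\<^sup>2 \<le> r\<^sup>2 * (t + M)\<^sup>2" if "- (r / (E + r)) \<le> t" "(E - r) * t \<le> r" for t :: real
  proof -
    have "E * \<bar>t\<bar> \<le> r * (t + M)"
    proof (cases "t \<ge> 0")
      case True
      have "r * 1 \<le> r * M" using \<open>0 < r\<close> M by simp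
      then show ?thesis using that(2) True by (simp add: algebra_simps)
    next
      case False
      have "- t * (E + r) \<le> r" using that(1) \<open>0 < r\<close> \<open>0 < E\<close> by (simp add: field_simps)
      moreover have "r * 1 \<le> r * M" using \<open>0 < r\<close> M by simp
      ultimately show ?thesis using False by (simp add: algebra_simps)
    qed
    then have "(E * \<bar>t\<bar>)\<^sup>2 \<le> (r * (t + M))\<^sup>2" using \<open>0 < E\<close> by (intro power_mono) auto
    then show ?thesis by (simp add: power_mult_distrib)
  qed
  have "0 \<le> \<eta> * r" using assms by simp
  have "G 1 \<ge> 0"
  proof -
    have "- (r / (E + r)) \<le> c + \<eta> * r" "(E - r) * (c + \<eta> * r) \<le> r"
      using lo hi \<open>0 \<le> \<eta> * r\<close> by (auto simp: c_def algebra_simps)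
    from real[OF this] show ?thesis by (simp add: G_def power2_eq_square algebra_simps)
  qed
  moreover have "G (-1) \<ge> 0"
  proof -
    have 1: "- (r / (E + r)) \<le> c - \<eta> * r" using lo by (simp add: c_def algebra_simps)
    have "(E - r) * (c - \<eta> * r) \<le> r"
    proof (cases "E \<ge> r")
      case True
      then have "(E - r) * (c - \<eta> * r) \<le> (E - r) * (c + \<eta> * r)"
        using \<open>0 \<le> \<eta> * r\<close> by (intro mult_left_mono) auto
      then show ?thesis using hi by (simp add: c_def algebra_simps)
    next
      case False
      then have "(E - r) * (c - \<eta> * r) \<le> (E - r) * (- (r / (E + r)))"
        using 1 by (intro mult_left_mono_neg) auto
      also have "\<dots> = r * ((r - E) / (E + r))" by (simp add: divide_inverse algebra_simps)
      also have "\<dots> \<le> r * 1" using assms by (intro mult_left_mono) (auto simp: field_simps)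
      finally show ?thesis by simp
    qed
    from real[OF 1 this] show ?thesis by (simp add: G_def power2_eq_square algebra_simps)
  qed
  ultimately have G: "G (Re \<zeta>) \<ge> 0"
  proof -
    assume G1: "G 1 \<ge> 0" and G2: "G (-1) \<ge> 0"
    have "\<bar>Re \<zeta>\<bar> \<le> 1" using abs_Re_le_cmod[of \<zeta>] \<zeta> by simp
    then have "0 \<le> (1 + Re \<zeta>) * G 1" "0 \<le> (1 - Re \<zeta>) * G (-1)"
      using G1 G2 by auto
    moreover
    have "2 * G x = (1 + x) * G 1 + (1 - x) * G (-1)" for x
      by (simp add: G_def algebra_simps)
    note e = this[of "Re \<zeta>"]
    ultimately show ?thesis using e by linarith
  qed
  have xy: "(Re \<zeta>)\<^sup>2 + (Im \<zeta>)\<^sup>2 = 1" using \<zeta> by (simp add: cmod_def)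
  have P2: "(norm P)\<^sup>2 = c\<^sup>2 + 2 * c * (\<eta> * r) * Re \<zeta> + (\<eta> * r)\<^sup>2"
  proof -
    have "(norm P)\<^sup>2 = c\<^sup>2 + 2 * c * (\<eta> * r) * Re \<zeta> + (\<eta> * r)\<^sup>2 * ((Re \<zeta>)\<^sup>2 + (Im \<zeta>)\<^sup>2)"
      unfolding cmod_power2 Pc by (simp add: power2_eq_square algebra_simps)
    then show ?thesis by (simp add: xy)
  qed
  have PM: "(norm (P + of_real M))\<^sup>2 = (norm P)\<^sup>2 + 2 * M * (c + \<eta> * r * Re \<zeta>) + M\<^sup>2"
    unfolding cmod_power2 Pc by (simp add: power2_eq_square algebra_simps)
  have "E\<^sup>2 * (norm P)\<^sup>2 \<le> r\<^sup>2 * (norm (P + of_real M))\<^sup>2"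
    using G unfolding PM P2 G_def by (simp add: algebra_simps)
  then have "(E * norm P)\<^sup>2 \<le> (r * norm (P + of_real M))\<^sup>2" by (simp add: power_mult_distrib)
  then have le: "E * norm P \<le> r * norm (P + of_real M)"
    by (rule power2_le_imp_le) (use \<open>0 < r\<close> in simp)
  define F where "F = qcurve r 0 \<zeta> + of_real M * (of_real r * \<zeta> + 2 * of_real 0 * \<zeta>\<^sup>2) / P"
  have "F - 1 = of_real r * \<zeta> * (P + of_real M) / P"
    using \<open>P \<noteq> 0\<close> by (simp add: F_def qcurve_def field_simps)
  then have "norm (F - 1) = r * norm (P + of_real M) / norm P"
    using \<zeta> \<open>0 < r\<close> by (simp add: norm_mult norm_divide)
  also have "\<dots> \<ge> E" using le by (subst pos_le_divide_eq) (use \<open>P \<noteq> 0\<close> in auto)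
  finally have "E \<le> norm (F - 1)" .
  then have "F \<notin> ball 1 E" unfolding mem_ball dist_norm norm_minus_commute[of 1] by linarith
  then show "qcurve r 0 \<zeta> + of_real M * (of_real r * \<zeta> + 2 * of_real 0 * \<zeta>\<^sup>2) / P \<notin> ball 1 E"
    unfolding F_def .
qed (use \<open>0 < r\<close> in auto)

section \<open>Limacons and discs inside \<open>cosh_sqrt (D)\<close>\<close>

text \<open>On the limacon \<open>|F - 1|^2 < s^2 (2 |F| + 2 - s^2)\<close>. Estimating
  \<open>2 g |F|\<close> by \<open>|F|^2 + g^2\<close> removes the isolated modulus at the cost
  \<open>s^2 (|F| - g)^2\<close>. Thus every \<open>g > s^2\<close> yields a disc around the
  limacon, whose circle meets the boundary of the limacon where \<open>|F| = g\<close>.\<close>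

lemma limacon_disc:
  fixes \<omega> :: complex and s g :: real
  assumes w: "norm \<omega> < s" and s: "s \<le> 1" and g: "g > 0"
  defines "F \<equiv> (1 + \<omega>)\<^sup>2"
  shows "(g - s\<^sup>2) * (norm F)\<^sup>2 - 2 * g * Re F + g * (1 - s\<^sup>2)\<^sup>2 - s\<^sup>2 * g\<^sup>2 < 0"
proof -
  define n where "n = (norm (1 + \<omega>))\<^sup>2"
  define W where "W = (norm \<omega>)\<^sup>2"
  have F: "norm F = n" by (simp add: F_def n_def norm_power)
  have W: "0 \<le> W" "W < s\<^sup>2" using w by (auto simp: W_def intro!: power_strict_mono)
  have "s\<^sup>2 \<le> 1" using s w norm_ge_zero[of \<omega>] by (intro power_le_one) linarith+
  have n0: "n \<ge> 0" by (simp add: n_def)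
  have "(norm (F - 1))\<^sup>2 = W * (norm (2 + \<omega>))\<^sup>2"
  proof -
    have "F - 1 = \<omega> * (2 + \<omega>)" by (simp add: F_def power2_eq_square algebra_simps)
    then show ?thesis by (simp add: W_def norm_mult power_mult_distrib)
  qed
  also have "(norm (2 + \<omega>))\<^sup>2 = 2 * n + 2 - W"
    unfolding n_def W_def cmod_power2 by (simp add: power2_eq_square algebra_simps)
  finally have F1: "(norm (F - 1))\<^sup>2 = W * (2 * n + 2 - W)" .
  have F2: "(norm (F - 1))\<^sup>2 = n\<^sup>2 - 2 * Re F + 1"
    unfolding F[symmetric] cmod_power2 by (simp add: power2_eq_square algebra_simps)
  have "(g - s\<^sup>2) * n\<^sup>2 - 2 * g * Re F + g * (1 - s\<^sup>2)\<^sup>2 - s\<^sup>2 * g\<^sup>2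
      = g * ((n\<^sup>2 - 2 * Re F + 1) - s\<^sup>2 * (2 * n + 2 - s\<^sup>2)) - s\<^sup>2 * (n - g)\<^sup>2"
    by (simp add: power2_eq_square algebra_simps)
  also have "\<dots> = - (g * ((s\<^sup>2 - W) * (2 * n + 2 - W - s\<^sup>2))) - s\<^sup>2 * (n - g)\<^sup>2"
    unfolding F2[symmetric] F1 by (simp add: algebra_simps)
  also have "\<dots> < 0"
  proof -
    have "0 < g * ((s\<^sup>2 - W) * (2 * n + 2 - W - s\<^sup>2))"
      using g W n0 \<open>s\<^sup>2 \<le> 1\<close> by (intro mult_pos_pos) auto
    moreover have "0 \<le> s\<^sup>2 * (n - g)\<^sup>2" by simp
    ultimately show ?thesis by linarith
  qed
  finally show ?thesis unfolding F .
qed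

lemma cosh_root_bounds:
  defines "\<sigma> \<equiv> sqrt (cosh 1) - 1"
  shows "cosh 1 = (1 + \<sigma>)\<^sup>2" "242207 / 1000000 < \<sigma>" "\<sigma> < 242209 / 1000000"
proof -
  show C: "cosh 1 = (1 + \<sigma>)\<^sup>2" by (simp add: \<sigma>_def)
  have "1 + 242207 / 1000000 < sqrt (cosh 1)"
    by (rule real_less_rsqrt) (use cosh_1_bounds in \<open>simp add: power2_eq_square\<close>)
  moreover have "sqrt (cosh 1) < 1 + 242209 / 1000000"
    by (rule real_less_lsqrt) (use cosh_1_bounds in \<open>simp_all add: power2_eq_square\<close>)
  ultimately show "242207 / 1000000 < \<sigma>" "\<sigma> < 242209 / 1000000" by (simp_all add: \<sigma>_def)
qed

text \<open>Both boundaries pass through \<open>cosh 1\<close>. Each point of the boundary curve of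
  \<open>cosh_sqrt\<close> is tested against one enclosing disc of the limacon, with
  \<open>g\<close> depending on the point; after taking out the factor \<open>\<xi>\<close>, a cubic
  has to be nonnegative on \<open>[0, 2]\<close>.\<close>

lemma limacon_subset_cosh_sqrt:
  defines "\<sigma> \<equiv> sqrt (cosh 1) - 1"
  shows "qcurve (2 * \<sigma>) (\<sigma>\<^sup>2) ` unit_disc \<subseteq> cosh_sqrt ` unit_disc"
proof (rule connected_subset_cosh_sqrt_disc)
  note \<sigma> = cosh_root_bounds[folded \<sigma>_def]
  let ?C = "cosh (1::real)"
  show "connected (qcurve (2 * \<sigma>) (\<sigma>\<^sup>2) ` unit_disc)"
    unfolding qcurve_def by (intro connected_continuous_image continuous_intros connected_ball)
  show "1 \<in> qcurve (2 * \<sigma>) (\<sigma>\<^sup>2) ` unit_disc"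
    by (rule image_eqI[of _ _ 0]) (auto simp: qcurve_def)
  fix z :: complex assume z: "norm z = 1"
  define \<xi> where "\<xi> = 1 - Re z"
  define \<Phi> where "\<Phi> = of_real ?C - cosh_sqrt z"
  note b = cosh_sqrt_circle[OF z, folded \<xi>_def, folded \<Phi>_def]
  show "cosh_sqrt z \<notin> qcurve (2 * \<sigma>) (\<sigma>\<^sup>2) ` unit_disc"
  proof
    assume "cosh_sqrt z \<in> qcurve (2 * \<sigma>) (\<sigma>\<^sup>2) ` unit_disc"
    then obtain v where v: "norm v < 1" "cosh_sqrt z = (1 + of_real \<sigma> * v)\<^sup>2"
      by (auto simp: qcurve_def power2_eq_square algebra_simps)
    \<comment> \<open>A linear guess for \<open>|cosh_sqrt z|\<close>: exact at
      \<open>z = 1\<close>, and at \<open>z = -1\<close> it gives \<open>cosh 1 - 1\<close> for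
      \<open>cos 1\<close>, off by less than \<open>0.003\<close>.\<close>
    define g where "g = ?C - \<xi> / 2"
    define F where "F = cosh_sqrt z"
    have "norm (of_real \<sigma> * v) < \<sigma>" using v(1) \<sigma> by (simp add: norm_mult)
    moreover have "g > 0" using b(3,4) cosh_1_bounds by (simp add: g_def)
    ultimately have neg: "(g - \<sigma>\<^sup>2) * (norm F)\<^sup>2 - 2 * g * Re F + g * (1 - \<sigma>\<^sup>2)\<^sup>2 - \<sigma>\<^sup>2 * g\<^sup>2 < 0"
      using limacon_disc[of "of_real \<sigma> * v" \<sigma> g] \<sigma> v(2) by (simp add: F_def)
    have F: "F = of_real ?C - \<Phi>" by (simp add: F_def \<Phi>_def)
    have nF: "(norm F)\<^sup>2 = ?C\<^sup>2 - 2 * ?C * Re \<Phi> + (norm \<Phi>)\<^sup>2"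
      unfolding F cmod_power2 by (simp add: power2_eq_square algebra_simps)
    have rF: "Re F = ?C - Re \<Phi>" by (simp add: F)
    \<comment> \<open>Written in the gap \<open>\<Phi>\<close>, the expression has no constant term,
      because \<open>(1 + \<sigma>)^2 = cosh 1\<close>.\<close>
    have eq: "(g - \<sigma>\<^sup>2) * (norm F)\<^sup>2 - 2 * g * Re F + g * (1 - \<sigma>\<^sup>2)\<^sup>2 - \<sigma>\<^sup>2 * g\<^sup>2
        = (1 + 2 * \<sigma> - \<xi> / 2) * (norm \<Phi>)\<^sup>2 - 2 * (2 * \<sigma> * ?C - \<xi> * (?C - 1) / 2) * Re \<Phi> - \<sigma>\<^sup>2 * \<xi>\<^sup>2 / 4"
      unfolding nF rF g_def \<sigma>(1) by (simp add: power2_eq_square field_simps)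
    define w where "w = (178929 - 27432 * \<xi> + 1564 * \<xi>\<^sup>2) / 518400 - 3 / 24500"
    define r where "r = 2 / 3 - \<xi> / 12 + (9 - 12 * \<xi> + 4 * \<xi>\<^sup>2) / 720 + 1 / 2450"
    have x2: "0 \<le> \<xi>\<^sup>2" "\<xi>\<^sup>2 \<le> 2 * \<xi>"
      using b(3,4) by (auto simp: power2_eq_square mult_right_mono)
    have x3: "0 \<le> \<xi> ^ 3" "\<xi> ^ 3 \<le> 2 * \<xi>\<^sup>2"
      using b(3) mult_right_mono[OF b(4), of "\<xi> * \<xi>"] by (auto simp: power2_eq_square power3_eq_cube mult_ac)
    have "0 \<le> 43822053 + (383180 * \<xi>\<^sup>2 - 6720840 * \<xi>)" using x2 b(3,4) by linarith
    then have w0: "w \<ge> 0" by (simp add: w_def field_simps)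
    have "0 \<le> (9 - 12 * \<xi> + 4 * \<xi>\<^sup>2) + 15" using x2 b(3,4) by linarith
    then have r0: "r \<ge> 0" unfolding r_def using b(3,4) by argo
    have A1: "(14844 / 10000 - \<xi> / 2) * (2 * \<xi> * w) \<le> (1 + 2 * \<sigma> - \<xi> / 2) * (norm \<Phi>)\<^sup>2"
      using b(1,3,4) \<sigma> w0 by (intro mult_mono) (auto simp: w_def)
    have A2: "2 * (2 * \<sigma> * ?C - \<xi> * (?C - 1) / 2) * Re \<Phi> \<le> 2 * (7476 / 10000 - \<xi> * (2715 / 10000)) * (\<xi> * r)"
    proof -
      have sC: "\<sigma> * ?C \<le> (242209 / 1000000) * (1543081 / 1000000)"
        using \<sigma>(2,3) cosh_1_bounds by (intro mult_mono) auto
      have sC': "(242207 / 1000000) * (1543080 / 1000000) \<le> \<sigma> * ?C"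
        using \<sigma>(2,3) cosh_1_bounds by (intro mult_mono) auto
      have xC: "\<xi> * (543 / 1000) \<le> \<xi> * (?C - 1)" "\<xi> * (?C - 1) \<le> 2 * (5431 / 10000)"
        using b(3,4) cosh_1_bounds mult_left_mono[of "543 / 1000" "?C - 1" \<xi>] mult_mono[of \<xi> 2 "?C - 1" "5431 / 10000"]
        by simp_all
      have "(2 * \<sigma> * ?C - \<xi> * (?C - 1) / 2) * Re \<Phi> \<le> (2 * \<sigma> * ?C - \<xi> * (?C - 1) / 2) * (\<xi> * r)"
        using b(2) sC' xC by (intro mult_left_mono) (auto simp: r_def)
      also have "\<dots> \<le> (7476 / 10000 - \<xi> * (2715 / 10000)) * (\<xi> * r)"
        using sC xC r0 b(3) by (intro mult_right_mono) auto
      finally show ?thesis by (simp only: mult.assoc mult_le_cancel_left_pos zero_less_numeral)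
    qed
    have A3: "\<sigma>\<^sup>2 * \<xi>\<^sup>2 / 4 \<le> \<xi> * (147 / 10000 * \<xi>)"
    proof -
      have "\<sigma>\<^sup>2 \<le> (242209 / 1000000)\<^sup>2" using \<sigma> by (intro power_mono) auto
      then have "\<sigma>\<^sup>2 * \<xi>\<^sup>2 \<le> (588 / 10000) * \<xi>\<^sup>2" by (intro mult_right_mono) (auto simp: power2_eq_square)
      then show ?thesis by (simp add: power2_eq_square)
    qed
    have A4: "0 \<le> \<xi> * (2 * (14844 / 10000 - \<xi> / 2) * w - 2 * (7476 / 10000 - \<xi> * (2715 / 10000)) * r - 147 / 10000 * \<xi>)"
    proof -
      have "2 * (14844 / 10000 - \<xi> / 2) * w - 2 * (7476 / 10000 - \<xi> * (2715 / 10000)) * r - 147 / 10000 * \<xi>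
          = (16142683/1960000000) + (332481/196000000) * \<xi> + (-39593/54000000) * \<xi>\<^sup>2 + (-1/3240000) * \<xi> ^ 3"
        unfolding w_def r_def by (simp add: field_simps power2_eq_square power3_eq_cube)
      also have "\<dots> \<ge> 0" using x2 x3 b(3,4) by linarith
      finally have "2 * (14844 / 10000 - \<xi> / 2) * w - 2 * (7476 / 10000 - \<xi> * (2715 / 10000)) * r - 147 / 10000 * \<xi> \<ge> 0" .
      then show ?thesis using b(3) by (intro mult_nonneg_nonneg)
    qed
    have "\<xi> * (2 * (14844 / 10000 - \<xi> / 2) * w - 2 * (7476 / 10000 - \<xi> * (2715 / 10000)) * r - 147 / 10000 * \<xi>)
        = (14844 / 10000 - \<xi> / 2) * (2 * \<xi> * w) - 2 * (7476 / 10000 - \<xi> * (2715 / 10000)) * (\<xi> * r) - \<xi> * (147 / 10000 * \<xi>)"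
      by (simp add: algebra_simps)
    then show False using neg A1 A2 A3 A4 unfolding eq by argo
  qed
qed

lemma disc_subset_cosh_sqrt:
  assumes "connected T" "1 \<in> T" and "\<And>y. y \<in> T \<Longrightarrow> (norm (of_real (cosh 1) - y))\<^sup>2 < Re (of_real (cosh 1) - y)"
  shows "T \<subseteq> cosh_sqrt ` unit_disc"
  using assms(1,2)
proof (rule connected_subset_cosh_sqrt_disc)
  show "cosh_sqrt z \<notin> T" if "norm z = 1" for z
    using cosh_sqrt_circle_disc[OF that] assms(3)[of "cosh_sqrt z"] by auto
qed

section \<open>Targets with \<open>E \<ge> 5 / 4\<close>\<close>

text \<open>Here \<open>p\<close> is compared with \<open>1 - \<delta> + \<delta> (1 + \<rho> v)\<^sup>2\<close>, whose value \<open>1 - \<delta>\<close> at the critical point is the zero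
  of \<open>\<eta> p + \<gamma>\<close>, so that \<open>\<eta> p + \<gamma> = (\<eta> + \<gamma>) (1 + \<rho> v)\<^sup>2\<close> is a square.\<close>

lemma briot_bouquet_square:
  fixes \<eta> \<gamma> \<rho> E :: real
  assumes hp: "p holomorphic_on unit_disc" and p0: "p 0 = 1"
    and hF: "(\<lambda>z. p z + z * deriv p z / (of_real \<eta> * p z + of_real \<gamma>)) holomorphic_on unit_disc"
    and T: "\<And>z. z \<in> unit_disc \<Longrightarrow> p z + z * deriv p z / (of_real \<eta> * p z + of_real \<gamma>) \<in> ball 1 E"
    and \<rho>: "0 < \<rho>" "\<rho> < 1" and \<eta>: "\<eta> > 0" and c: "\<eta> + \<gamma> > 0"
  defines "\<delta> \<equiv> (\<eta> + \<gamma>) / \<eta>"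
  assumes main: "\<And>Z. 0 < Z \<Longrightarrow> Z \<le> (1 + \<rho>)\<^sup>2 \<Longrightarrow>
      E * Z \<le> \<rho> * ((1 / \<eta>) * (Z + (1 - \<rho>\<^sup>2)) + \<delta> * ((1 + (1 - \<rho>\<^sup>2) / 2) * Z + Z\<^sup>2 / 2))"
  shows "p ` unit_disc \<subseteq> qcurve (2 * \<delta> * \<rho>) (\<delta> * \<rho>\<^sup>2) ` unit_disc"
proof (rule briot_bouquet_curve[OF _ _ hp p0 _ hF T])
  have \<delta>: "\<delta> > 0" using \<eta> c by (simp add: \<delta>_def)
  then show "0 \<le> \<delta> * \<rho>\<^sup>2" by simp
  show "2 * (\<delta> * \<rho>\<^sup>2) < 2 * \<delta> * \<rho>"
    using \<delta> \<rho> by (simp add: power2_eq_square)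
  show "\<gamma> \<noteq> - \<eta>" using c by simp
  fix \<zeta> P :: complex and M :: real
  assume \<zeta>: "norm \<zeta> = 1" and M: "M \<ge> 1"
    and P: "P = of_real \<eta> * qcurve (2 * \<delta> * \<rho>) (\<delta> * \<rho>\<^sup>2) \<zeta> + of_real \<gamma>" and "P \<noteq> 0"
  define U where "U = 1 + of_real \<rho> * \<zeta>"
  have Pc: "P = of_real (\<eta> * \<delta>) * U\<^sup>2"
  proof -
    have "\<eta> + \<gamma> = \<eta> * \<delta>" using \<eta> by (simp add: \<delta>_def)
    then have "of_real \<gamma> = of_real (\<eta> * \<delta>) - (of_real \<eta> :: complex)"
      unfolding of_real_diff[symmetric] by (intro arg_cong[of _ _ of_real]) simp
    then show ?thesis unfolding P U_def qcurve_def by (simp add: power2_eq_square algebra_simps)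
  qed
  have U0: "U \<noteq> 0" using \<open>P \<noteq> 0\<close> by (auto simp: Pc)
  define F where "F = qcurve (2 * \<delta> * \<rho>) (\<delta> * \<rho>\<^sup>2) \<zeta>
     + of_real M * (of_real (2 * \<delta> * \<rho>) * \<zeta> + 2 * of_real (\<delta> * \<rho>\<^sup>2) * \<zeta>\<^sup>2) / P"
  have "of_real (2 * \<delta> * \<rho>) * \<zeta> + 2 * of_real (\<delta> * \<rho>\<^sup>2) * \<zeta>\<^sup>2 = of_real (2 * \<delta> * \<rho>) * \<zeta> * U"
    by (simp add: U_def power2_eq_square algebra_simps)
  then have "of_real M * (of_real (2 * \<delta> * \<rho>) * \<zeta> + 2 * of_real (\<delta> * \<rho>\<^sup>2) * \<zeta>\<^sup>2) / P
      = of_real (\<delta> * \<rho>) * \<zeta> * (of_real (2 * M / (\<eta> * \<delta>)) / U)"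
    using U0 \<delta> \<eta> by (simp add: Pc power2_eq_square)
  moreover have "qcurve (2 * \<delta> * \<rho>) (\<delta> * \<rho>\<^sup>2) \<zeta> - 1 = of_real (\<delta> * \<rho>) * \<zeta> * (1 + U)"
    by (simp add: qcurve_def U_def power2_eq_square algebra_simps)
  \<comment> \<open>As \<open>P\<close> is a multiple of \<open>U^2\<close>, one factor
    \<open>U\<close> cancels against the derivative of the curve and only \<open>1 / U\<close>
    remains.\<close>
  ultimately have "F - 1 = of_real (\<delta> * \<rho>) * \<zeta> * (1 + U + of_real (2 * M / (\<eta> * \<delta>)) / U)"
    unfolding F_def by (simp only: ring_distribs add_diff_eq[symmetric] add.commute)
      (simp add: algebra_simps)
  then have nF: "norm (F - 1) = \<delta> * \<rho> * norm (1 + U + of_real (2 * M / (\<eta> * \<delta>)) / U)"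
    using \<zeta> \<delta> \<rho> by (simp add: norm_mult)
  define Z where "Z = (norm U)\<^sup>2"
  define X where "X = Re U"
  have Z0: "Z > 0" using U0 by (simp add: Z_def)
  have "norm U \<le> 1 + \<rho>"
    unfolding U_def using \<zeta> \<rho> by (intro order_trans[OF norm_triangle_ineq]) (simp add: norm_mult)
  then have Z1: "Z \<le> (1 + \<rho>)\<^sup>2" unfolding Z_def by (intro power_mono) auto
  have "(norm (U - 1))\<^sup>2 = \<rho>\<^sup>2" using \<zeta> \<rho> by (simp add: U_def norm_mult)
  then have ZX: "Z = 2 * X - (1 - \<rho>\<^sup>2)"
    unfolding Z_def X_def cmod_power2 by (simp add: power2_eq_square algebra_simps)
  have "\<rho>\<^sup>2 < 1" using \<rho> by (simp add: power_less_one_iff)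
  then have X0: "X > 0" using ZX Z0 by simp
  \<comment> \<open>\<open>U\<close> and hence \<open>1 / U\<close> lie in the right half-plane. The
    real part of the bracket therefore grows with \<open>M\<close>, and \<open>M = 1\<close> is the
    worst case.\<close>
  have "Re (of_real (2 * M / (\<eta> * \<delta>)) / U) = 2 * M / (\<eta> * \<delta>) * (X / Z)"
    unfolding divide_inverse[of _ U] times_complex.simps X_def Z_def cmod_power2 Re_complex_of_real Im_complex_of_real inverse_complex.simps by simp
  moreover have "2 * 1 / (\<eta> * \<delta>) * (X / Z) \<le> 2 * M / (\<eta> * \<delta>) * (X / Z)"
    using M \<eta> \<delta> X0 Z0 by (intro mult_right_mono divide_right_mono) auto
  ultimately have "1 + X + 2 / (\<eta> * \<delta>) * (X / Z) \<le> Re (1 + U + of_real (2 * M / (\<eta> * \<delta>)) / U)"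
    by (simp add: X_def)
  also have "\<dots> \<le> norm (1 + U + of_real (2 * M / (\<eta> * \<delta>)) / U)" by (rule complex_Re_le_cmod)
  finally have "\<delta> * \<rho> * (1 + X + 2 / (\<eta> * \<delta>) * (X / Z)) \<le> norm (F - 1)"
    unfolding nF using \<delta> \<rho> by (intro mult_left_mono) auto
  moreover have "E \<le> \<delta> * \<rho> * (1 + X + 2 / (\<eta> * \<delta>) * (X / Z))"
  proof -
    \<comment> \<open>The right-hand side of \<open>main\<close> is this bound times
      \<open>Z\<close>, expressed in \<open>Z\<close> alone through
      \<open>2 X = Z + 1 - \<rho>^2\<close>.\<close>
    have "\<rho> * ((1 / \<eta>) * (Z + (1 - \<rho>\<^sup>2)) + \<delta> * ((1 + (1 - \<rho>\<^sup>2) / 2) * Z + Z\<^sup>2 / 2))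
       = \<delta> * \<rho> * (1 + X + 2 / (\<eta> * \<delta>) * (X / Z)) * Z"
    proof -
      have r: "1 - \<rho>\<^sup>2 = 2 * X - Z" using ZX by simp
      show ?thesis unfolding r using Z0 \<delta> \<eta> by (simp add: power2_eq_square field_simps)
    qed
    with main[OF Z0 Z1] have "E * Z \<le> \<delta> * \<rho> * (1 + X + 2 / (\<eta> * \<delta>) * (X / Z)) * Z" by (simp only:)
    then show ?thesis using Z0 by (rule mult_right_le_imp_le)
  qed
  ultimately have "E \<le> norm (F - 1)" by linarith
  then have "F \<notin> ball 1 E" unfolding mem_ball dist_norm norm_minus_commute[of 1] by linarith
  then show "qcurve (2 * \<delta> * \<rho>) (\<delta> * \<rho>\<^sup>2) \<zeta>
     + of_real M * (of_real (2 * \<delta> * \<rho>) * \<zeta> + 2 * of_real (\<delta> * \<rho>\<^sup>2) * \<zeta>\<^sup>2) / P \<notin> ball 1 E"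
    unfolding F_def .
qed

text \<open>For \<open>t = 1\<close> the curve ends at \<open>cosh 1\<close>; smaller
  \<open>t\<close> shrink it towards 1. Membership in the disc with diameter
  \<open>[cosh 1 - 1, cosh 1]\<close> splits into a term with factor \<open>1 - |v|^2\<close> and a
  term with factor \<open>1 - Re v\<close>; \<open>main\<close> is the nonnegativity of the second
  cofactor at \<open>Re v = 1\<close>, its worst case.\<close>

lemma qcurve_subset_cosh_sqrt:
  fixes \<alpha> \<beta> t :: real
  assumes ab: "0 \<le> \<beta>" "2 * \<beta> < \<alpha>" "\<alpha> + \<beta> = cosh 1 - 1"
    and main: "(2 * cosh 1 - 3) * (\<alpha> + 4 * \<beta>) \<le> 2 * \<alpha> * \<beta>"
    and t: "0 \<le> t" "t \<le> 1"
  shows "qcurve (t * \<alpha>) (t * \<beta>) ` unit_disc \<subseteq> cosh_sqrt ` unit_disc"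
proof (rule disc_subset_cosh_sqrt)
  show "connected (qcurve (t * \<alpha>) (t * \<beta>) ` unit_disc)"
    unfolding qcurve_def by (intro connected_continuous_image continuous_intros connected_ball)
  show "1 \<in> qcurve (t * \<alpha>) (t * \<beta>) ` unit_disc"
    by (rule image_eqI[of _ _ 0]) (auto simp: qcurve_def)
  fix y assume "y \<in> qcurve (t * \<alpha>) (t * \<beta>) ` unit_disc"
  then obtain v where v: "norm v < 1" and y: "y = qcurve (t * \<alpha>) (t * \<beta>) v" by auto
  define x where "x = Re v"
  define n where "n = (norm v)\<^sup>2"
  define d where "d = 2 * cosh 1 - (3::real)"
  define u where "u = of_real \<alpha> * v + of_real \<beta> * v\<^sup>2"
  have d: "0 < d" using cosh_1_bounds by (simp add: d_def)
  have x: "-1 \<le> x" "x \<le> 1" using v abs_Re_le_cmod[of v] by (auto simp: x_def)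
  have n: "0 \<le> n" "n < 1" "n = x\<^sup>2 + (Im v)\<^sup>2" using v by (simp_all only: n_def x_def cmod_power2[symmetric]) (simp_all add: power_less_one_iff)
  have u1: "(norm u)\<^sup>2 = n * (\<alpha>\<^sup>2 + \<beta>\<^sup>2 * n + 2 * \<alpha> * \<beta> * x)"
    unfolding u_def cmod_power2 n(3) x_def by (simp add: power2_eq_square algebra_simps)
  have u2: "Re u = \<alpha> * x + \<beta> * (2 * x\<^sup>2 - n)"
    unfolding u_def n(3) x_def by (simp add: power2_eq_square algebra_simps)
  have "(norm u)\<^sup>2 - d * Re u < (cosh 1 - 1)\<^sup>2 - d * (cosh 1 - 1)"
  proof -
    have a: "0 < \<alpha>\<^sup>2 + 2 * \<alpha> * \<beta> * x"
    proof -
      have "2 * \<beta> * (- x) \<le> 2 * \<beta> * 1" using ab x by (intro mult_left_mono) auto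
      then have "0 < \<alpha> * (\<alpha> + 2 * \<beta> * x)" using ab by (intro mult_pos_pos) auto
      then show ?thesis by (simp add: power2_eq_square algebra_simps)
    qed
    have "0 < (1 - n) * (\<alpha>\<^sup>2 + 2 * \<alpha> * \<beta> * x + d * \<beta> + \<beta>\<^sup>2 * (1 + n))"
    proof (rule mult_pos_pos)
      have "0 \<le> d * \<beta>" "0 \<le> \<beta>\<^sup>2 * (1 + n)" using d ab n by simp_all
      with a show "0 < \<alpha>\<^sup>2 + 2 * \<alpha> * \<beta> * x + d * \<beta> + \<beta>\<^sup>2 * (1 + n)" by linarith
    qed (use n in simp)
    moreover have "0 \<le> (1 - x) * (2 * \<alpha> * \<beta> - d * \<alpha> - 2 * d * \<beta> * (1 + x))"
    proof (rule mult_nonneg_nonneg)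
      have "d * \<beta> * (1 + x) \<le> d * \<beta> * 2" using d ab x by (intro mult_left_mono) auto
      then show "0 \<le> 2 * \<alpha> * \<beta> - d * \<alpha> - 2 * d * \<beta> * (1 + x)"
        using main unfolding d_def[symmetric] by (simp add: algebra_simps)
    qed (use x in simp)
    ultimately show ?thesis unfolding u1 u2 ab(3)[symmetric] by (simp add: power2_eq_square algebra_simps)
  qed
  moreover have "(cosh 1 - 1)\<^sup>2 - d * (cosh 1 - 1) = (cosh 1 - 1) * (2 - cosh (1::real))"
    by (simp add: d_def power2_eq_square algebra_simps)
  ultimately have lt: "(norm u)\<^sup>2 - d * Re u < (cosh 1 - 1) * (2 - cosh 1)" by simp
  have pos: "0 < (cosh 1 - 1) * (2 - cosh (1::real))" using cosh_1_bounds by (intro mult_pos_pos) auto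
  have "t * ((norm u)\<^sup>2 - d * Re u) < (cosh 1 - 1) * (2 - cosh 1)"
  proof (cases "t = 0")
    case False
    then have "t * ((norm u)\<^sup>2 - d * Re u) < t * ((cosh 1 - 1) * (2 - cosh 1))"
      using lt t by (intro mult_strict_left_mono) auto
    also have "\<dots> \<le> 1 * ((cosh 1 - 1) * (2 - cosh 1))"
      using t pos by (intro mult_right_mono) auto
    finally show ?thesis by simp
  qed (use pos in auto)
  moreover have "t\<^sup>2 * (norm u)\<^sup>2 \<le> t * (norm u)\<^sup>2"
    using t by (intro mult_right_mono) (auto simp: power2_eq_square mult_left_le)
  ultimately have "t\<^sup>2 * (norm u)\<^sup>2 - t * (d * Re u) < (cosh 1 - 1) * (2 - cosh 1)"
    by (simp add: algebra_simps)
  moreover have y': "of_real (cosh 1) - y = of_real (cosh 1 - 1) - of_real t * u"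
    by (simp add: y u_def qcurve_def algebra_simps)
  moreover have "(norm (of_real (cosh 1 - 1) - of_real t * u))\<^sup>2 = (cosh 1 - 1)\<^sup>2 - 2 * (cosh 1 - 1) * (t * Re u) + t\<^sup>2 * (norm u)\<^sup>2"
    unfolding cmod_power2 by (simp add: power2_eq_square algebra_simps)
  ultimately show "(norm (of_real (cosh 1) - y))\<^sup>2 < Re (of_real (cosh 1) - y)"
    unfolding y' by (simp add: d_def power2_eq_square algebra_simps)
qed

text \<open>The two lower bounds for \<open>\<theta>\<close> come from the conditions at \<open>cosh 1\<close> and at \<open>cos 1\<close>.\<close>

lemma square_exit_large:
  fixes E \<delta> \<theta> \<rho> Z :: real
  assumes E: "5 / 4 \<le> E" and \<rho>: "2 / 5 \<le> \<rho>" "\<rho> \<le> 9 / 10"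
    and \<delta>: "\<delta> > 0" "\<delta> * (\<rho> * (2 + \<rho>)) = cosh 1 - 1"
    and \<theta>: "2 * (E - (cosh 1 - 1)) * (cosh 1 - 1 + \<delta>) \<le> \<theta> * sinh 1"
    and Z: "0 < Z" "Z \<le> (1 + \<rho>)\<^sup>2"
  shows "E * Z \<le> \<rho> * (\<theta> * (Z + (1 - \<rho>\<^sup>2)) + \<delta> * ((1 + (1 - \<rho>\<^sup>2) / 2) * Z + Z\<^sup>2 / 2))"
proof -
  define \<epsilon> where "\<epsilon> = cosh 1 - (1::real)"
  define S where "S = sinh (1::real)"
  define T where "T = 1 + \<rho>"
  note num = cosh_1_bounds sinh_1_bounds
  have \<epsilon>: "54308 / 100000 < \<epsilon>" "\<epsilon> < 543081 / 1000000" using num by (auto simp: \<epsilon>_def)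
  have S: "0 < S" "S < 117521 / 100000" using num by (auto simp: S_def)
  have T: "7 / 5 \<le> T" "T \<le> 19 / 10" using \<rho> by (auto simp: T_def)
  define \<kappa> where "\<kappa> = T * (2 - T)"
  have \<kappa>: "1 - \<rho>\<^sup>2 = \<kappa>" by (simp add: \<kappa>_def T_def power2_eq_square algebra_simps)
  have \<kappa>0: "0 \<le> \<kappa>" using T by (simp add: \<kappa>_def)
  have \<theta>1: "2 * (E - \<epsilon>) * T\<^sup>2 * \<delta> / S \<le> \<theta>"
  proof -
    have "\<delta> * T\<^sup>2 = \<epsilon> + \<delta>" using \<delta>(2) by (simp add: \<epsilon>_def T_def power2_eq_square algebra_simps)
    then have "2 * (E - \<epsilon>) * T\<^sup>2 * \<delta> = 2 * (E - \<epsilon>) * (\<epsilon> + \<delta>)" by (simp only: mult.assoc mult.commute[of \<delta>])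
    with \<theta> S show ?thesis unfolding \<epsilon>_def S_def by (simp only: pos_divide_le_eq)
  qed
  have iS: "100000 / 117521 \<le> 1 / S" using S by (simp add: field_simps)
  have ie: "1 / \<epsilon> \<le> 100000 / 54308" using \<epsilon> by (simp add: field_simps)
  \<comment> \<open>Once \<open>\<theta>\<close> is replaced by its lower bound, the claim is affine
    in \<open>E\<close>: \<open>slope\<close> handles the coefficient of \<open>E\<close>, and
    \<open>base\<close> the value at \<open>E = 5 / 4\<close>.\<close>
  have slope: "Z * (1 + T) / \<epsilon> \<le> 2 * T\<^sup>2 / S * (Z + \<kappa>)"
  proof -
    have "(1 + T) * (1 / \<epsilon>) \<le> (1 + T) * (100000 / 54308)" using T ie by (intro mult_left_mono) auto
    also have "\<dots> \<le> 4 * T * (100000 / 117521)" using T by simp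
    also have "\<dots> \<le> 4 * T * (1 / S)" using T iS by (intro mult_left_mono) auto
    finally have "Z * ((1 + T) / \<epsilon>) \<le> Z * (4 * T / S)" using Z by (intro mult_left_mono) auto
    also have "\<dots> = 2 / S * (Z * (T * 2))" by simp
    also have "\<dots> = 2 / S * (Z * T\<^sup>2 + Z * \<kappa>)" by (simp add: \<kappa>_def power2_eq_square algebra_simps)
    also have "\<dots> \<le> 2 / S * (Z * T\<^sup>2 + T\<^sup>2 * \<kappa>)"
      using S Z(2) \<kappa>0 by (intro mult_left_mono add_left_mono mult_right_mono) (auto simp: T_def)
    also have "2 / S * (Z * T\<^sup>2 + T\<^sup>2 * \<kappa>) = 2 * T\<^sup>2 / S * (Z + \<kappa>)"
      unfolding mult.commute[of Z "T\<^sup>2"] distrib_left[symmetric] by simp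
    finally show ?thesis by simp
  qed
  have base: "5 / 4 * Z * (1 + T) / \<epsilon> \<le> 2 * (5 / 4 - \<epsilon>) * T\<^sup>2 / S * (Z + \<kappa>) + (1 + \<kappa> / 2) * Z + Z\<^sup>2 / 2"
  proof -
    \<comment> \<open>The coefficient of \<open>Z\<close> after rounding the constants. What remains
      is that a quadratic in \<open>Z\<close> has nonpositive discriminant.\<close>
    define b where "b = (703 / 1000) * T\<^sup>2 - (13017 / 10000) * T - 13017 / 10000"
    have "0 \<le> 2406 / 1000 * T ^ 3 * (2 - T) - b\<^sup>2"
    proof -
      \<comment> \<open>Expansion of the quartic in the distances to the ends of
        \<open>[7 / 5, 19 / 10]\<close>, where \<open>u + w = 1 / 2\<close>; all coefficients are
        positive.\<close>
      define u where "u = T - 7 / 5"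
      define w where "w = 19 / 10 - T"
      have "0 \<le> u" "0 \<le> w" using T by (auto simp: u_def w_def)
      then have "0 \<le> 22800599 / 1562500 * (u ^ 0 * w ^ 4) + 287771969 / 3125000 * (u ^ 1 * w ^ 3) + 4110320583 / 25000000 * (u ^ 2 * w ^ 2) + 573350809 / 6250000 * (u ^ 3 * w ^ 1) + 11985899 / 6250000 * (u ^ 4 * w ^ 0)"
        by simp
      also have "\<dots> = 2406 / 1000 * T ^ 3 * (2 - T) - b\<^sup>2"
        unfolding u_def w_def b_def by (simp add: field_simps power2_eq_square power3_eq_cube power4_eq_xxxx)
      finally show ?thesis .
    qed
    moreover have "0 \<le> (Z + b)\<^sup>2" by simp
    moreover have "(Z + b)\<^sup>2 = Z\<^sup>2 + 2 * (b * Z) + b\<^sup>2" by (simp add: power2_sum)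
    ultimately have q: "0 \<le> Z\<^sup>2 / 2 + b * Z + 1203 / 1000 * T ^ 3 * (2 - T)" by argo
    have "5 / 4 * Z * (1 + T) / \<epsilon> \<le> 23017 / 10000 * (Z * (1 + T))"
    proof -
      have "5 / 4 * (Z * (1 + T)) * (1 / \<epsilon>) \<le> 5 / 4 * (Z * (1 + T)) * (100000 / 54308)"
        using Z T ie by (intro mult_left_mono) auto
      also have "\<dots> \<le> 23017 / 10000 * (Z * (1 + T))" using Z T by simp
      finally show ?thesis by simp
    qed
    moreover have "1203 / 1000 * (T\<^sup>2 * (Z + \<kappa>)) \<le> 2 * (5 / 4 - \<epsilon>) * T\<^sup>2 / S * (Z + \<kappa>)"
    proof -
      have "1203 / 1000 \<le> 2 * (5 / 4 - \<epsilon>) / S" using S \<epsilon> by (simp add: field_simps)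
      then have "1203 / 1000 * (T\<^sup>2 * (Z + \<kappa>)) \<le> 2 * (5 / 4 - \<epsilon>) / S * (T\<^sup>2 * (Z + \<kappa>))"
        using Z \<kappa>0 by (intro mult_right_mono) auto
      then show ?thesis by simp
    qed
    moreover have "Z\<^sup>2 / 2 + b * Z + 1203 / 1000 * T ^ 3 * (2 - T)
       = 1203 / 1000 * (T\<^sup>2 * (Z + \<kappa>)) + (1 + \<kappa> / 2) * Z + Z\<^sup>2 / 2 - 23017 / 10000 * (Z * (1 + T))"
      unfolding b_def \<kappa>_def by (simp add: power2_eq_square power3_eq_cube field_simps)
    ultimately show ?thesis using q by linarith
  qed
  have "E * Z * (1 + T) / \<epsilon> \<le> 2 * (E - \<epsilon>) * T\<^sup>2 / S * (Z + \<kappa>) + (1 + \<kappa> / 2) * Z + Z\<^sup>2 / 2"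
  proof -
    have "(E - 5 / 4) * (Z * (1 + T) / \<epsilon>) \<le> (E - 5 / 4) * (2 * T\<^sup>2 / S * (Z + \<kappa>))"
      using slope E by (intro mult_left_mono) auto
    then show ?thesis using base by (simp add: diff_divide_distrib add_divide_distrib algebra_simps)
  qed
  then have "\<delta> * (E * Z * (1 + T) / \<epsilon>) \<le> \<delta> * (2 * (E - \<epsilon>) * T\<^sup>2 / S * (Z + \<kappa>) + (1 + \<kappa> / 2) * Z + Z\<^sup>2 / 2)"
    using \<delta> by (intro mult_left_mono) auto
  also have "\<dots> = 2 * (E - \<epsilon>) * T\<^sup>2 * \<delta> / S * (Z + \<kappa>) + \<delta> * ((1 + \<kappa> / 2) * Z + Z\<^sup>2 / 2)"
    by (simp add: algebra_simps)
  also have "\<dots> \<le> \<theta> * (Z + \<kappa>) + \<delta> * ((1 + \<kappa> / 2) * Z + Z\<^sup>2 / 2)"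
    using \<theta>1 Z \<kappa>0 by (intro add_right_mono mult_right_mono) auto
  finally have "\<rho> * (\<delta> * (E * Z * (1 + T) / \<epsilon>)) \<le> \<rho> * (\<theta> * (Z + \<kappa>) + \<delta> * ((1 + \<kappa> / 2) * Z + Z\<^sup>2 / 2))"
    using \<rho> by (intro mult_left_mono) auto
  moreover have "\<rho> * (\<delta> * (E * Z * (1 + T) / \<epsilon>)) = E * Z"
  proof -
    have "\<rho> * (\<delta> * (E * Z * (1 + T) / \<epsilon>)) = (\<delta> * (\<rho> * (2 + \<rho>))) * (E * Z) / \<epsilon>" by (simp add: T_def)
    then show ?thesis unfolding \<delta>(2) using \<epsilon> by (simp add: \<epsilon>_def)
  qed
  ultimately show ?thesis unfolding \<kappa> by simp
qed

text \<open>Here \<open>\<rho> = 9 / 10\<close>. The two lower bounds for \<open>\<theta>\<close>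
  are averaged with weights \<open>42 / 100\<close> and \<open>58 / 100\<close>; the outcome is
  affine in \<open>E\<close> and in \<open>\<delta>\<close> separately, so the four corners of the
  rectangle suffice. The bound \<open>2081 / 10000\<close> slightly exceeds
  \<open>(cosh 1 - 1) / (261 / 100)\<close>.\<close>

lemma square_exit_small:
  fixes E \<delta> \<theta> Z :: real
  assumes E: "5 / 4 \<le> E" "E \<le> 192 / 100"
    and \<delta>: "0 \<le> \<delta>" "\<delta> \<le> 2081 / 10000"
    and \<theta>1: "2 * (E - (cosh 1 - 1)) * (cosh 1 - 1 + \<delta>) \<le> \<theta> * sinh 1"
    and \<theta>2: "2 * (E + (1 - cos 1)) * (1 - cos 1 - \<delta>) \<le> \<theta> * sin 1"
    and Z: "0 < Z" "Z \<le> (1 + 9 / 10)\<^sup>2"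
  shows "E * Z \<le> 9 / 10 * (\<theta> * (Z + (1 - (9 / 10)\<^sup>2)) + \<delta> * ((1 + (1 - (9 / 10)\<^sup>2) / 2) * Z + Z\<^sup>2 / 2))"
proof -
  define \<epsilon> where "\<epsilon> = cosh 1 - (1::real)"
  define r where "r = 1 - cos (1::real)"
  note num = cosh_1_bounds sinh_1_bounds cos_1_bounds sin_1_bounds
  have \<epsilon>: "54308 / 100000 < \<epsilon>" "\<epsilon> < 543081 / 1000000" using num by (auto simp: \<epsilon>_def)
  have r: "45969 / 100000 < r" "r < 4597 / 10000" using num by (auto simp: r_def)
  have t1: "(2 * (E - 543081 / 1000000) * (54308 / 100000 + \<delta>)) / (117521 / 100000) \<le> \<theta>"
  proof -
    have "2 * (E - 543081 / 1000000) * (54308 / 100000 + \<delta>) \<le> 2 * (E - \<epsilon>) * (\<epsilon> + \<delta>)"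
      using E \<delta> \<epsilon> by (intro mult_mono) auto
    also have "\<dots> \<le> \<theta> * sinh 1" using \<theta>1 by (simp add: \<epsilon>_def)
    finally have *: "2 * (E - 543081 / 1000000) * (54308 / 100000 + \<delta>) \<le> \<theta> * sinh 1" .
    moreover have "0 \<le> 2 * (E - 543081 / 1000000) * (54308 / 100000 + \<delta>)" using E \<delta> by simp
    ultimately have "0 \<le> \<theta> * sinh 1" by linarith
    then have "0 \<le> \<theta>" using num by (simp add: zero_le_mult_iff)
    then have "\<theta> * sinh 1 \<le> \<theta> * (117521 / 100000)" using num by (intro mult_left_mono) auto
    with * show ?thesis by (simp add: field_simps)
  qed
  have t2: "(2 * (E + 45969 / 100000) * (45969 / 100000 - \<delta>)) / (841472 / 1000000) \<le> \<theta>"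
  proof -
    have "2 * (E + 45969 / 100000) * (45969 / 100000 - \<delta>) \<le> 2 * (E + r) * (r - \<delta>)"
      using E \<delta> r by (intro mult_mono) auto
    also have "\<dots> \<le> \<theta> * sin 1" using \<theta>2 by (simp add: r_def)
    finally have *: "2 * (E + 45969 / 100000) * (45969 / 100000 - \<delta>) \<le> \<theta> * sin 1" .
    have "0 \<le> (2 * (E - 543081 / 1000000) * (54308 / 100000 + \<delta>)) / (117521 / 100000)" using E \<delta> by simp
    then have "0 \<le> \<theta>" using t1 by linarith
    then have "\<theta> * sin 1 \<le> \<theta> * (841472 / 1000000)" using num by (intro mult_left_mono) auto
    with * show ?thesis by (simp add: field_simps)
  qed
  define L where "L = 42 / 100 * ((2 * (E - 543081 / 1000000) * (54308 / 100000 + \<delta>)) / (117521 / 100000))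
     + 58 / 100 * ((2 * (E + 45969 / 100000) * (45969 / 100000 - \<delta>)) / (841472 / 1000000))"
  have L: "L \<le> \<theta>" using t1 t2 unfolding L_def by linarith
  have Z1: "Z \<le> 361 / 100" using Z by (simp add: power2_eq_square)
  define G where "G E \<delta> = 9 / 10 * ((42 / 100 * ((2 * (E - 543081 / 1000000) * (54308 / 100000 + \<delta>)) / (117521 / 100000))
     + 58 / 100 * ((2 * (E + 45969 / 100000) * (45969 / 100000 - \<delta>)) / (841472 / 1000000))) * (Z + 19 / 100)
     + \<delta> * (1095 / 1000 * Z + Z\<^sup>2 / 2)) - E * Z" for E \<delta>
  have sq: "0 \<le> (Z - 9 / 10)\<^sup>2" "0 \<le> (Z - 164 / 100)\<^sup>2" by simp_all
  have "0 \<le> G (5 / 4) 0" "0 \<le> G (192 / 100) 0"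
    using Z Z1 by (simp_all add: G_def field_simps)
  moreover have "0 \<le> G (5 / 4) (2081 / 10000)" "0 \<le> G (192 / 100) (2081 / 10000)"
    using sq by (simp_all add: G_def power2_eq_square field_simps)
  ultimately have "0 \<le> (192 / 100 - E) * (2081 / 10000 - \<delta>) * G (5 / 4) 0 + (E - 5 / 4) * (2081 / 10000 - \<delta>) * G (192 / 100) 0
      + (192 / 100 - E) * \<delta> * G (5 / 4) (2081 / 10000) + (E - 5 / 4) * \<delta> * G (192 / 100) (2081 / 10000)"
    using E \<delta> by (intro add_nonneg_nonneg mult_nonneg_nonneg) auto
  also have "\<dots> = (67 / 100 * (2081 / 10000)) * G E \<delta>"
    unfolding G_def by (simp add: field_simps)
  finally have "0 \<le> G E \<delta>" by simp
  then have "0 \<le> 9 / 10 * (L * (Z + 19 / 100) + \<delta> * (1095 / 1000 * Z + Z\<^sup>2 / 2)) - E * Z"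
    by (simp only: G_def L_def)
  also have "\<dots> \<le> 9 / 10 * (\<theta> * (Z + 19 / 100) + \<delta> * (1095 / 1000 * Z + Z\<^sup>2 / 2)) - E * Z"
    using L Z by (intro diff_mono add_mono mult_left_mono mult_right_mono) auto
  finally show ?thesis by (simp add: power2_eq_square)
qed

text \<open>The curve should end at \<open>cosh 1\<close>, which means
  \<open>\<delta> \<rho> (2 + \<rho>) = cosh 1 - 1\<close>. As \<open>\<delta>\<close> decreases,
  this \<open>\<rho>\<close> increases and passes 1, where univalence is lost. Therefore
  \<open>\<rho>\<close> is frozen at \<open>9 / 10\<close> for small \<open>\<delta>\<close>, and
  the curve then ends at or before \<open>cosh 1\<close>. The parameter \<open>\<theta>\<close> of
  the estimates is \<open>1 / \<eta>\<close>.\<close>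

lemma briot_bouquet_large:
  fixes \<eta> \<gamma> E :: real
  assumes hp: "p holomorphic_on unit_disc" and p0: "p 0 = 1"
    and hF: "(\<lambda>z. p z + z * deriv p z / (of_real \<eta> * p z + of_real \<gamma>)) holomorphic_on unit_disc"
    and T: "\<And>z. z \<in> unit_disc \<Longrightarrow> p z + z * deriv p z / (of_real \<eta> * p z + of_real \<gamma>) \<in> ball 1 E"
    and E: "5 / 4 \<le> E" "E \<le> 192 / 100" and \<eta>: "\<eta> > 0" and c: "\<eta> + \<gamma> > 0"
    and a: "\<eta> * cos 1 + \<gamma> \<le> 0" "- (\<eta> * cos 1 + \<gamma>) \<le> sin 1 / (2 * (E + (1 - cos 1)))"
    and b: "\<eta> * cosh 1 + \<gamma> \<le> sinh 1 / (2 * (E - (cosh 1 - 1)))"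
  shows "p ` unit_disc \<subseteq> cosh_sqrt ` unit_disc"
proof -
  define \<delta> where "\<delta> = (\<eta> + \<gamma>) / \<eta>"
  define \<epsilon> where "\<epsilon> = cosh 1 - (1::real)"
  define d where "d = 2 * cosh 1 - (3::real)"
  note num = cosh_1_bounds sinh_1_bounds cos_1_bounds sin_1_bounds
  have \<epsilon>: "54308 / 100000 < \<epsilon>" "\<epsilon> < 543081 / 1000000" using num by (auto simp: \<epsilon>_def)
  have d: "d \<le> 86162 / 1000000" using num by (auto simp: d_def)
  have \<delta>: "\<delta> > 0" "\<eta> * \<delta> = \<eta> + \<gamma>" using \<eta> c by (auto simp: \<delta>_def)
  have "\<eta> * \<delta> \<le> \<eta> * (1 - cos 1)" using a(1) \<delta>(2) by (simp add: algebra_simps)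
  then have \<delta>r: "\<delta> \<le> 1 - cos 1" using \<eta> by (rule mult_left_le_imp_le)
  have \<theta>1: "2 * (E - (cosh 1 - 1)) * (cosh 1 - 1 + \<delta>) \<le> (1 / \<eta>) * sinh 1"
  proof -
    have "2 * (E - (cosh 1 - 1)) * (\<eta> * (cosh 1 - 1 + \<delta>)) \<le> sinh 1"
    proof -
      have "(\<eta> * cosh 1 + \<gamma>) * (2 * (E - (cosh 1 - 1))) \<le> sinh 1"
        using b by (rule pos_le_divide_eq[THEN iffD1, rotated]) (use E num in simp)
      moreover have "\<eta> * (cosh 1 - 1 + \<delta>) = \<eta> * cosh 1 + \<gamma>" using \<delta>(2) by (simp add: algebra_simps)
      ultimately show ?thesis by (simp only: mult.commute)
    qed
    then show ?thesis using \<eta> by (simp add: pos_le_divide_eq mult_ac)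
  qed
  have \<theta>2: "2 * (E + (1 - cos 1)) * (1 - cos 1 - \<delta>) \<le> (1 / \<eta>) * sin 1"
  proof -
    have "2 * (E + (1 - cos 1)) * (\<eta> * (1 - cos 1 - \<delta>)) \<le> sin 1"
    proof -
      have "- (\<eta> * cos 1 + \<gamma>) * (2 * (E + (1 - cos 1))) \<le> sin 1"
        using a(2) by (rule pos_le_divide_eq[THEN iffD1, rotated]) (use E num in simp)
      moreover have "\<eta> * (1 - cos 1 - \<delta>) = - (\<eta> * cos 1 + \<gamma>)" using \<delta>(2) by (simp add: algebra_simps)
      ultimately show ?thesis by (simp only: mult.commute)
    qed
    then show ?thesis using \<eta> by (simp add: pos_le_divide_eq mult_ac)
  qed
  show ?thesis
  \<comment> \<open>\<open>261 / 100\<close> is \<open>\<rho> (2 + \<rho>)\<close> at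
    \<open>\<rho> = 9 / 10\<close>.\<close>
  proof (cases "\<delta> * (261 / 100) \<le> \<epsilon>")
    case True
    have \<delta>0: "0 \<le> \<delta>" and \<delta>1: "\<delta> \<le> 2081 / 10000" using \<delta>(1) True \<epsilon> by auto
    have "p ` unit_disc \<subseteq> qcurve (2 * \<delta> * (9 / 10)) (\<delta> * (9 / 10)\<^sup>2) ` unit_disc"
      unfolding \<delta>_def
    proof (rule briot_bouquet_square[OF hp p0 hF T _ _ \<eta> c])
      fix Z :: real assume Z: "0 < Z" "Z \<le> (1 + 9 / 10)\<^sup>2"
      show "E * Z \<le> 9 / 10 * ((1 / \<eta>) * (Z + (1 - (9 / 10)\<^sup>2)) + (\<eta> + \<gamma>) / \<eta> * ((1 + (1 - (9 / 10)\<^sup>2) / 2) * Z + Z\<^sup>2 / 2))"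
        using square_exit_small[OF E \<delta>0 \<delta>1 \<theta>1 \<theta>2 Z] unfolding \<delta>_def .
    qed simp_all
    also have "\<dots> \<subseteq> cosh_sqrt ` unit_disc"
    proof -
      define t where "t = \<delta> * (261 / 100) / \<epsilon>"
      have t: "0 \<le> t" "t \<le> 1" using \<delta>(1) \<epsilon> True by (auto simp: t_def)
      have "qcurve (t * (\<epsilon> * (180 / 261))) (t * (\<epsilon> * (81 / 261))) ` unit_disc \<subseteq> cosh_sqrt ` unit_disc"
      proof (rule qcurve_subset_cosh_sqrt[OF _ _ _ _ t])
        have "d * (504 / 261) \<le> (86162 / 1000000) * (504 / 261)" using d by simp
        also have "\<dots> \<le> 2 * (180 / 261) * (54308 / 100000 * (81 / 261))" by simp
        also have "\<dots> \<le> 2 * (180 / 261) * (\<epsilon> * (81 / 261))" using \<epsilon> by simp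
        finally have "\<epsilon> * (d * (504 / 261)) \<le> \<epsilon> * (2 * (180 / 261) * (\<epsilon> * (81 / 261)))"
          using \<epsilon> by (intro mult_left_mono) auto
        then show "(2 * cosh 1 - 3) * (\<epsilon> * (180 / 261) + 4 * (\<epsilon> * (81 / 261))) \<le> 2 * (\<epsilon> * (180 / 261)) * (\<epsilon> * (81 / 261))"
          unfolding d_def[symmetric] by (simp add: algebra_simps)
        show "\<epsilon> * (180 / 261) + \<epsilon> * (81 / 261) = cosh 1 - 1" by (simp add: \<epsilon>_def field_simps)
      qed (use \<epsilon> in auto)
      moreover have "t * (\<epsilon> * (180 / 261)) = 2 * \<delta> * (9 / 10)" "t * (\<epsilon> * (81 / 261)) = \<delta> * (9 / 10)\<^sup>2"
        using \<epsilon> by (auto simp: t_def power2_eq_square)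
      ultimately show ?thesis by (simp only:)
    qed
    finally show ?thesis .
  next
    case False
    define \<rho> where "\<rho> = sqrt (1 + \<epsilon> / \<delta>) - 1"
    have q: "\<epsilon> / \<delta> < 261 / 100" using False \<delta>(1) by (simp add: field_simps)
    \<comment> \<open>The zero \<open>1 - \<delta>\<close> of \<open>\<eta> w + \<gamma>\<close> is
      at least \<open>cos 1\<close>; this keeps \<open>\<rho>\<close> above
      \<open>2 / 5\<close>.\<close>
    have "\<epsilon> / (1 - cos 1) \<le> \<epsilon> / \<delta>" using \<epsilon> \<delta>r \<delta>(1) by (intro divide_left_mono) auto
    moreover have "96 / 100 \<le> \<epsilon> / (1 - cos 1)" using \<epsilon> num by (simp add: pos_le_divide_eq)
    ultimately have q2: "96 / 100 \<le> \<epsilon> / \<delta>" by linarith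
    have "sqrt (1 + \<epsilon> / \<delta>) \<le> 19 / 10" by (rule real_le_lsqrt) (use q in \<open>simp_all add: power2_eq_square\<close>)
    moreover have "7 / 5 \<le> sqrt (1 + \<epsilon> / \<delta>)" by (rule real_le_rsqrt) (use q2 in \<open>simp add: power2_eq_square\<close>)
    ultimately have \<rho>: "2 / 5 \<le> \<rho>" "\<rho> \<le> 9 / 10" by (auto simp: \<rho>_def)
    have "\<rho> * (2 + \<rho>) = (sqrt (1 + \<epsilon> / \<delta>))\<^sup>2 - 1" by (simp add: \<rho>_def power2_eq_square algebra_simps)
    also have "\<dots> = \<epsilon> / \<delta>" using q2 by (subst real_sqrt_pow2) linarith+
    finally have \<delta>\<rho>: "\<delta> * (\<rho> * (2 + \<rho>)) = \<epsilon>" using \<delta>(1) by simp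
    have "p ` unit_disc \<subseteq> qcurve (2 * \<delta> * \<rho>) (\<delta> * \<rho>\<^sup>2) ` unit_disc"
      unfolding \<delta>_def
    proof (rule briot_bouquet_square[OF hp p0 hF T _ _ \<eta> c])
      fix Z :: real assume Z: "0 < Z" "Z \<le> (1 + \<rho>)\<^sup>2"
      show "E * Z \<le> \<rho> * ((1 / \<eta>) * (Z + (1 - \<rho>\<^sup>2)) + (\<eta> + \<gamma>) / \<eta> * ((1 + (1 - \<rho>\<^sup>2) / 2) * Z + Z\<^sup>2 / 2))"
        using square_exit_large[OF E(1) \<rho> \<delta>(1) \<delta>\<rho>[unfolded \<epsilon>_def] \<theta>1 Z] unfolding \<delta>_def .
    qed (use \<rho> in auto)
    also have "\<dots> \<subseteq> cosh_sqrt ` unit_disc"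
    proof -
      have "qcurve (1 * (2 * \<delta> * \<rho>)) (1 * (\<delta> * \<rho>\<^sup>2)) ` unit_disc \<subseteq> cosh_sqrt ` unit_disc"
      proof (rule qcurve_subset_cosh_sqrt)
        have "0 \<le> (\<rho> - 2 / 5) * (9 / 10 - \<rho>)" using \<rho> by simp
        then have "2 * \<rho>\<^sup>2 \<le> (13 / 5) * \<rho> - 72 / 100" by (simp add: power2_eq_square field_simps)
        then have "(86162 / 1000000) * ((1 + 2 * \<rho>) * (2 + \<rho>)) \<le> 2 * (54308 / 100000 * \<rho>)"
          using \<rho> by (simp add: power2_eq_square algebra_simps)
        also have "\<dots> \<le> 2 * (\<epsilon> * \<rho>)" using \<epsilon> \<rho> by simp
        also have "\<dots> = (2 * \<delta> * \<rho>\<^sup>2) * (2 + \<rho>)" unfolding \<delta>\<rho>[symmetric] by (simp add: power2_eq_square algebra_simps)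
        finally have "((86162 / 1000000) * (1 + 2 * \<rho>)) * (2 + \<rho>) \<le> (2 * \<delta> * \<rho>\<^sup>2) * (2 + \<rho>)"
          by (simp only: mult.assoc)
        then have "(86162 / 1000000) * (1 + 2 * \<rho>) \<le> 2 * \<delta> * \<rho>\<^sup>2"
          by (rule mult_right_le_imp_le) (use \<rho> in simp)
        moreover have "d * (1 + 2 * \<rho>) \<le> (86162 / 1000000) * (1 + 2 * \<rho>)" using d \<rho> by (intro mult_right_mono) auto
        ultimately have "d * (1 + 2 * \<rho>) \<le> 2 * \<delta> * \<rho>\<^sup>2" by linarith
        then have "2 * \<delta> * \<rho> * (d * (1 + 2 * \<rho>)) \<le> 2 * \<delta> * \<rho> * (2 * \<delta> * \<rho>\<^sup>2)"
          using \<delta>(1) \<rho> by (intro mult_left_mono) auto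
        then show "(2 * cosh 1 - 3) * (2 * \<delta> * \<rho> + 4 * (\<delta> * \<rho>\<^sup>2)) \<le> 2 * (2 * \<delta> * \<rho>) * (\<delta> * \<rho>\<^sup>2)"
          unfolding d_def[symmetric] by (simp add: power2_eq_square algebra_simps)
        show "2 * (\<delta> * \<rho>\<^sup>2) < 2 * \<delta> * \<rho>" using \<delta>(1) \<rho> by (simp add: power2_eq_square)
        show "2 * \<delta> * \<rho> + \<delta> * \<rho>\<^sup>2 = cosh 1 - 1" using \<delta>\<rho> by (simp add: \<epsilon>_def power2_eq_square algebra_simps)
      qed (use \<delta>(1) in auto)
      then show ?thesis by simp
    qed
    finally show ?thesis .
  qed
qed

section \<open>The quadratic form for limacon targets\<close>

text \<open>Multiplying the inequality of \<open>limacon_disc\<close> at \<open>F = (1 + \<sigma> \<zeta>)\<^sup>2 + t \<cdot> 2 \<sigma> \<zeta> (1 + \<sigma> \<zeta>) / P\<close>, with parameter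
  \<open>g = |1 + \<sigma> \<zeta>|\<^sup>2 + D\<close>, by \<open>|P|\<^sup>2\<close> gives this quadratic form in \<open>(t, P)\<close>.\<close>

definition limacon_form :: "real \<Rightarrow> real \<Rightarrow> real \<Rightarrow> complex \<Rightarrow> real \<Rightarrow> complex \<Rightarrow> real" where
  "limacon_form \<sigma> s D \<zeta> t P =
    (let \<rho> = 1 + \<sigma> * Re \<zeta>; m = 1 + 2 * \<sigma> * Re \<zeta> + \<sigma>\<^sup>2; q = s\<^sup>2 - \<sigma>\<^sup>2
     in 4 * \<sigma>\<^sup>2 * m * (2 * \<rho> - 1 + D - q) * t\<^sup>2 + 8 * \<sigma>\<^sup>2 * m * \<rho> * t * Re P
        + 4 * \<sigma> * t * ((D - q) * m * Re ((\<zeta> + of_real \<sigma>) * cnj P) - D * Re (\<zeta> * (1 + of_real \<sigma> * \<zeta>) * cnj P))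
        - ((m + D) * q * (4 * \<rho> - q) + s\<^sup>2 * D\<^sup>2) * (norm P)\<^sup>2)"

lemma norm_one_plus:
  assumes "norm \<zeta> = 1"
  shows "(norm (1 + of_real \<sigma> * \<zeta>))\<^sup>2 = 1 + 2 * \<sigma> * Re \<zeta> + \<sigma>\<^sup>2"
proof -
  have "(Re \<zeta>)\<^sup>2 + (Im \<zeta>)\<^sup>2 = 1" using assms by (simp add: cmod_def)
  moreover have "(norm (1 + of_real \<sigma> * \<zeta>))\<^sup>2 = 1 + 2 * \<sigma> * Re \<zeta> + \<sigma>\<^sup>2 * ((Re \<zeta>)\<^sup>2 + (Im \<zeta>)\<^sup>2)"
    unfolding cmod_power2 by (simp add: power2_eq_square algebra_simps)
  ultimately show ?thesis by simp
qed

text \<open>If the exit value were in the limacon, the strict inequality of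
  \<open>limacon_disc\<close>, multiplied by \<open>|P|^2 > 0\<close>, would make the form negative.
  The work lies in expressing \<open>|F|^2 |P|^2\<close> and \<open>Re F |P|^2\<close> through
  \<open>t\<close> and \<open>P\<close>.\<close>

lemma limacon_form_exit:
  fixes \<zeta> P :: complex and \<sigma> s D t :: real
  assumes \<zeta>: "norm \<zeta> = 1" and s: "0 < s" "s \<le> 1" and g: "1 + 2 * \<sigma> * Re \<zeta> + \<sigma>\<^sup>2 + D > 0" and "P \<noteq> 0"
    and form: "0 \<le> limacon_form \<sigma> s D \<zeta> t P"
  shows "qcurve (2 * \<sigma>) (\<sigma>\<^sup>2) \<zeta> + of_real t * (of_real (2 * \<sigma>) * \<zeta> + 2 * of_real (\<sigma>\<^sup>2) * \<zeta>\<^sup>2) / P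
    \<notin> qcurve (2 * s) (s\<^sup>2) ` unit_disc"
proof
  define Z where "Z = 1 + of_real \<sigma> * \<zeta>"
  define m where "m = 1 + 2 * \<sigma> * Re \<zeta> + \<sigma>\<^sup>2"
  define \<rho> where "\<rho> = 1 + \<sigma> * Re \<zeta>"
  define q where "q = s\<^sup>2 - \<sigma>\<^sup>2"
  define F where "F = Z\<^sup>2 + of_real t * (2 * of_real \<sigma> * \<zeta> * Z) / P"
  define n where "n = (norm P)\<^sup>2"
  define R1 where "R1 = Re ((\<zeta> + of_real \<sigma>) * cnj P)"
  define R2 where "R2 = Re (\<zeta> * Z * cnj P)"
  have n: "n > 0" using \<open>P \<noteq> 0\<close> by (simp add: n_def)
  have Zm: "(norm Z)\<^sup>2 = m" unfolding Z_def m_def by (rule norm_one_plus[OF \<zeta>])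
  have \<zeta>c: "\<zeta> * cnj \<zeta> = 1" using complex_norm_square[of \<zeta>] \<zeta> by simp
  have \<zeta>Z: "\<zeta> * cnj Z = \<zeta> + of_real \<sigma>"
    unfolding Z_def using \<zeta>c by (simp add: distrib_left mult.left_commute)
  assume "qcurve (2 * \<sigma>) (\<sigma>\<^sup>2) \<zeta> + of_real t * (of_real (2 * \<sigma>) * \<zeta> + 2 * of_real (\<sigma>\<^sup>2) * \<zeta>\<^sup>2) / P
    \<in> qcurve (2 * s) (s\<^sup>2) ` unit_disc"
  moreover have "qcurve (2 * \<sigma>) (\<sigma>\<^sup>2) \<zeta> + of_real t * (of_real (2 * \<sigma>) * \<zeta> + 2 * of_real (\<sigma>\<^sup>2) * \<zeta>\<^sup>2) / P = F"
    by (simp add: F_def Z_def qcurve_def power2_eq_square algebra_simps)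
  ultimately obtain v where v: "norm v < 1" "F = qcurve (2 * s) (s\<^sup>2) v" by auto
  have "norm (of_real s * v) < s" using v(1) s by (simp add: norm_mult)
  moreover have "F = (1 + of_real s * v)\<^sup>2" unfolding v(2) by (simp add: qcurve_def power2_eq_square algebra_simps)
  ultimately have neg: "(m + D - s\<^sup>2) * (norm F)\<^sup>2 - 2 * (m + D) * Re F + (m + D) * (1 - s\<^sup>2)\<^sup>2 - s\<^sup>2 * (m + D)\<^sup>2 < 0"
    using limacon_disc[of "of_real s * v" s "m + D"] g s by (simp add: m_def)
  have FP: "F * P = Z * (Z * P + of_real (2 * \<sigma> * t) * \<zeta>)"
    using \<open>P \<noteq> 0\<close> by (simp add: F_def power2_eq_square field_simps)
  have sq: "(norm (a + of_real c * b))\<^sup>2 = (norm a)\<^sup>2 + 2 * c * Re (b * cnj a) + c\<^sup>2 * (norm b)\<^sup>2" for a b :: complex and c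
    unfolding cmod_power2 by (simp add: power2_eq_square algebra_simps)
  have nF: "(norm F)\<^sup>2 * n = m * (m * n + 4 * \<sigma> * t * R1 + 4 * \<sigma>\<^sup>2 * t\<^sup>2)"
  proof -
    have "(norm F)\<^sup>2 * n = (norm (F * P))\<^sup>2" by (simp add: n_def norm_mult power_mult_distrib)
    also have "\<dots> = m * (norm (Z * P + of_real (2 * \<sigma> * t) * \<zeta>))\<^sup>2"
      unfolding FP norm_mult power_mult_distrib Zm ..
    also have "(norm (Z * P + of_real (2 * \<sigma> * t) * \<zeta>))\<^sup>2 = m * n + 2 * (2 * \<sigma> * t) * R1 + (2 * \<sigma> * t)\<^sup>2"
    proof -
      have "\<zeta> * cnj (Z * P) = (\<zeta> + of_real \<sigma>) * cnj P" by (simp add: \<zeta>Z[symmetric])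
      then show ?thesis unfolding sq by (simp only: norm_mult power_mult_distrib Zm \<zeta> n_def R1_def) simp
    qed
    finally show ?thesis by (simp add: power_mult_distrib)
  qed
  have rF: "Re F * n = (2 * \<rho>\<^sup>2 - m) * n + 2 * \<sigma> * t * R2"
  proof -
    have "Re F * n = Re (F * P * cnj P)"
      unfolding n_def mult.assoc complex_norm_square[symmetric] by simp
    also have "\<dots> = Re (Z\<^sup>2 * of_real n + of_real (2 * \<sigma> * t) * (\<zeta> * Z * cnj P))"
      unfolding FP n_def complex_norm_square by (rule arg_cong[of _ _ Re]) (simp add: power2_eq_square algebra_simps)
    also have "\<dots> = Re (Z\<^sup>2) * n + 2 * \<sigma> * t * R2" by (simp add: R2_def)
    also have "Re (Z\<^sup>2) = 2 * \<rho>\<^sup>2 - m"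
    proof -
      have "Re Z = \<rho>" by (simp add: Z_def \<rho>_def)
      then show ?thesis unfolding Zm[symmetric] cmod_power2 by (simp add: power2_eq_square)
    qed
    finally show ?thesis .
  qed
  \<comment> \<open>\<open>R1\<close>, \<open>R2\<close> and \<open>Re P\<close> are linear
    functionals of the same \<open>P\<close> and satisfy this relation; eliminating
    \<open>R2\<close> reduces the identity below to one that \<open>algebra\<close> settles.\<close>
  have R3: "(m - \<sigma>\<^sup>2) * R1 - R2 = 2 * \<sigma> * \<rho> * Re P"
  proof -
    have "of_real (m - \<sigma>\<^sup>2) * (\<zeta> + of_real \<sigma>) - \<zeta> * Z = (of_real (2 * \<sigma> * \<rho>) :: complex)"
    proof -
      have "of_real (m - \<sigma>\<^sup>2) = 1 + of_real \<sigma> * (\<zeta> + cnj \<zeta>)"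
        unfolding complex_add_cnj m_def by simp
      moreover have "(1 + of_real \<sigma> * (\<zeta> + cnj \<zeta>)) * (\<zeta> + of_real \<sigma>) - \<zeta> * Z
          = of_real \<sigma> + of_real \<sigma> * (\<zeta> * cnj \<zeta>) + (of_real \<sigma>)\<^sup>2 * (\<zeta> + cnj \<zeta>)"
        by (simp add: Z_def power2_eq_square algebra_simps)
      ultimately show ?thesis unfolding \<zeta>c complex_add_cnj \<rho>_def by (simp add: power2_eq_square algebra_simps)
    qed
    then have "Re ((of_real (m - \<sigma>\<^sup>2) * (\<zeta> + of_real \<sigma>) - \<zeta> * Z) * cnj P) = Re (of_real (2 * \<sigma> * \<rho>) * cnj P)"
      by (simp only:)
    then show ?thesis by (simp add: R1_def R2_def algebra_simps)
  qed
  have "((m + D - s\<^sup>2) * (norm F)\<^sup>2 - 2 * (m + D) * Re F + (m + D) * (1 - s\<^sup>2)\<^sup>2 - s\<^sup>2 * (m + D)\<^sup>2) * n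
      = (m + D - s\<^sup>2) * ((norm F)\<^sup>2 * n) - 2 * (m + D) * (Re F * n) + ((m + D) * (1 - s\<^sup>2)\<^sup>2 - s\<^sup>2 * (m + D)\<^sup>2) * n"
    by (simp add: algebra_simps)
  also have "\<dots> = 4 * \<sigma>\<^sup>2 * m * (2 * \<rho> - 1 + D - q) * t\<^sup>2 + 8 * \<sigma>\<^sup>2 * m * \<rho> * t * Re P
        + 4 * \<sigma> * t * ((D - q) * m * R1 - D * R2) - ((m + D) * q * (4 * \<rho> - q) + s\<^sup>2 * D\<^sup>2) * n"
  proof -
    have R2: "R2 = (m - \<sigma>\<^sup>2) * R1 - 2 * \<sigma> * \<rho> * Re P" using R3 by simp
    have s2: "s\<^sup>2 = q + \<sigma>\<^sup>2" by (simp add: q_def)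
    have m: "m = 2 * \<rho> - 1 + \<sigma>\<^sup>2" by (simp add: m_def \<rho>_def)
    show ?thesis unfolding nF rF R2 s2 m by algebra
  qed
  also have "\<dots> = limacon_form \<sigma> s D \<zeta> t P"
    by (simp add: limacon_form_def Let_def \<rho>_def m_def q_def R1_def R2_def n_def Z_def)
  finally show False using mult_neg_pos[OF neg n] form by linarith
qed

lemma limacon_form_scale:
  "limacon_form \<sigma> s D \<zeta> (c * t) (of_real c * P) = c\<^sup>2 * limacon_form \<sigma> s D \<zeta> t P"
proof -
  have "Re (u * cnj (of_real c * P)) = c * Re (u * cnj P)" for u by (simp add: algebra_simps)
  then show ?thesis unfolding limacon_form_def Let_def norm_mult power_mult_distrib norm_of_real power2_abs
    by (simp add: power2_eq_square algebra_simps del: complex_cnj_mult)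
qed

text \<open>For \<open>t = 1\<close> the form is affine in \<open>P\<close> minus a nonnegative
  multiple of \<open>|P|^2\<close>, hence concave. It then suffices to test the vertices of a
  polygon that contains the possible \<open>P\<close>.\<close>

lemma convex_limacon_form:
  assumes "0 \<le> (1 + 2 * \<sigma> * Re \<zeta> + \<sigma>\<^sup>2 + D) * (s\<^sup>2 - \<sigma>\<^sup>2) * (4 * (1 + \<sigma> * Re \<zeta>) - (s\<^sup>2 - \<sigma>\<^sup>2)) + s\<^sup>2 * D\<^sup>2"
  shows "convex {P. 0 \<le> limacon_form \<sigma> s D \<zeta> 1 P}"
proof (rule convexI)
  fix P Q :: complex and u v :: real
  assume PQ: "P \<in> {P. 0 \<le> limacon_form \<sigma> s D \<zeta> 1 P}" "Q \<in> {P. 0 \<le> limacon_form \<sigma> s D \<zeta> 1 P}"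
    and uv: "0 \<le> u" "0 \<le> v" "u + v = 1"
  define c where "c = (1 + 2 * \<sigma> * Re \<zeta> + \<sigma>\<^sup>2 + D) * (s\<^sup>2 - \<sigma>\<^sup>2) * (4 * (1 + \<sigma> * Re \<zeta>) - (s\<^sup>2 - \<sigma>\<^sup>2)) + s\<^sup>2 * D\<^sup>2"
  define k where "k = 4 * \<sigma>\<^sup>2 * (1 + 2 * \<sigma> * Re \<zeta> + \<sigma>\<^sup>2) * (2 * (1 + \<sigma> * Re \<zeta>) - 1 + D - (s\<^sup>2 - \<sigma>\<^sup>2))"
  define W where "W = of_real (8 * \<sigma>\<^sup>2 * (1 + 2 * \<sigma> * Re \<zeta> + \<sigma>\<^sup>2) * (1 + \<sigma> * Re \<zeta>))
     + of_real (4 * \<sigma> * (D - (s\<^sup>2 - \<sigma>\<^sup>2)) * (1 + 2 * \<sigma> * Re \<zeta> + \<sigma>\<^sup>2)) * (\<zeta> + of_real \<sigma>)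
     - of_real (4 * \<sigma> * D) * (\<zeta> * (1 + of_real \<sigma> * \<zeta>))"
  have form: "limacon_form \<sigma> s D \<zeta> 1 P = k + Re (W * cnj P) - c * (norm P)\<^sup>2" for P
  proof -
    have "Re (W * cnj P) = 8 * \<sigma>\<^sup>2 * (1 + 2 * \<sigma> * Re \<zeta> + \<sigma>\<^sup>2) * (1 + \<sigma> * Re \<zeta>) * Re P
       + 4 * \<sigma> * ((D - (s\<^sup>2 - \<sigma>\<^sup>2)) * (1 + 2 * \<sigma> * Re \<zeta> + \<sigma>\<^sup>2) * Re ((\<zeta> + of_real \<sigma>) * cnj P) - D * Re (\<zeta> * (1 + of_real \<sigma> * \<zeta>) * cnj P))"
      unfolding W_def left_diff_distrib[of _ _ "cnj P"] distrib_right[of _ _ "cnj P"] mult.assoc[of "of_real _" _ "cnj P"]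
        minus_complex.simps plus_complex.simps Re_complex_of_real Im_complex_of_real times_complex.simps(1)[of "of_real _"]
      by (simp add: right_diff_distrib del: times_complex.simps)
    then show ?thesis unfolding limacon_form_def Let_def k_def c_def by simp
  qed
  have "limacon_form \<sigma> s D \<zeta> 1 (u *\<^sub>R P + v *\<^sub>R Q) - u * limacon_form \<sigma> s D \<zeta> 1 P - v * limacon_form \<sigma> s D \<zeta> 1 Q
      = c * (u * v * (norm (P - Q))\<^sup>2)"
  proof -
    have v: "v = 1 - u" using uv by simp
    have nn: "(norm (u *\<^sub>R P + v *\<^sub>R Q))\<^sup>2 = u * (norm P)\<^sup>2 + v * (norm Q)\<^sup>2 - u * v * (norm (P - Q))\<^sup>2"
      unfolding v cmod_power2 by (simp add: power2_eq_square algebra_simps)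
    have rr: "Re (W * cnj (u *\<^sub>R P + v *\<^sub>R Q)) = u * Re (W * cnj P) + v * Re (W * cnj Q)"
      by (simp add: algebra_simps)
    show ?thesis unfolding form nn rr unfolding v by (simp add: algebra_simps)
  qed
  moreover have "0 \<le> c * (u * v * (norm (P - Q))\<^sup>2)" using assms uv unfolding c_def[symmetric] by simp
  moreover have "0 \<le> u * limacon_form \<sigma> s D \<zeta> 1 P" "0 \<le> v * limacon_form \<sigma> s D \<zeta> 1 Q" using PQ uv by simp_all
  ultimately show "u *\<^sub>R P + v *\<^sub>R Q \<in> {P. 0 \<le> limacon_form \<sigma> s D \<zeta> 1 P}" by simp
qed

text \<open>\<open>X\<close> is the distance from the curve to its rightmost point \<open>(1 + \<sigma>)\<^sup>2\<close>.\<close>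

lemma limacon_gap:
  fixes \<zeta> :: complex and \<sigma> :: real
  assumes "norm \<zeta> = 1"
  defines "x \<equiv> Re \<zeta>" and "Z \<equiv> 1 + of_real \<sigma> * \<zeta>" and "m \<equiv> 1 + 2 * \<sigma> * Re \<zeta> + \<sigma>\<^sup>2"
  defines "X \<equiv> of_real ((1 + \<sigma>)\<^sup>2) - Z\<^sup>2"
  shows "Re X = 2 * \<sigma> * (1 - x) * (1 + 2 * \<sigma> - \<sigma> * (1 - x))"
    and "(norm X)\<^sup>2 = 4 * \<sigma>\<^sup>2 * (1 - x) * (2 * (1 + \<sigma>)\<^sup>2 - ((1 + \<sigma>)\<^sup>2 - 1) * (1 - x))"
    and "Re ((\<zeta> + of_real \<sigma>) * cnj X) = (1 + \<sigma>)\<^sup>2 * (x + \<sigma>) - (x + 3 * \<sigma> + 3 * \<sigma>\<^sup>2 * x + \<sigma> ^ 3 * (2 * x\<^sup>2 - 1))"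
    and "Re (\<zeta> * Z * cnj X) = (1 + \<sigma>)\<^sup>2 * (x + \<sigma> * (2 * x\<^sup>2 - 1)) - m * (x + \<sigma>)"
proof -
  define y where "y = Im \<zeta>"
  have xy: "x\<^sup>2 + y\<^sup>2 = 1" using assms(1) by (simp add: cmod_def x_def y_def)
  have Z: "Re Z = 1 + \<sigma> * x" "Im Z = \<sigma> * y" by (simp_all add: Z_def x_def y_def)
  have X: "Re X = (1 + \<sigma>)\<^sup>2 - ((1 + \<sigma> * x)\<^sup>2 - (\<sigma> * y)\<^sup>2)" "Im X = - (2 * (1 + \<sigma> * x) * (\<sigma> * y))"
    unfolding X_def by (simp_all add: Z power2_eq_square)
  show "Re X = 2 * \<sigma> * (1 - x) * (1 + 2 * \<sigma> - \<sigma> * (1 - x))" unfolding X using xy by algebra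
  show "(norm X)\<^sup>2 = 4 * \<sigma>\<^sup>2 * (1 - x) * (2 * (1 + \<sigma>)\<^sup>2 - ((1 + \<sigma>)\<^sup>2 - 1) * (1 - x))"
    unfolding cmod_power2 X using xy by algebra
  have "Re ((\<zeta> + of_real \<sigma>) * cnj X) = (x + \<sigma>) * Re X + y * Im X" by (simp add: x_def y_def)
  then show "Re ((\<zeta> + of_real \<sigma>) * cnj X) = (1 + \<sigma>)\<^sup>2 * (x + \<sigma>) - (x + 3 * \<sigma> + 3 * \<sigma>\<^sup>2 * x + \<sigma> ^ 3 * (2 * x\<^sup>2 - 1))"
    unfolding X using xy by algebra
  have "Re (\<zeta> * Z * cnj X) = (x * Re Z - y * Im Z) * Re X + (x * Im Z + y * Re Z) * Im X" by (simp add: x_def y_def)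
  then show "Re (\<zeta> * Z * cnj X) = (1 + \<sigma>)\<^sup>2 * (x + \<sigma> * (2 * x\<^sup>2 - 1)) - m * (x + \<sigma>)"
    unfolding X Z m_def x_def[symmetric] using xy by algebra
qed

section \<open>Polynomial certificates by Bernstein coefficients\<close>

text \<open>A triple stands for \<open>a w^2 + b w u + c u^2\<close>; the result lists the
  coefficients of the product from \<open>w^4\<close> to \<open>u^4\<close>.\<close>

fun conv3 :: "'a::comm_ring_1 \<times> 'a \<times> 'a \<Rightarrow> 'a \<times> 'a \<times> 'a \<Rightarrow> 'a list" where
  "conv3 (a, b, c) (a', b', c') = [a * a', a * b' + b * a', a * c' + b * b' + c * a', b * c' + c * b', c * c']"

fun add5 :: "'a::comm_ring_1 list \<Rightarrow> 'a list \<Rightarrow> 'a list" where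
  "add5 [a, b, c, d, e] [a', b', c', d', e'] = [a + a', b + b', c + c', d + d', e + e']"
| "add5 _ _ = []"

text \<open>For \<open>\<sigma> = 31 / 128\<close> and \<open>D = e (1 + 13 / 32 (1 - Re \<zeta>))\<close> the form \<open>limacon_form\<close> is a quartic in \<open>(1 - Re \<zeta>) / 2\<close>. These are
  its Bernstein coefficients (with the binomial factors), scaled by \<open>2 ^ 89\<close>, for arguments scaled as in \<open>near_coeffs_form_nonneg\<close>;
  some constants are rounded in the safe direction. The definition is polymorphic so that the
  simplifier can expand it as a polynomial in \<open>e\<close>, with \<open>h c = [:c:]\<close>.\<close>

definition near_coeffs :: "(real \<Rightarrow> 'a::comm_ring_1) \<Rightarrow> 'a \<Rightarrow> 'a \<Rightarrow> 'a \<Rightarrow> 'a \<Rightarrow> 'a \<Rightarrow> 'a list" where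
  "near_coeffs h t k e q l =
    (let m0 = h 25281; m1 = h 9409; d0 = h 16 * e; d1 = h 29 * e;
         a0 = h 512 * d0 - q; a1 = h 512 * d1 - q;
         l0 = h 1556480 + a0; l1 = h 540672 + a1;
         b0 = m0 + h 8 * d0; b1 = m1 + h 8 * d1; f0 = h 40704 - l; f1 = h 24832 - l;
         s = h 32 * (h 61504 + q); t2 = h 125960192 * (t * t); t3 = h 63488 * t; t4 = h (- 532575944704) * t; k2 = k * k
     in add5 (add5 (add5 (add5
          (conv3 (m0 * l0, m0 * l1 + m1 * l0, m1 * l1) (t2, h 2 * t2, t2))
          (conv3 (h 506319538618368 * t, h 497327114551296 * t, h 114960466313216 * t) (h 134217728, h 268435456 - h 2945 * k, h 134217728 - h 1984 * k)))
          (conv3 (m0 * a0, m0 * a1 + m1 * a0, m1 * a1)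
             (t3 * h 83361792, t3 * (h 32505856 + h 635 * k), t3 * (h 751 * k - h 50855936))))
          (conv3 (d0, d0 + d1, d1) (t4 * h 83361792, t4 * (h 1830 * k - h 97517568), t4 * (h 752 * k - h 50855936))))
          (conv3 (q * (b0 * f0) + s * (d0 * d0), q * (b0 * f1 + b1 * f0) + s * (h 2 * (d0 * d1)), q * (b1 * f1) + s * (d1 * d1))
             (h (- 4398046511104), h 193003520 * k - h 1483 * k2 - h 8796093022208, h 130023424 * k - h 961 * k2 - h 4398046511104)))"

text \<open>Horner's scheme as a lower bound valid on all of \<open>[0, H]\<close>: at each level a
  negative inner bound is taken at \<open>v = H\<close>, a nonnegative one at
  \<open>v = 0\<close>.\<close>

definition horner_low :: "real \<Rightarrow> real poly \<Rightarrow> real" where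
  "horner_low H p = fold_coeffs (\<lambda>a l. a + min 0 (H * l)) p 0"

lemma horner_low_pCons:
  "horner_low H 0 = 0" "horner_low H (pCons a p) = a + min 0 (H * horner_low H p)"
  by (cases "p = 0"; cases "a = 0"; simp add: horner_low_def)+

lemma horner_low_le:
  assumes "0 \<le> v" "v \<le> H"
  shows "horner_low H p \<le> poly p v"
proof (induction p)
  case (pCons a p)
  have "min 0 (H * horner_low H p) \<le> v * poly p v"
  proof (cases "horner_low H p \<ge> 0")
    case True
    with pCons have "0 \<le> v * poly p v" using assms by simp
    then show ?thesis by simp
  next
    case False
    then have "H * horner_low H p \<le> v * horner_low H p" using assms by (intro mult_right_mono_neg) auto
    also have "\<dots> \<le> v * poly p v" using pCons assms by (intro mult_left_mono) auto
    finally show ?thesis by simp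
  qed
  then show ?case by (simp add: horner_low_pCons)
qed (simp add: horner_low_pCons)

text \<open>\<open>near_coeffs\<close> uses ring operations only, so it commutes with evaluation at
  \<open>v\<close>, and a single computation over \<open>real poly\<close> covers a whole interval
  of \<open>e\<close>.\<close>

lemma near_coeffs_nonneg:
  assumes "list_all (\<lambda>p. 0 \<le> horner_low H p) (near_coeffs (\<lambda>c. [:c:]) t k e q l)" and v: "0 \<le> v" "v \<le> H"
  shows "list_all (\<lambda>c. 0 \<le> c) (near_coeffs (\<lambda>c. c) (poly t v) (poly k v) (poly e v) (poly q v) (poly l v))"
proof -
  have "near_coeffs (\<lambda>c. c) (poly t v) (poly k v) (poly e v) (poly q v) (poly l v)
      = map (\<lambda>p. poly p v) (near_coeffs (\<lambda>c. [:c:]) t k e q l)"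
    by (simp only: near_coeffs_def Let_def conv3.simps add5.simps list.map
        poly_mult poly_add poly_diff poly_pCons poly_0 mult_zero_right add_0_right)
  then show ?thesis
    using assms(1) horner_low_le[OF v] by (auto simp: list_all_iff intro: order_trans)
qed

text \<open>In these names the first index is the subinterval of \<open>e\<close>, of length 19, 31,
  19, 12 or 9 in units of \<open>1 / 128\<close>, and the second is the vertex. The polynomials are
  the scaled \<open>t\<close>, \<open>k\<close>, \<open>e\<close>, \<open>q\<close>,
  \<open>l\<close> in the variable \<open>v\<close>, which is \<open>128 e\<close> minus its value
  at the left end.\<close>

lemma near_check_1_1:
  "list_all (\<lambda>p. 0 \<le> horner_low 19 p)
    (near_coeffs (\<lambda>c. [:c:]) [:108, 108:] [:65280:] [:1, 1:] [:1607, 1615, 8:] [:12, 12:])"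
  by (simp add: near_coeffs_def Let_def horner_low_pCons)

lemma near_check_1_2:
  "list_all (\<lambda>p. 0 \<le> horner_low 19 p)
    (near_coeffs (\<lambda>c. [:c:]) [:108, 108:] [:65745, 348, - 2:] [:1, 1:] [:1607, 1615, 8:] [:12, 12:])"
  by (simp add: near_coeffs_def Let_def horner_low_pCons)

lemma near_check_1_3:
  "list_all (\<lambda>p. 0 \<le> horner_low 19 p)
    (near_coeffs (\<lambda>c. [:c:]) [:1541, 129:] [:70522, 377, - 2:] [:1, 1:] [:1607, 1615, 8:] [:12, 12:])"
  by (simp add: near_coeffs_def Let_def horner_low_pCons)

lemma near_check_2_1:
  "list_all (\<lambda>p. 0 \<le> horner_low 31 p)
    (near_coeffs (\<lambda>c. [:c:]) [:2160, 108:] [:65280:] [:20, 1:] [:35240, 1902, 7:] [:260, 13:])"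
  by (simp add: near_coeffs_def Let_def horner_low_pCons)

lemma near_check_2_2:
  "list_all (\<lambda>p. 0 \<le> horner_low 31 p)
    (near_coeffs (\<lambda>c. [:c:]) [:2160, 108:] [:71706, 255, - 1:] [:20, 1:] [:35240, 1902, 7:] [:260, 13:])"
  by (simp add: near_coeffs_def Let_def horner_low_pCons)

lemma near_check_2_3:
  "list_all (\<lambda>p. 0 \<le> horner_low 31 p)
    (near_coeffs (\<lambda>c. [:c:]) [:3992, 129:] [:77038, 276, - 1:] [:20, 1:] [:35240, 1902, 7:] [:260, 13:])"
  by (simp add: near_coeffs_def Let_def horner_low_pCons)

lemma near_check_3_1:
  "list_all (\<lambda>p. 0 \<le> horner_low 19 p)
    (near_coeffs (\<lambda>c. [:c:]) [:5508, 108:] [:65280:] [:51, 1:] [:101133, 2289, 6:] [:765, 15:])"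
  by (simp add: near_coeffs_def Let_def horner_low_pCons)

lemma near_check_3_2:
  "list_all (\<lambda>p. 0 \<le> horner_low 19 p)
    (near_coeffs (\<lambda>c. [:c:]) [:5508, 108:] [:78565, 186, - 1:] [:51, 1:] [:101133, 2289, 6:] [:765, 15:])"
  by (simp add: near_coeffs_def Let_def horner_low_pCons)

lemma near_check_3_3:
  "list_all (\<lambda>p. 0 \<le> horner_low 19 p)
    (near_coeffs (\<lambda>c. [:c:]) [:7991, 129:] [:84505, 202, - 1:] [:51, 1:] [:101133, 2289, 6:] [:765, 15:])"
  by (simp add: near_coeffs_def Let_def horner_low_pCons)

lemma near_check_4_1:
  "list_all (\<lambda>p. 0 \<le> horner_low 12 p)
    (near_coeffs (\<lambda>c. [:c:]) [:7560, 108:] [:65280:] [:70, 1:] [:146790, 2517, 6:] [:1120, 16:])"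
  by (simp add: near_coeffs_def Let_def horner_low_pCons)

lemma near_check_4_2:
  "list_all (\<lambda>p. 0 \<le> horner_low 12 p)
    (near_coeffs (\<lambda>c. [:c:]) [:7560, 108:] [:81738, 155, - 1:] [:70, 1:] [:146790, 2517, 6:] [:1120, 16:])"
  by (simp add: near_coeffs_def Let_def horner_low_pCons)

lemma near_check_4_3:
  "list_all (\<lambda>p. 0 \<le> horner_low 12 p)
    (near_coeffs (\<lambda>c. [:c:]) [:10442, 129:] [:87981, 168, - 1:] [:70, 1:] [:146790, 2517, 6:] [:1120, 16:])"
  by (simp add: near_coeffs_def Let_def horner_low_pCons)

lemma near_check_5_1:
  "list_all (\<lambda>p. 0 \<le> horner_low 9 p)
    (near_coeffs (\<lambda>c. [:c:]) [:8856, 108:] [:65280:] [:82, 1:] [:177858, 2661, 6:] [:1312, 16:])"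
  by (simp add: near_coeffs_def Let_def horner_low_pCons)

lemma near_check_5_2:
  "list_all (\<lambda>p. 0 \<le> horner_low 9 p)
    (near_coeffs (\<lambda>c. [:c:]) [:8856, 108:] [:83451, 138, - 1:] [:82, 1:] [:177858, 2661, 6:] [:1312, 16:])"
  by (simp add: near_coeffs_def Let_def horner_low_pCons)

lemma near_check_5_3:
  "list_all (\<lambda>p. 0 \<le> horner_low 9 p)
    (near_coeffs (\<lambda>c. [:c:]) [:11990, 129:] [:89853, 150, - 1:] [:82, 1:] [:177858, 2661, 6:] [:1312, 16:])"
  by (simp add: near_coeffs_def Let_def horner_low_pCons)

fun bern4 :: "real list \<Rightarrow> real \<Rightarrow> real \<Rightarrow> real" where
  "bern4 [a, b, c, d, e] u w = a * w ^ 4 + b * (w ^ 3 * u) + c * (w\<^sup>2 * u\<^sup>2) + d * (w * u ^ 3) + e * u ^ 4"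
| "bern4 _ _ _ = 0"

lemma length_near [simp]:
  "length (conv3 x y) = 5" "length xs = 5 \<Longrightarrow> length ys = 5 \<Longrightarrow> length (add5 xs ys) = 5"
  by (cases "(x, y)" rule: conv3.cases; simp) (cases "(xs, ys)" rule: add5.cases; simp)+

lemma bern4_conv3:
  "bern4 (conv3 (a, b, c) (a', b', c')) u w = (a * w\<^sup>2 + b * (w * u) + c * u\<^sup>2) * (a' * w\<^sup>2 + b' * (w * u) + c' * u\<^sup>2)"
  by (simp add: power2_eq_square power3_eq_cube power4_eq_xxxx algebra_simps)

lemma bern4_add5:
  "length xs = 5 \<Longrightarrow> length ys = 5 \<Longrightarrow> bern4 (add5 xs ys) u w = bern4 xs u w + bern4 ys u w"
  by (cases "(xs, ys)" rule: add5.cases) (simp_all add: algebra_simps)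

lemma bern4_nonneg:
  assumes "list_all (\<lambda>c. 0 \<le> c) xs" "0 \<le> u" "0 \<le> w"
  shows "0 \<le> bern4 xs u w"
  using assms by (cases "(xs, u, w)" rule: bern4.cases) auto

text \<open>With \<open>u = \<xi> / 2\<close> and \<open>w = 1 - u\<close> the factors become
  quadratic forms in \<open>(w, u)\<close>, and their products quartic forms with the given
  coefficients. \<open>q\<close> and \<open>l\<close> represent an upper and a lower bound of the
  same quantity \<open>s^2 - \<sigma>^2\<close>, which is why both occur.\<close>

lemma near_coeffs_form_nonneg:
  fixes t k e q l \<xi> :: real
  assumes nn: "list_all (\<lambda>c. 0 \<le> c) (near_coeffs (\<lambda>c. c) (8192 * t) (65536 * k) (128 * e) (1048576 * q) (8192 * l))"
    and \<xi>: "0 \<le> \<xi>" "\<xi> \<le> 2" and pos: "0 \<le> t" "0 \<le> k" "0 \<le> e" "0 \<le> q" "q \<le> e" "l \<le> 3"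
  defines "\<sigma> \<equiv> 31 / 128" and "x \<equiv> 1 - \<xi>"
  defines "m \<equiv> (1 + \<sigma>)\<^sup>2 - 2 * \<sigma> * \<xi>" and "\<rho> \<equiv> 1 + \<sigma> - \<sigma> * \<xi>" and "D \<equiv> e * (1 + 13 / 32 * \<xi>)"
  defines "W \<equiv> 2 * \<sigma> * \<xi> * (1 + 2 * \<sigma> - \<sigma> * \<xi>)" and "X \<equiv> 4 * \<sigma>\<^sup>2 * \<xi> * (2 * (1 + \<sigma>)\<^sup>2 - ((1 + \<sigma>)\<^sup>2 - 1) * \<xi>)"
    and "U \<equiv> (1 + \<sigma>)\<^sup>2 * (x + \<sigma>) - (x + 3 * \<sigma> + 3 * \<sigma>\<^sup>2 * x + \<sigma> ^ 3 * (2 * x\<^sup>2 - 1))"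
    and "V \<equiv> (1 + \<sigma>)\<^sup>2 * (x + \<sigma> * (2 * x\<^sup>2 - 1)) - m * (x + \<sigma>)"
  shows "0 \<le> 4 * \<sigma>\<^sup>2 * m * (2 * \<rho> - 1 + D - q) * t\<^sup>2 + 8 * \<sigma>\<^sup>2 * m * \<rho> * t * (1 - k * W)
     + 4 * \<sigma> * t * ((D - q) * m * (x + \<sigma> - k * U) - D * (x + \<sigma> * (2 * x\<^sup>2 - 1) - k * V))
     - ((m + D) * q * (4 * \<rho> - l) + (q + \<sigma>\<^sup>2) * D\<^sup>2) * (1 - 2 * k * W + k\<^sup>2 * X)" (is "0 \<le> ?K")
proof -
  define u where "u = \<xi> / 2"
  define w where "w = 1 - u"
  have uw: "0 \<le> u" "0 \<le> w" "\<xi> = 2 * u" "w + u = 1" using \<xi> by (auto simp: u_def w_def)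
  note defs = \<sigma>_def x_def m_def \<rho>_def D_def W_def X_def U_def V_def w_def uw(3)
  define L where "L = 2 * \<rho> - 1 + D - q"
  define A where "A = D - q"
  define G where "G = (m + D) * q * (4 * \<rho> - l) + (q + \<sigma>\<^sup>2) * D\<^sup>2"
  define R1 where "R1 = 159 / 128 * w\<^sup>2 + (31 / 64 + 635 / 1024 * k) * (w * u) + (751 / 1024 * k - 97 / 128) * u\<^sup>2"
  define R2 where "R2 = 159 / 128 * w\<^sup>2 + (1830 / 1024 * k - 93 / 64) * (w * u) + (752 / 1024 * k - 97 / 128) * u\<^sup>2"
  define N where "N = w\<^sup>2 + (2 - 2945 / 1024 * k + 1483 / 1024 * k\<^sup>2) * (w * u) + (1 - 31 / 16 * k + 961 / 1024 * k\<^sup>2) * u\<^sup>2"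
  have e1: "25281 * w + 9409 * u = 16384 * m" unfolding defs by (simp add: power2_eq_square field_simps)
  have D: "16 * (128 * e) * w + 29 * (128 * e) * u = 2048 * D" unfolding defs by (simp add: field_simps)
  have \<rho>4: "40704 * w + 24832 * u = 8192 * (4 * \<rho>)" unfolding defs by (simp add: field_simps)
  have \<rho>2: "1556480 * w + 540672 * u = 1048576 * (2 * \<rho> - 1)" unfolding defs by (simp add: field_simps)
  have mr: "3862911519 * w\<^sup>2 + 3794304768 * (w * u) + 877078753 * u\<^sup>2 = 4294967296 * (8 * \<sigma>\<^sup>2 * m * \<rho>)"
    unfolding defs by (simp add: power2_eq_square field_simps)
  have RP: "w\<^sup>2 + (2 - 2945 / 2048 * k) * (w * u) + (1 - 31 / 32 * k) * u\<^sup>2 = 1 - k * W"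
    unfolding defs by (simp add: power2_eq_square field_simps)
  have r1: "x + \<sigma> - k * U = R1 + k * ((162657 / 262144 - 635 / 1024) * (w * u) + (3007 / 4096 - 751 / 1024) * u\<^sup>2)"
    unfolding defs R1_def by (simp add: power2_eq_square power3_eq_cube field_simps)
  have r2: "x + \<sigma> * (2 * x\<^sup>2 - 1) - k * V = R2 - k * ((1830 / 1024 - 468255 / 262144) * (w * u) + (752 / 1024 - 3007 / 4096) * u\<^sup>2)"
    unfolding defs R2_def by (simp add: power2_eq_square power3_eq_cube field_simps)
  have nX: "1 - 2 * k * W + k\<^sup>2 * X = N - k\<^sup>2 * ((1483 / 1024 - 24295041 / 16777216) * (w * u))"
    unfolding defs N_def by (simp add: power2_eq_square power3_eq_cube field_simps)
  \<comment> \<open>The rounding errors. \<open>R1\<close> is rounded down, \<open>R2\<close> and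
    \<open>N\<close> are rounded up; since \<open>t\<close>, \<open>A\<close>, \<open>D\<close> and
    \<open>G\<close> are nonnegative, each error only lowers the expression.\<close>
  define s1 where "s1 = k * ((162657 / 262144 - 635 / 1024) * (w * u) + (3007 / 4096 - 751 / 1024) * u\<^sup>2)"
  define s2 where "s2 = k * ((1830 / 1024 - 468255 / 262144) * (w * u) + (752 / 1024 - 3007 / 4096) * u\<^sup>2)"
  define s3 where "s3 = k\<^sup>2 * ((1483 / 1024 - 24295041 / 16777216) * (w * u))"
  have s: "0 \<le> s1" "0 \<le> s2" "0 \<le> s3" using pos uw by (simp_all add: s1_def s2_def s3_def)
  have D0: "e \<le> D" using \<xi> pos by (simp add: D_def distrib_left)
  have m0: "0 \<le> m" using \<xi> by (simp add: m_def \<sigma>_def power2_eq_square)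
  have "0 \<le> G"
  proof -
    have "0 \<le> 4 * \<rho> - l" using \<xi> pos by (simp add: \<rho>_def \<sigma>_def)
    then show ?thesis unfolding G_def using pos D0 m0 by simp
  qed
  have "0 \<le> bern4 (near_coeffs (\<lambda>c. c) (8192 * t) (65536 * k) (128 * e) (1048576 * q) (8192 * l)) u w"
    by (rule bern4_nonneg[OF nn uw(1,2)])
  also have "\<dots> = 2 ^ 89 * (4 * \<sigma>\<^sup>2 * m * L * t\<^sup>2 + 8 * \<sigma>\<^sup>2 * m * \<rho> * t * (1 - k * W) + 4 * \<sigma> * t * (A * m * R1 - D * R2) - G * N)"
  proof -
    define d0 where "d0 = 16 * (128 * e)"
    define d1 where "d1 = 29 * (128 * e)"
    define qq where "qq = 1048576 * q"
    define l0 where "l0 = 1556480 + (512 * d0 - qq)"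
    define l1 where "l1 = 540672 + (512 * d1 - qq)"
    define b0 where "b0 = 25281 + 8 * d0"
    define b1 where "b1 = 9409 + 8 * d1"
    define f0 where "f0 = 40704 - 8192 * l"
    define f1 where "f1 = 24832 - 8192 * l"
    define S where "S = 32 * (61504 + qq)"
    have dd: "d0 * w + d1 * u = 2048 * D" using D by (simp add: d0_def d1_def)
    have c: "c * w + c * u = c" for c :: real using uw(4) by (simp add: distrib_left[symmetric])
    have ll: "l0 * w + l1 * u = 1048576 * L"
    proof -
      have "l0 * w + l1 * u = (1556480 * w + 540672 * u) + 512 * (d0 * w + d1 * u) - (qq * w + qq * u)"
        by (simp add: l0_def l1_def algebra_simps)
      then show ?thesis unfolding \<rho>2 dd c by (simp add: L_def qq_def algebra_simps)
    qed
    have aa: "(512 * d0 - qq) * w + (512 * d1 - qq) * u = 1048576 * A"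
    proof -
      have "(512 * d0 - qq) * w + (512 * d1 - qq) * u = 512 * (d0 * w + d1 * u) - (qq * w + qq * u)"
        by (simp add: algebra_simps)
      then show ?thesis unfolding dd c by (simp add: A_def qq_def algebra_simps)
    qed
    have bb: "b0 * w + b1 * u = 16384 * (m + D)"
    proof -
      have "b0 * w + b1 * u = (25281 * w + 9409 * u) + 8 * (d0 * w + d1 * u)"
        by (simp add: b0_def b1_def algebra_simps)
      then show ?thesis unfolding e1 dd by simp
    qed
    have ff: "f0 * w + f1 * u = 8192 * (4 * \<rho> - l)"
    proof -
      have "f0 * w + f1 * u = (40704 * w + 24832 * u) - (8192 * l * w + 8192 * l * u)"
        by (simp add: f0_def f1_def algebra_simps)
      then show ?thesis unfolding \<rho>4 c by simp
    qed
    have two: "p * r * w\<^sup>2 + (p * r' + p' * r) * (w * u) + p' * r' * u\<^sup>2 = (p * w + p' * u) * (r * w + r' * u)" for p p' r r' :: real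
      by (simp add: power2_eq_square algebra_simps)
    have one: "p * w\<^sup>2 + 2 * p * (w * u) + p * u\<^sup>2 = p" for p
    proof -
      have "p * w\<^sup>2 + 2 * p * (w * u) + p * u\<^sup>2 = p * (w + u)\<^sup>2" by (simp add: power2_sum algebra_simps)
      then show ?thesis using uw(4) by simp
    qed
    have dd2: "d0 * w\<^sup>2 + (d0 + d1) * (w * u) + d1 * u\<^sup>2 = 2048 * D"
    proof -
      have "d0 * w\<^sup>2 + (d0 + d1) * (w * u) + d1 * u\<^sup>2 = (d0 * w + d1 * u) * (w + u)" by (simp add: power2_eq_square algebra_simps)
      then show ?thesis using uw(4) dd by simp
    qed
    have gg: "(qq * (b0 * f0) + S * (d0 * d0)) * w\<^sup>2 + (qq * (b0 * f1 + b1 * f0) + S * (2 * (d0 * d1))) * (w * u) + (qq * (b1 * f1) + S * (d1 * d1)) * u\<^sup>2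
        = 140737488355328 * G"
    proof -
      have "(qq * (b0 * f0) + S * (d0 * d0)) * w\<^sup>2 + (qq * (b0 * f1 + b1 * f0) + S * (2 * (d0 * d1))) * (w * u) + (qq * (b1 * f1) + S * (d1 * d1)) * u\<^sup>2
         = qq * ((b0 * w + b1 * u) * (f0 * w + f1 * u)) + S * (d0 * w + d1 * u)\<^sup>2"
        by (simp add: power2_eq_square algebra_simps)
      then show ?thesis unfolding bb ff dd by (simp add: G_def S_def qq_def \<sigma>_def power2_eq_square algebra_simps)
    qed
    have E: "bern4 (near_coeffs (\<lambda>c. c) (8192 * t) (65536 * k) (128 * e) (1048576 * q) (8192 * l)) u w
       = (16384 * m) * (1048576 * L) * (125960192 * ((8192 * t) * (8192 * t)))
       + (131072 * 4294967296 * (8 * \<sigma>\<^sup>2 * m * \<rho>)) * (8192 * t) * (134217728 * (1 - k * W))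
       + (16384 * m) * (1048576 * A) * ((63488 * (8192 * t)) * (67108864 * R1))
       + (2048 * D) * ((- 532575944704 * (8192 * t)) * (67108864 * R2))
       + (140737488355328 * G) * (- 4398046511104 * N)"
    proof -
      let ?T = "8192 * t"
      let ?k = "65536 * k"
      have 1: "bern4 (conv3 (25281 * l0, 25281 * l1 + 9409 * l0, 9409 * l1) (p, 2 * p, p)) u w = (16384 * m) * (1048576 * L) * p" for p
        unfolding bern4_conv3 two one e1 ll ..
      have 2: "bern4 (conv3 (506319538618368 * T, 497327114551296 * T, 114960466313216 * T) (134217728, 268435456 - 2945 * ?k, 134217728 - 1984 * ?k)) u w
          = (131072 * 4294967296 * (8 * \<sigma>\<^sup>2 * m * \<rho>)) * T * (134217728 * (1 - k * W))" for T
      proof -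
        have "506319538618368 * T * w\<^sup>2 + 497327114551296 * T * (w * u) + 114960466313216 * T * u\<^sup>2
            = 131072 * T * (3862911519 * w\<^sup>2 + 3794304768 * (w * u) + 877078753 * u\<^sup>2)" by (simp add: algebra_simps)
        moreover have "134217728 * w\<^sup>2 + (268435456 - 2945 * ?k) * (w * u) + (134217728 - 1984 * ?k) * u\<^sup>2
            = 134217728 * (w\<^sup>2 + (2 - 2945 / 2048 * k) * (w * u) + (1 - 31 / 32 * k) * u\<^sup>2)" by (simp add: field_simps)
        ultimately show ?thesis unfolding bern4_conv3 mr RP by simp
      qed
      have 3: "bern4 (conv3 (25281 * (512 * d0 - qq), 25281 * (512 * d1 - qq) + 9409 * (512 * d0 - qq), 9409 * (512 * d1 - qq))
             (T * 83361792, T * (32505856 + 635 * ?k), T * (751 * ?k - 50855936))) u w = (16384 * m) * (1048576 * A) * (T * (67108864 * R1))" for T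
      proof -
        have "T * 83361792 * w\<^sup>2 + T * (32505856 + 635 * ?k) * (w * u) + T * (751 * ?k - 50855936) * u\<^sup>2 = T * (67108864 * R1)"
          unfolding R1_def by (simp add: field_simps)
        then show ?thesis unfolding bern4_conv3 two e1 aa by simp
      qed
      have 4: "bern4 (conv3 (d0, d0 + d1, d1) (T * 83361792, T * (1830 * ?k - 97517568), T * (752 * ?k - 50855936))) u w = (2048 * D) * (T * (67108864 * R2))" for T
      proof -
        have "T * 83361792 * w\<^sup>2 + T * (1830 * ?k - 97517568) * (w * u) + T * (752 * ?k - 50855936) * u\<^sup>2 = T * (67108864 * R2)"
          unfolding R2_def by (simp add: field_simps)
        then show ?thesis unfolding bern4_conv3 dd2 by simp
      qed
      have 5: "bern4 (conv3 (qq * (b0 * f0) + S * (d0 * d0), qq * (b0 * f1 + b1 * f0) + S * (2 * (d0 * d1)), qq * (b1 * f1) + S * (d1 * d1))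
             (- 4398046511104, 193003520 * ?k - 1483 * (?k * ?k) - 8796093022208, 130023424 * ?k - 961 * (?k * ?k) - 4398046511104)) u w = (140737488355328 * G) * (- 4398046511104 * N)"
      proof -
        have "- 4398046511104 * w\<^sup>2 + (193003520 * ?k - 1483 * (?k * ?k) - 8796093022208) * (w * u) + (130023424 * ?k - 961 * (?k * ?k) - 4398046511104) * u\<^sup>2 = - 4398046511104 * N"
          unfolding N_def by (simp add: power2_eq_square field_simps)
        then show ?thesis unfolding bern4_conv3 gg by simp
      qed
      show ?thesis
        unfolding near_coeffs_def Let_def d0_def[symmetric] d1_def[symmetric] qq_def[symmetric] l0_def[symmetric] l1_def[symmetric]
          b0_def[symmetric] b1_def[symmetric] f0_def[symmetric] f1_def[symmetric] S_def[symmetric]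
        by (simp only: bern4_add5 length_near 1 2 3 4 5)
    qed
    show ?thesis unfolding E by (simp add: \<sigma>_def power2_eq_square field_simps)
  qed
  finally have "0 \<le> 4 * \<sigma>\<^sup>2 * m * L * t\<^sup>2 + 8 * \<sigma>\<^sup>2 * m * \<rho> * t * (1 - k * W) + 4 * \<sigma> * t * (A * m * R1 - D * R2) - G * N"
    by simp
  also have "\<dots> \<le> 4 * \<sigma>\<^sup>2 * m * L * t\<^sup>2 + 8 * \<sigma>\<^sup>2 * m * \<rho> * t * (1 - k * W) + 4 * \<sigma> * t * (A * m * (R1 + s1) - D * (R2 - s2)) - G * (N - s3)"
  proof -
    have "A * m * R1 \<le> A * m * (R1 + s1)" using s m0 D0 pos by (intro mult_left_mono) (auto simp: A_def)
    moreover have "D * (R2 - s2) \<le> D * R2" using s D0 pos by (intro mult_left_mono) auto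
    ultimately have "4 * \<sigma> * t * (A * m * R1 - D * R2) \<le> 4 * \<sigma> * t * (A * m * (R1 + s1) - D * (R2 - s2))"
      using pos by (intro mult_left_mono) (auto simp: \<sigma>_def)
    moreover have "G * (N - s3) \<le> G * N" using s \<open>0 \<le> G\<close> by (intro mult_left_mono) auto
    ultimately show ?thesis by linarith
  qed
  also have "\<dots> = ?K" unfolding r1 r2 nX s1_def s2_def s3_def L_def A_def G_def ..
  finally show ?thesis .
qed

text \<open>At \<open>P = 1 - k X\<close> the form becomes a polynomial in \<open>\<xi>\<close>,
  \<open>k\<close>, \<open>t\<close> and the parameters, with no imaginary part of
  \<open>\<zeta>\<close> left; in this shape the Bernstein coefficients apply.\<close>

lemma limacon_form_gap:
  fixes \<zeta> :: complex and \<sigma> s D t k :: real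
  assumes "norm \<zeta> = 1"
  defines "x \<equiv> Re \<zeta>" and "\<xi> \<equiv> 1 - Re \<zeta>" and "q \<equiv> s\<^sup>2 - \<sigma>\<^sup>2"
  defines "m \<equiv> (1 + \<sigma>)\<^sup>2 - 2 * \<sigma> * \<xi>" and "\<rho> \<equiv> 1 + \<sigma> - \<sigma> * \<xi>"
    and "W \<equiv> 2 * \<sigma> * \<xi> * (1 + 2 * \<sigma> - \<sigma> * \<xi>)" and "X2 \<equiv> 4 * \<sigma>\<^sup>2 * \<xi> * (2 * (1 + \<sigma>)\<^sup>2 - ((1 + \<sigma>)\<^sup>2 - 1) * \<xi>)"
    and "U \<equiv> (1 + \<sigma>)\<^sup>2 * (x + \<sigma>) - (x + 3 * \<sigma> + 3 * \<sigma>\<^sup>2 * x + \<sigma> ^ 3 * (2 * x\<^sup>2 - 1))"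
    and "V \<equiv> (1 + \<sigma>)\<^sup>2 * (x + \<sigma> * (2 * x\<^sup>2 - 1)) - ((1 + \<sigma>)\<^sup>2 - 2 * \<sigma> * \<xi>) * (x + \<sigma>)"
    and "p \<equiv> 1 - of_real k * (of_real ((1 + \<sigma>)\<^sup>2) - (1 + of_real \<sigma> * \<zeta>)\<^sup>2)"
  shows "limacon_form \<sigma> s D \<zeta> t p = 4 * \<sigma>\<^sup>2 * m * (2 * \<rho> - 1 + D - q) * t\<^sup>2 + 8 * \<sigma>\<^sup>2 * m * \<rho> * t * (1 - k * W)
     + 4 * \<sigma> * t * ((D - q) * m * (x + \<sigma> - k * U) - D * (x + \<sigma> * (2 * x\<^sup>2 - 1) - k * V))
     - ((m + D) * q * (4 * \<rho> - q) + (q + \<sigma>\<^sup>2) * D\<^sup>2) * (1 - 2 * k * W + k\<^sup>2 * X2)"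
    and "(norm p)\<^sup>2 = 1 - 2 * k * W + k\<^sup>2 * X2" and "Re ((\<zeta> + of_real \<sigma>) * cnj p) = x + \<sigma> - k * U"
    and "Re p = 1 - k * W" and "(norm (\<zeta> + of_real \<sigma>))\<^sup>2 = m"
proof -
  note g = limacon_gap[OF assms(1), of \<sigma>]
  define X where "X = of_real ((1 + \<sigma>)\<^sup>2) - (1 + of_real \<sigma> * \<zeta>)\<^sup>2"
  have p: "p = 1 - of_real k * X" by (simp add: p_def X_def)
  have W: "Re X = W" unfolding X_def g(1) W_def \<xi>_def by simp
  have X2: "(norm X)\<^sup>2 = X2" unfolding X_def g(2) X2_def \<xi>_def by simp
  have U: "Re ((\<zeta> + of_real \<sigma>) * cnj X) = U" unfolding X_def g(3) U_def x_def by simp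
  have V: "Re (\<zeta> * (1 + of_real \<sigma> * \<zeta>) * cnj X) = V" unfolding X_def g(4) V_def x_def \<xi>_def by (simp add: power2_eq_square algebra_simps)
  have m: "1 + 2 * \<sigma> * Re \<zeta> + \<sigma>\<^sup>2 = m" by (simp add: m_def \<xi>_def power2_eq_square algebra_simps)
  have \<rho>: "1 + \<sigma> * Re \<zeta> = \<rho>" by (simp add: \<rho>_def \<xi>_def algebra_simps)
  show rp: "Re p = 1 - k * W" by (simp add: p W[symmetric])
  show np: "(norm p)\<^sup>2 = 1 - 2 * k * W + k\<^sup>2 * X2"
    unfolding p W[symmetric] X2[symmetric] cmod_power2 by (simp add: power2_eq_square algebra_simps)
  have lin: "Re (u * cnj p) = Re u - k * Re (u * cnj X)" for u by (simp add: p algebra_simps)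
  show u: "Re ((\<zeta> + of_real \<sigma>) * cnj p) = x + \<sigma> - k * U" unfolding lin U by (simp add: x_def)
  have "(Re \<zeta>)\<^sup>2 + (Im \<zeta>)\<^sup>2 = 1" using assms(1) by (simp add: cmod_def)
  then have "Re (\<zeta> * (1 + of_real \<sigma> * \<zeta>)) = x + \<sigma> * (2 * x\<^sup>2 - 1)"
    unfolding x_def by (simp add: power2_eq_square) algebra
  then have v: "Re (\<zeta> * (1 + of_real \<sigma> * \<zeta>) * cnj p) = x + \<sigma> * (2 * x\<^sup>2 - 1) - k * V" unfolding lin V by simp
  show "limacon_form \<sigma> s D \<zeta> t p = 4 * \<sigma>\<^sup>2 * m * (2 * \<rho> - 1 + D - q) * t\<^sup>2 + 8 * \<sigma>\<^sup>2 * m * \<rho> * t * (1 - k * W)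
     + 4 * \<sigma> * t * ((D - q) * m * (x + \<sigma> - k * U) - D * (x + \<sigma> * (2 * x\<^sup>2 - 1) - k * V))
     - ((m + D) * q * (4 * \<rho> - q) + (q + \<sigma>\<^sup>2) * D\<^sup>2) * (1 - 2 * k * W + k\<^sup>2 * X2)"
    unfolding limacon_form_def Let_def m \<rho> rp np u v q_def[symmetric] by (simp add: q_def)
  show "(norm (\<zeta> + of_real \<sigma>))\<^sup>2 = m"
    unfolding m[symmetric] cmod_power2 using \<open>(Re \<zeta>)\<^sup>2 + (Im \<zeta>)\<^sup>2 = 1\<close> by simp algebra
qed

text \<open>The form decreases in \<open>q = s\<^sup>2 - \<sigma>\<^sup>2\<close>, because \<open>|2 \<sigma> t + (\<zeta> + \<sigma>) p\<^sup>*|\<^sup>2 \<ge> 0\<close>; so \<open>q\<close> may be replaced by rational bounds.\<close>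

lemma limacon_form_vertex:
  fixes \<zeta> :: complex and s t k e q' l :: real
  assumes \<zeta>: "norm \<zeta> = 1"
    and nn: "list_all (\<lambda>c. 0 \<le> c) (near_coeffs (\<lambda>c. c) (8192 * t) (65536 * k) (128 * e) (1048576 * q') (8192 * l))"
    and pos: "0 \<le> t" "0 \<le> k" "0 \<le> e" "q' \<le> e"
    and q: "0 \<le> l" "l \<le> s\<^sup>2 - (31 / 128)\<^sup>2" "s\<^sup>2 - (31 / 128)\<^sup>2 \<le> q'" "l \<le> 1"
  shows "0 \<le> limacon_form (31 / 128) s (e * (1 + 13 / 32 * (1 - Re \<zeta>))) \<zeta> t
     (1 - of_real k * (of_real ((1 + 31 / 128)\<^sup>2) - (1 + of_real (31 / 128) * \<zeta>)\<^sup>2))"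
proof -
  define \<sigma> where "\<sigma> = (31 / 128 :: real)"
  define x where "x = Re \<zeta>"
  define \<xi> where "\<xi> = 1 - Re \<zeta>"
  define D where "D = e * (1 + 13 / 32 * \<xi>)"
  define q where "q = s\<^sup>2 - \<sigma>\<^sup>2"
  define m where "m = (1 + \<sigma>)\<^sup>2 - 2 * \<sigma> * \<xi>"
  define \<rho> where "\<rho> = 1 + \<sigma> - \<sigma> * \<xi>"
  define W where "W = 2 * \<sigma> * \<xi> * (1 + 2 * \<sigma> - \<sigma> * \<xi>)"
  define X2 where "X2 = 4 * \<sigma>\<^sup>2 * \<xi> * (2 * (1 + \<sigma>)\<^sup>2 - ((1 + \<sigma>)\<^sup>2 - 1) * \<xi>)"
  define U where "U = (1 + \<sigma>)\<^sup>2 * (x + \<sigma>) - (x + 3 * \<sigma> + 3 * \<sigma>\<^sup>2 * x + \<sigma> ^ 3 * (2 * x\<^sup>2 - 1))"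
  define V where "V = (1 + \<sigma>)\<^sup>2 * (x + \<sigma> * (2 * x\<^sup>2 - 1)) - m * (x + \<sigma>)"
  define p where "p = 1 - of_real k * (of_real ((1 + \<sigma>)\<^sup>2) - (1 + of_real \<sigma> * \<zeta>)\<^sup>2)"
  define R1 where "R1 = x + \<sigma> - k * U"
  define R2 where "R2 = x + \<sigma> * (2 * x\<^sup>2 - 1) - k * V"
  define N where "N = 1 - 2 * k * W + k\<^sup>2 * X2"
  have g1: "limacon_form \<sigma> s D \<zeta> t p = 4 * \<sigma>\<^sup>2 * m * (2 * \<rho> - 1 + D - q) * t\<^sup>2 + 8 * \<sigma>\<^sup>2 * m * \<rho> * t * (1 - k * W)
     + 4 * \<sigma> * t * ((D - q) * m * R1 - D * R2) - ((m + D) * q * (4 * \<rho> - q) + (q + \<sigma>\<^sup>2) * D\<^sup>2) * N"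
    unfolding N_def R1_def R2_def U_def V_def W_def X2_def m_def \<rho>_def q_def p_def \<xi>_def x_def
    by (rule limacon_form_gap(1)[OF \<zeta>])
  have g2: "(norm p)\<^sup>2 = N" unfolding N_def W_def X2_def \<xi>_def p_def by (rule limacon_form_gap(2)[OF \<zeta>])
  have g3: "Re ((\<zeta> + of_real \<sigma>) * cnj p) = R1" unfolding R1_def U_def x_def p_def by (rule limacon_form_gap(3)[OF \<zeta>])
  have g5: "(norm (\<zeta> + of_real \<sigma>))\<^sup>2 = m" unfolding m_def \<xi>_def by (rule limacon_form_gap(5)[OF \<zeta>])
  have \<xi>: "0 \<le> \<xi>" "\<xi> \<le> 2" using abs_Re_le_cmod[of \<zeta>] \<zeta> by (auto simp: \<xi>_def)
  have qq: "0 \<le> q'" "l \<le> q" "q \<le> q'" "0 \<le> q" using q by (auto simp: q_def \<sigma>_def)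
  have D0: "0 \<le> D" using \<xi> pos by (simp add: D_def)
  have m0: "0 \<le> m" using \<xi> by (simp add: m_def \<sigma>_def power2_eq_square)
  have \<rho>m: "m \<le> 4 * \<rho> - l" using \<xi> q(4) by (simp add: m_def \<rho>_def \<sigma>_def power2_eq_square)
  have N0: "0 \<le> N" using g2 by (metis zero_le_power2)
  have K: "0 \<le> 4 * \<sigma>\<^sup>2 * m * (2 * \<rho> - 1 + D - q') * t\<^sup>2 + 8 * \<sigma>\<^sup>2 * m * \<rho> * t * (1 - k * W)
     + 4 * \<sigma> * t * ((D - q') * m * R1 - D * R2) - ((m + D) * q' * (4 * \<rho> - l) + (q' + \<sigma>\<^sup>2) * D\<^sup>2) * N"
  proof -
    have xx: "x = 1 - \<xi>" by (simp add: x_def \<xi>_def)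
    have "l \<le> 3" using q(4) by simp
    then show ?thesis
      unfolding N_def R1_def R2_def U_def V_def W_def X2_def m_def \<rho>_def D_def xx \<sigma>_def
      by (rule near_coeffs_form_nonneg[OF nn \<xi> pos(1,2,3) qq(1) pos(4)])
  qed
  have "0 \<le> (norm (of_real (2 * \<sigma> * t) + (\<zeta> + of_real \<sigma>) * cnj p))\<^sup>2" by simp
  also have "\<dots> = (2 * \<sigma> * t)\<^sup>2 + 2 * (2 * \<sigma> * t) * Re ((\<zeta> + of_real \<sigma>) * cnj p) + (norm ((\<zeta> + of_real \<sigma>) * cnj p))\<^sup>2"
    unfolding cmod_power2 by (simp add: power2_eq_square algebra_simps)
  also have "\<dots> = 4 * \<sigma>\<^sup>2 * t\<^sup>2 + 4 * \<sigma> * t * R1 + m * N"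
    unfolding g3 norm_mult power_mult_distrib g5 complex_mod_cnj g2 by simp
  finally have "0 \<le> m * (4 * \<sigma>\<^sup>2 * t\<^sup>2 + 4 * \<sigma> * t * R1 + m * N)" using m0 by simp
  moreover have "m * (m * N) \<le> ((m + D) * (4 * \<rho> - l) + D\<^sup>2) * N"
  proof -
    have "m * m \<le> (m + D) * (4 * \<rho> - l)" using m0 D0 \<rho>m by (intro mult_mono) auto
    then have "m * m \<le> (m + D) * (4 * \<rho> - l) + D\<^sup>2" using zero_le_power2[of D] by linarith
    then have "m * m * N \<le> ((m + D) * (4 * \<rho> - l) + D\<^sup>2) * N" using N0 by (rule mult_right_mono)
    then show ?thesis by simp
  qed
  ultimately have "0 \<le> m * (4 * \<sigma>\<^sup>2 * t\<^sup>2 + 4 * \<sigma> * t * R1) + ((m + D) * (4 * \<rho> - l) + D\<^sup>2) * N"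
    by (simp add: distrib_left)
  \<comment> \<open>The form at \<open>q\<close> minus the bound \<open>K\<close> is exactly this
    product plus the term \<open>(m + D) q (q - l) N\<close> below.\<close>
  then have "0 \<le> (q' - q) * (m * (4 * \<sigma>\<^sup>2 * t\<^sup>2 + 4 * \<sigma> * t * R1) + ((m + D) * (4 * \<rho> - l) + D\<^sup>2) * N)"
    using qq by simp
  moreover have "0 \<le> (m + D) * q * (q - l) * N" using m0 D0 qq N0 by simp
  ultimately have "0 \<le> limacon_form \<sigma> s D \<zeta> t p"
    unfolding g1 using K by (simp add: algebra_simps)
  then show ?thesis unfolding p_def D_def \<xi>_def \<sigma>_def by simp
qed

section \<open>Rational data on five subintervals of \<open>e\<close>\<close>

text \<open>As \<open>s^2 - \<sigma>^2 = e - 2 (s - \<sigma>)\<close>, a bound by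
  \<open>e \<theta>\<close> compares \<open>1 + s\<close> with
  \<open>1 + \<sigma> + e (1 - \<theta>) / 2\<close>. Squaring turns this into the sign of an
  expression in \<open>e\<close> and \<open>\<theta>\<close>, and the square root that defines
  \<open>s\<close> disappears.\<close>

lemma limacon_diff_bounds:
  fixes \<sigma> s e \<theta> :: real
  assumes "0 < \<sigma>" "\<sigma> \<le> s" and e: "(1 + s)\<^sup>2 = (1 + \<sigma>)\<^sup>2 + e" and \<theta>: "\<theta> \<le> 1"
  shows "0 \<le> 1 - (1 + \<sigma>) * (1 - \<theta>) - e * (1 - \<theta>)\<^sup>2 / 4 \<Longrightarrow> s\<^sup>2 - \<sigma>\<^sup>2 \<le> e * \<theta>"
    and "1 - (1 + \<sigma>) * (1 - \<theta>) - e * (1 - \<theta>)\<^sup>2 / 4 \<le> 0 \<Longrightarrow> e * \<theta> \<le> s\<^sup>2 - \<sigma>\<^sup>2"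
proof -
  define y where "y = e * (1 - \<theta>) / 2"
  have "0 \<le> e" using e assms power_mono[of "1 + \<sigma>" "1 + s" 2] by simp
  then have y: "0 \<le> y" using \<theta> by (simp add: y_def)
  have sq: "(1 + \<sigma> + y)\<^sup>2 = (1 + s)\<^sup>2 - e * (1 - (1 + \<sigma>) * (1 - \<theta>) - e * (1 - \<theta>)\<^sup>2 / 4)"
    unfolding e y_def by (simp add: power2_eq_square field_simps)
  have q: "s\<^sup>2 - \<sigma>\<^sup>2 = e - 2 * (s - \<sigma>)" using e by (simp add: power2_eq_square algebra_simps)
  have y2: "2 * y = e - e * \<theta>" unfolding y_def by (simp add: field_simps)
  show "s\<^sup>2 - \<sigma>\<^sup>2 \<le> e * \<theta>" if "0 \<le> 1 - (1 + \<sigma>) * (1 - \<theta>) - e * (1 - \<theta>)\<^sup>2 / 4"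
  proof -
    have "(1 + \<sigma> + y)\<^sup>2 \<le> (1 + s)\<^sup>2" unfolding sq using mult_nonneg_nonneg[OF \<open>0 \<le> e\<close> that] by simp
    then have "1 + \<sigma> + y \<le> 1 + s" by (rule power2_le_imp_le) (use assms in simp)
    then have "s\<^sup>2 - \<sigma>\<^sup>2 \<le> e - 2 * y" unfolding q by simp
    then show ?thesis unfolding y2 by simp
  qed
  show "e * \<theta> \<le> s\<^sup>2 - \<sigma>\<^sup>2" if "1 - (1 + \<sigma>) * (1 - \<theta>) - e * (1 - \<theta>)\<^sup>2 / 4 \<le> 0"
  proof -
    have "(1 + s)\<^sup>2 \<le> (1 + \<sigma> + y)\<^sup>2" unfolding sq using mult_nonneg_nonpos[OF \<open>0 \<le> e\<close> that] by simp
    then have "1 + s \<le> 1 + \<sigma> + y" by (rule power2_le_imp_le) (use assms y in simp)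
    then have "e - 2 * y \<le> s\<^sup>2 - \<sigma>\<^sup>2" unfolding q by simp
    then show ?thesis unfolding y2 by simp
  qed
qed

text \<open>The three conditions on \<open>near_coeffs\<close> make the form nonnegative at vertices \<open>P = (1 - k X) / t\<close> of a polygon that contains
  all possible \<open>P = b - \<eta> X\<close>, where \<open>X = (1 + 31 / 128)\<^sup>2 - w\<close>; \<open>k2\<close>, \<open>k3\<close>, \<open>q\<close> and \<open>l\<close> are polynomials in \<open>e\<close>.\<close>

definition near_data :: "real \<Rightarrow> real \<Rightarrow> real \<Rightarrow> real \<Rightarrow> real \<Rightarrow> bool" where
  "near_data e k2 k3 q l \<longleftrightarrow>
    list_all (\<lambda>c. 0 \<le> c) (near_coeffs (\<lambda>c. c) (8192 * (27 / 16 * e)) (65536 * (255 / 256)) (128 * e) (1048576 * q) (8192 * l)) \<and>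
    list_all (\<lambda>c. 0 \<le> c) (near_coeffs (\<lambda>c. c) (8192 * (27 / 16 * e)) (65536 * k2) (128 * e) (1048576 * q) (8192 * l)) \<and>
    list_all (\<lambda>c. 0 \<le> c) (near_coeffs (\<lambda>c. c) (8192 * ((16512 * e + 1412) / 8192)) (65536 * k3) (128 * e) (1048576 * q) (8192 * l)) \<and>
    0 \<le> l \<and> l \<le> 1 \<and> q \<le> e \<and>
    99731 / 100000 * (e + 10027 / 10000 + 27 / 16 * e * (42074 / 100000)) \<le> k2 * (e + 10027 / 10000) \<and>
    99731 / 100000 * (e + 10027 / 10000 + (16512 * e + 1412) / 8192 * (42074 / 100000)) \<le> k3 * (e + 10027 / 10000) \<and>
    (\<forall>s. 31 / 128 \<le> s \<longrightarrow> (1 + s)\<^sup>2 = (1 + 31 / 128)\<^sup>2 + e \<longrightarrow> l \<le> s\<^sup>2 - (31 / 128)\<^sup>2 \<and> s\<^sup>2 - (31 / 128)\<^sup>2 \<le> q)"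

text \<open>The witnesses for \<open>k2\<close> and \<open>k3\<close> are quadratic over-estimates
  of the rational functions of \<open>e\<close> that \<open>near_data\<close> requires; those for
  \<open>q\<close> and \<open>l\<close> are \<open>e\<close> times an affine and a constant slope.
  The lemmas for the other subintervals have the same form.\<close>

lemma near_data_1:
  fixes e :: real
  assumes "1 / 128 \<le> e" "e \<le> 5 / 32"
  shows "\<exists>k2 k3 q l. near_data e k2 k3 q l"
proof -
  define v where "v = 128 * e - 1"
  have v: "0 \<le> v" "v \<le> 19" using assms by (simp_all add: v_def)
  have e: "e = (1 + v) / 128" by (simp add: v_def)
  \<comment> \<open>A certificate for the cubic in \<open>e\<close> of the next line; the square is
    centred close to the minimum of that cubic.\<close>
  have "0 \<le> (e - 17 / 256)\<^sup>2 * (6525 / 131072 + - (1 / 256) * e)" using assms by simp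
  then have \<theta>: "0 \<le> 1 - (1 + 31 / 128) * (1 - (1599 / 8192 + 1 / 8 * e)) - e * (1 - (1599 / 8192 + 1 / 8 * e))\<^sup>2 / 4"
    using assms by (simp add: power2_eq_square field_simps)
  have "near_data e ((65395 + 352 * (128 * e) + - (2) * (128 * e)\<^sup>2) / 65536) ((70143 + 381 * (128 * e) + - (2) * (128 * e)\<^sup>2) / 65536) (e * (1599 / 8192 + 1 / 8 * e)) (3 / 16 * e)"
    unfolding near_data_def
  proof (intro conjI allI impI)
    fix s :: real assume s: "31 / 128 \<le> s" "(1 + s)\<^sup>2 = (1 + 31 / 128)\<^sup>2 + e"
    show "3 / 16 * e \<le> s\<^sup>2 - (31 / 128)\<^sup>2"
      using limacon_diff_bounds(2)[OF _ s, of "3 / 16"] assms by (simp add: power2_eq_square field_simps)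
    show "s\<^sup>2 - (31 / 128)\<^sup>2 \<le> e * (1599 / 8192 + 1 / 8 * e)"
      using limacon_diff_bounds(1)[OF _ s _ \<theta>] assms by simp
  next
    have "poly [:108, 108:] v = 8192 * (27 / 16 * e)" "poly [:65280:] v = 65536 * (255 / 256)" "poly [:1, 1:] v = 128 * e" "poly [:1607, 1615, 8:] v = 1048576 * (e * (1599 / 8192 + 1 / 8 * e))" "poly [:12, 12:] v = 8192 * (3 / 16 * e)"
      unfolding v_def by (simp_all add: power2_eq_square field_simps)
    then show "list_all (\<lambda>c. 0 \<le> c) (near_coeffs (\<lambda>c. c) (8192 * (27 / 16 * e)) (65536 * (255 / 256)) (128 * e) (1048576 * (e * (1599 / 8192 + 1 / 8 * e))) (8192 * (3 / 16 * e)))"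
      using near_coeffs_nonneg[OF near_check_1_1 v] by (simp only:)
    have "poly [:108, 108:] v = 8192 * (27 / 16 * e)" "poly [:65745, 348, - (2):] v = 65536 * ((65395 + 352 * (128 * e) + - (2) * (128 * e)\<^sup>2) / 65536)" "poly [:1, 1:] v = 128 * e" "poly [:1607, 1615, 8:] v = 1048576 * (e * (1599 / 8192 + 1 / 8 * e))" "poly [:12, 12:] v = 8192 * (3 / 16 * e)"
      unfolding v_def by (simp_all add: power2_eq_square field_simps)
    then show "list_all (\<lambda>c. 0 \<le> c) (near_coeffs (\<lambda>c. c) (8192 * (27 / 16 * e)) (65536 * ((65395 + 352 * (128 * e) + - (2) * (128 * e)\<^sup>2) / 65536)) (128 * e) (1048576 * (e * (1599 / 8192 + 1 / 8 * e))) (8192 * (3 / 16 * e)))"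
      using near_coeffs_nonneg[OF near_check_1_2 v] by (simp only:)
    have "poly [:1541, 129:] v = 8192 * ((16512 * e + 1412) / 8192)" "poly [:70522, 377, - (2):] v = 65536 * ((70143 + 381 * (128 * e) + - (2) * (128 * e)\<^sup>2) / 65536)" "poly [:1, 1:] v = 128 * e" "poly [:1607, 1615, 8:] v = 1048576 * (e * (1599 / 8192 + 1 / 8 * e))" "poly [:12, 12:] v = 8192 * (3 / 16 * e)"
      unfolding v_def by (simp_all add: power2_eq_square field_simps)
    then show "list_all (\<lambda>c. 0 \<le> c) (near_coeffs (\<lambda>c. c) (8192 * ((16512 * e + 1412) / 8192)) (65536 * ((70143 + 381 * (128 * e) + - (2) * (128 * e)\<^sup>2) / 65536)) (128 * e) (1048576 * (e * (1599 / 8192 + 1 / 8 * e))) (8192 * (3 / 16 * e)))"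
      using near_coeffs_nonneg[OF near_check_1_3 v] by (simp only:)
    \<comment> \<open>This cubic in \<open>v\<close> is the difference of the two sides of the
      condition on \<open>k2\<close>.\<close>
    have "0 \<le> poly [:33500909433 / 81920000000000, - (9841313027 / 81920000000000), 27909 / 2621440000, - (1 / 4194304):] v"
    proof -
      have "0 \<le> (v - 121 / 16)\<^sup>2 * (147647 / 20971520000 + - (1 / 4194304) * v)" using v by simp
      then show ?thesis using v by (simp add: power2_eq_square field_simps)
    qed
    then show "99731 / 100000 * (e + 10027 / 10000 + 27 / 16 * e * (42074 / 100000)) \<le> (65395 + 352 * (128 * e) + - (2) * (128 * e)\<^sup>2) / 65536 * (e + 10027 / 10000)"
      unfolding e by (simp add: power2_eq_square field_simps)
    have "0 \<le> poly [:13634508589 / 20480000000000, - (14677568251 / 81920000000000), 73943 / 5242880000, - (1 / 4194304):] v"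
    proof -
      have "0 \<le> (v - 509 / 64)\<^sup>2 * (864963 / 83886080000 + - (1 / 4194304) * v)" using v by simp
      then show ?thesis using v by (simp add: power2_eq_square field_simps)
    qed
    then show "99731 / 100000 * (e + 10027 / 10000 + (16512 * e + 1412) / 8192 * (42074 / 100000)) \<le> (70143 + 381 * (128 * e) + - (2) * (128 * e)\<^sup>2) / 65536 * (e + 10027 / 10000)"
      unfolding e by (simp add: power2_eq_square field_simps)
  qed (use assms in \<open>simp_all add: mult_le_cancel_left1\<close>)
  then show ?thesis by blast
qed

lemma near_data_2:
  fixes e :: real
  assumes "5 / 32 \<le> e" "e \<le> 51 / 128"
  shows "\<exists>k2 k3 q l. near_data e k2 k3 q l"
proof -
  define v where "v = 128 * e - 20"
  have v: "0 \<le> v" "v \<le> 31" using assms by (simp_all add: v_def)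
  have e: "e = (20 + v) / 128" by (simp add: v_def)
  have "0 \<le> (e - 75 / 256)\<^sup>2 * (88305 / 2097152 + - (49 / 16384) * e)" using assms by simp
  then have \<theta>: "0 \<le> 1 - (1 + 31 / 128) * (1 - (811 / 4096 + 7 / 64 * e)) - e * (1 - (811 / 4096 + 7 / 64 * e))\<^sup>2 / 4"
    using assms by (simp add: power2_eq_square field_simps)
  have "near_data e ((66206 + 295 * (128 * e) + - (1) * (128 * e)\<^sup>2) / 65536) ((71118 + 316 * (128 * e) + - (1) * (128 * e)\<^sup>2) / 65536) (e * (811 / 4096 + 7 / 64 * e)) (13 / 64 * e)"
    unfolding near_data_def
  proof (intro conjI allI impI)
    fix s :: real assume s: "31 / 128 \<le> s" "(1 + s)\<^sup>2 = (1 + 31 / 128)\<^sup>2 + e"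
    show "13 / 64 * e \<le> s\<^sup>2 - (31 / 128)\<^sup>2"
      using limacon_diff_bounds(2)[OF _ s, of "13 / 64"] assms by (simp add: power2_eq_square field_simps)
    show "s\<^sup>2 - (31 / 128)\<^sup>2 \<le> e * (811 / 4096 + 7 / 64 * e)"
      using limacon_diff_bounds(1)[OF _ s _ \<theta>] assms by simp
  next
    have "poly [:2160, 108:] v = 8192 * (27 / 16 * e)" "poly [:65280:] v = 65536 * (255 / 256)" "poly [:20, 1:] v = 128 * e" "poly [:35240, 1902, 7:] v = 1048576 * (e * (811 / 4096 + 7 / 64 * e))" "poly [:260, 13:] v = 8192 * (13 / 64 * e)"
      unfolding v_def by (simp_all add: power2_eq_square field_simps)
    then show "list_all (\<lambda>c. 0 \<le> c) (near_coeffs (\<lambda>c. c) (8192 * (27 / 16 * e)) (65536 * (255 / 256)) (128 * e) (1048576 * (e * (811 / 4096 + 7 / 64 * e))) (8192 * (13 / 64 * e)))"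
      using near_coeffs_nonneg[OF near_check_2_1 v] by (simp only:)
    have "poly [:2160, 108:] v = 8192 * (27 / 16 * e)" "poly [:71706, 255, - (1):] v = 65536 * ((66206 + 295 * (128 * e) + - (1) * (128 * e)\<^sup>2) / 65536)" "poly [:20, 1:] v = 128 * e" "poly [:35240, 1902, 7:] v = 1048576 * (e * (811 / 4096 + 7 / 64 * e))" "poly [:260, 13:] v = 8192 * (13 / 64 * e)"
      unfolding v_def by (simp_all add: power2_eq_square field_simps)
    then show "list_all (\<lambda>c. 0 \<le> c) (near_coeffs (\<lambda>c. c) (8192 * (27 / 16 * e)) (65536 * ((66206 + 295 * (128 * e) + - (1) * (128 * e)\<^sup>2) / 65536)) (128 * e) (1048576 * (e * (811 / 4096 + 7 / 64 * e))) (8192 * (13 / 64 * e)))"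
      using near_coeffs_nonneg[OF near_check_2_2 v] by (simp only:)
    have "poly [:3992, 129:] v = 8192 * ((16512 * e + 1412) / 8192)" "poly [:77038, 276, - (1):] v = 65536 * ((71118 + 316 * (128 * e) + - (1) * (128 * e)\<^sup>2) / 65536)" "poly [:20, 1:] v = 128 * e" "poly [:35240, 1902, 7:] v = 1048576 * (e * (811 / 4096 + 7 / 64 * e))" "poly [:260, 13:] v = 8192 * (13 / 64 * e)"
      unfolding v_def by (simp_all add: power2_eq_square field_simps)
    then show "list_all (\<lambda>c. 0 \<le> c) (near_coeffs (\<lambda>c. c) (8192 * ((16512 * e + 1412) / 8192)) (65536 * ((71118 + 316 * (128 * e) + - (1) * (128 * e)\<^sup>2) / 65536)) (128 * e) (1048576 * (e * (811 / 4096 + 7 / 64 * e))) (8192 * (13 / 64 * e)))"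
      using near_coeffs_nonneg[OF near_check_2_3 v] by (simp only:)
    have "0 \<le> poly [:3256408423 / 2048000000000, - (10893023701 / 40960000000000), 66659 / 5242880000, - (1 / 8388608):] v"
    proof -
      have "0 \<le> (v - 51 / 4)\<^sup>2 * (101443 / 10485760000 + - (1 / 8388608) * v)" using v by simp
      then show ?thesis using v by (simp add: power2_eq_square field_simps)
    qed
    then show "99731 / 100000 * (e + 10027 / 10000 + 27 / 16 * e * (42074 / 100000)) \<le> (66206 + 295 * (128 * e) + - (1) * (128 * e)\<^sup>2) / 65536 * (e + 10027 / 10000)"
      unfolding e by (simp add: power2_eq_square field_simps)
    have "0 \<le> poly [:20929461339 / 10240000000000, - (428297209 / 1280000000000), 9973 / 655360000, - (1 / 8388608):] v"
    proof -
      have "0 \<le> (v - 415 / 32)\<^sup>2 * (1017169 / 83886080000 + - (1 / 8388608) * v)" using v by simp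
      then show ?thesis using v by (simp add: power2_eq_square field_simps)
    qed
    then show "99731 / 100000 * (e + 10027 / 10000 + (16512 * e + 1412) / 8192 * (42074 / 100000)) \<le> (71118 + 316 * (128 * e) + - (1) * (128 * e)\<^sup>2) / 65536 * (e + 10027 / 10000)"
      unfolding e by (simp add: power2_eq_square field_simps)
  qed (use assms in \<open>simp_all add: mult_le_cancel_left1\<close>)
  then show ?thesis by blast
qed

lemma near_data_3:
  fixes e :: real
  assumes "51 / 128 \<le> e" "e \<le> 35 / 64"
  shows "\<exists>k2 k3 q l. near_data e k2 k3 q l"
proof -
  define v where "v = 128 * e - 51"
  have v: "0 \<le> v" "v \<le> 19" using assms by (simp_all add: v_def)
  have e: "e = (51 + v) / 128" by (simp add: v_def)
  have "0 \<le> (e - 35 / 64)\<^sup>2 * (18285 / 524288 + - (9 / 4096) * e)" using assms by simp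
  then have \<theta>: "0 \<le> 1 - (1 + 31 / 128) * (1 - (1677 / 8192 + 3 / 32 * e)) - e * (1 - (1677 / 8192 + 3 / 32 * e))\<^sup>2 / 4"
    using assms by (simp add: power2_eq_square field_simps)
  have "near_data e ((66478 + 288 * (128 * e) + - (1) * (128 * e)\<^sup>2) / 65536) ((71602 + 304 * (128 * e) + - (1) * (128 * e)\<^sup>2) / 65536) (e * (1677 / 8192 + 3 / 32 * e)) (15 / 64 * e)"
    unfolding near_data_def
  proof (intro conjI allI impI)
    fix s :: real assume s: "31 / 128 \<le> s" "(1 + s)\<^sup>2 = (1 + 31 / 128)\<^sup>2 + e"
    show "15 / 64 * e \<le> s\<^sup>2 - (31 / 128)\<^sup>2"
      using limacon_diff_bounds(2)[OF _ s, of "15 / 64"] assms by (simp add: power2_eq_square field_simps)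
    show "s\<^sup>2 - (31 / 128)\<^sup>2 \<le> e * (1677 / 8192 + 3 / 32 * e)"
      using limacon_diff_bounds(1)[OF _ s _ \<theta>] assms by simp
  next
    have "poly [:5508, 108:] v = 8192 * (27 / 16 * e)" "poly [:65280:] v = 65536 * (255 / 256)" "poly [:51, 1:] v = 128 * e" "poly [:101133, 2289, 6:] v = 1048576 * (e * (1677 / 8192 + 3 / 32 * e))" "poly [:765, 15:] v = 8192 * (15 / 64 * e)"
      unfolding v_def by (simp_all add: power2_eq_square field_simps)
    then show "list_all (\<lambda>c. 0 \<le> c) (near_coeffs (\<lambda>c. c) (8192 * (27 / 16 * e)) (65536 * (255 / 256)) (128 * e) (1048576 * (e * (1677 / 8192 + 3 / 32 * e))) (8192 * (15 / 64 * e)))"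
      using near_coeffs_nonneg[OF near_check_3_1 v] by (simp only:)
    have "poly [:5508, 108:] v = 8192 * (27 / 16 * e)" "poly [:78565, 186, - (1):] v = 65536 * ((66478 + 288 * (128 * e) + - (1) * (128 * e)\<^sup>2) / 65536)" "poly [:51, 1:] v = 128 * e" "poly [:101133, 2289, 6:] v = 1048576 * (e * (1677 / 8192 + 3 / 32 * e))" "poly [:765, 15:] v = 8192 * (15 / 64 * e)"
      unfolding v_def by (simp_all add: power2_eq_square field_simps)
    then show "list_all (\<lambda>c. 0 \<le> c) (near_coeffs (\<lambda>c. c) (8192 * (27 / 16 * e)) (65536 * ((66478 + 288 * (128 * e) + - (1) * (128 * e)\<^sup>2) / 65536)) (128 * e) (1048576 * (e * (1677 / 8192 + 3 / 32 * e))) (8192 * (15 / 64 * e)))"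
      using near_coeffs_nonneg[OF near_check_3_2 v] by (simp only:)
    have "poly [:7991, 129:] v = 8192 * ((16512 * e + 1412) / 8192)" "poly [:84505, 202, - (1):] v = 65536 * ((71602 + 304 * (128 * e) + - (1) * (128 * e)\<^sup>2) / 65536)" "poly [:51, 1:] v = 128 * e" "poly [:101133, 2289, 6:] v = 1048576 * (e * (1677 / 8192 + 3 / 32 * e))" "poly [:765, 15:] v = 8192 * (15 / 64 * e)"
      unfolding v_def by (simp_all add: power2_eq_square field_simps)
    then show "list_all (\<lambda>c. 0 \<le> c) (near_coeffs (\<lambda>c. c) (8192 * ((16512 * e + 1412) / 8192)) (65536 * ((71602 + 304 * (128 * e) + - (1) * (128 * e)\<^sup>2) / 65536)) (128 * e) (1048576 * (e * (1677 / 8192 + 3 / 32 * e))) (8192 * (15 / 64 * e)))"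
      using near_coeffs_nonneg[OF near_check_3_3 v] by (simp only:)
    have "0 \<le> poly [:16016820583 / 81920000000000, 1545530723 / 81920000000000, 4159 / 5242880000, - (1 / 8388608):] v"
      by (rule order_trans[OF _ horner_low_le[OF v]]) (simp add: horner_low_pCons)
    then show "99731 / 100000 * (e + 10027 / 10000 + 27 / 16 * e * (42074 / 100000)) \<le> (66478 + 288 * (128 * e) + - (1) * (128 * e)\<^sup>2) / 65536 * (e + 10027 / 10000)"
      unfolding e by (simp add: power2_eq_square field_simps)
    have "0 \<le> poly [:590918681 / 81920000000000, - (541630751 / 81920000000000), 14159 / 5242880000, - (1 / 8388608):] v"
    proof -
      have "0 \<le> (v - 43 / 32)\<^sup>2 * (199669 / 83886080000 + - (1 / 8388608) * v)" using v by simp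
      then show ?thesis using v by (simp add: power2_eq_square field_simps)
    qed
    then show "99731 / 100000 * (e + 10027 / 10000 + (16512 * e + 1412) / 8192 * (42074 / 100000)) \<le> (71602 + 304 * (128 * e) + - (1) * (128 * e)\<^sup>2) / 65536 * (e + 10027 / 10000)"
      unfolding e by (simp add: power2_eq_square field_simps)
  qed (use assms in \<open>simp_all add: mult_le_cancel_left1\<close>)
  then show ?thesis by blast
qed

lemma near_data_4:
  fixes e :: real
  assumes "35 / 64 \<le> e" "e \<le> 41 / 64"
  shows "\<exists>k2 k3 q l. near_data e k2 k3 q l"
proof -
  define v where "v = 128 * e - 70"
  have v: "0 \<le> v" "v \<le> 12" using assms by (simp_all add: v_def)
  have e: "e = (70 + v) / 128" by (simp add: v_def)
  have "0 \<le> (e - 151 / 256)\<^sup>2 * (9093 / 262144 + - (9 / 4096) * e)" using assms by simp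
  then have \<theta>: "0 \<le> 1 - (1 + 31 / 128) * (1 - (1677 / 8192 + 3 / 32 * e)) - e * (1 - (1677 / 8192 + 3 / 32 * e))\<^sup>2 / 4"
    using assms by (simp add: power2_eq_square field_simps)
  have "near_data e ((65988 + 295 * (128 * e) + - (1) * (128 * e)\<^sup>2) / 65536) ((71321 + 308 * (128 * e) + - (1) * (128 * e)\<^sup>2) / 65536) (e * (1677 / 8192 + 3 / 32 * e)) (1 / 4 * e)"
    unfolding near_data_def
  proof (intro conjI allI impI)
    fix s :: real assume s: "31 / 128 \<le> s" "(1 + s)\<^sup>2 = (1 + 31 / 128)\<^sup>2 + e"
    show "1 / 4 * e \<le> s\<^sup>2 - (31 / 128)\<^sup>2"
      using limacon_diff_bounds(2)[OF _ s, of "1 / 4"] assms by (simp add: power2_eq_square field_simps)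
    show "s\<^sup>2 - (31 / 128)\<^sup>2 \<le> e * (1677 / 8192 + 3 / 32 * e)"
      using limacon_diff_bounds(1)[OF _ s _ \<theta>] assms by simp
  next
    have "poly [:7560, 108:] v = 8192 * (27 / 16 * e)" "poly [:65280:] v = 65536 * (255 / 256)" "poly [:70, 1:] v = 128 * e" "poly [:146790, 2517, 6:] v = 1048576 * (e * (1677 / 8192 + 3 / 32 * e))" "poly [:1120, 16:] v = 8192 * (1 / 4 * e)"
      unfolding v_def by (simp_all add: power2_eq_square field_simps)
    then show "list_all (\<lambda>c. 0 \<le> c) (near_coeffs (\<lambda>c. c) (8192 * (27 / 16 * e)) (65536 * (255 / 256)) (128 * e) (1048576 * (e * (1677 / 8192 + 3 / 32 * e))) (8192 * (1 / 4 * e)))"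
      using near_coeffs_nonneg[OF near_check_4_1 v] by (simp only:)
    have "poly [:7560, 108:] v = 8192 * (27 / 16 * e)" "poly [:81738, 155, - (1):] v = 65536 * ((65988 + 295 * (128 * e) + - (1) * (128 * e)\<^sup>2) / 65536)" "poly [:70, 1:] v = 128 * e" "poly [:146790, 2517, 6:] v = 1048576 * (e * (1677 / 8192 + 3 / 32 * e))" "poly [:1120, 16:] v = 8192 * (1 / 4 * e)"
      unfolding v_def by (simp_all add: power2_eq_square field_simps)
    then show "list_all (\<lambda>c. 0 \<le> c) (near_coeffs (\<lambda>c. c) (8192 * (27 / 16 * e)) (65536 * ((65988 + 295 * (128 * e) + - (1) * (128 * e)\<^sup>2) / 65536)) (128 * e) (1048576 * (e * (1677 / 8192 + 3 / 32 * e))) (8192 * (1 / 4 * e)))"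
      using near_coeffs_nonneg[OF near_check_4_2 v] by (simp only:)
    have "poly [:10442, 129:] v = 8192 * ((16512 * e + 1412) / 8192)" "poly [:87981, 168, - (1):] v = 65536 * ((71321 + 308 * (128 * e) + - (1) * (128 * e)\<^sup>2) / 65536)" "poly [:70, 1:] v = 128 * e" "poly [:146790, 2517, 6:] v = 1048576 * (e * (1677 / 8192 + 3 / 32 * e))" "poly [:1120, 16:] v = 8192 * (1 / 4 * e)"
      unfolding v_def by (simp_all add: power2_eq_square field_simps)
    then show "list_all (\<lambda>c. 0 \<le> c) (near_coeffs (\<lambda>c. c) (8192 * ((16512 * e + 1412) / 8192)) (65536 * ((71321 + 308 * (128 * e) + - (1) * (128 * e)\<^sup>2) / 65536)) (128 * e) (1048576 * (e * (1677 / 8192 + 3 / 32 * e))) (8192 * (1 / 4 * e)))"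
      using near_coeffs_nonneg[OF near_check_4_3 v] by (simp only:)
    have "0 \<le> poly [:92942091 / 4096000000000, 1749386587 / 20480000000000, - (27091 / 5242880000), - (1 / 8388608):] v"
      by (rule order_trans[OF _ horner_low_le[OF v]]) (simp add: horner_low_pCons)
    then show "99731 / 100000 * (e + 10027 / 10000 + 27 / 16 * e * (42074 / 100000)) \<le> (65988 + 295 * (128 * e) + - (1) * (128 * e)\<^sup>2) / 65536 * (e + 10027 / 10000)"
      unfolding e by (simp add: power2_eq_square field_simps)
    have "0 \<le> poly [:623076581 / 40960000000000, 5027212999 / 81920000000000, - (9483 / 2621440000), - (1 / 8388608):] v"
      by (rule order_trans[OF _ horner_low_le[OF v]]) (simp add: horner_low_pCons)
    then show "99731 / 100000 * (e + 10027 / 10000 + (16512 * e + 1412) / 8192 * (42074 / 100000)) \<le> (71321 + 308 * (128 * e) + - (1) * (128 * e)\<^sup>2) / 65536 * (e + 10027 / 10000)"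
      unfolding e by (simp add: power2_eq_square field_simps)
  qed (use assms in \<open>simp_all add: mult_le_cancel_left1\<close>)
  then show ?thesis by blast
qed

lemma near_data_5:
  fixes e :: real
  assumes "41 / 64 \<le> e" "e \<le> 91 / 128"
  shows "\<exists>k2 k3 q l. near_data e k2 k3 q l"
proof -
  define v where "v = 128 * e - 82"
  have v: "0 \<le> v" "v \<le> 9" using assms by (simp_all add: v_def)
  have e: "e = (82 + v) / 128" by (simp add: v_def)
  have "0 \<le> (e - 41 / 64)\<^sup>2 * (18069 / 524288 + - (9 / 4096) * e)" using assms by simp
  then have \<theta>: "0 \<le> 1 - (1 + 31 / 128) * (1 - (1677 / 8192 + 3 / 32 * e)) - e * (1 - (1677 / 8192 + 3 / 32 * e))\<^sup>2 / 4"
    using assms by (simp add: power2_eq_square field_simps)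
  have "near_data e ((65411 + 302 * (128 * e) + - (1) * (128 * e)\<^sup>2) / 65536) ((70829 + 314 * (128 * e) + - (1) * (128 * e)\<^sup>2) / 65536) (e * (1677 / 8192 + 3 / 32 * e)) (1 / 4 * e)"
    unfolding near_data_def
  proof (intro conjI allI impI)
    fix s :: real assume s: "31 / 128 \<le> s" "(1 + s)\<^sup>2 = (1 + 31 / 128)\<^sup>2 + e"
    show "1 / 4 * e \<le> s\<^sup>2 - (31 / 128)\<^sup>2"
      using limacon_diff_bounds(2)[OF _ s, of "1 / 4"] assms by (simp add: power2_eq_square field_simps)
    show "s\<^sup>2 - (31 / 128)\<^sup>2 \<le> e * (1677 / 8192 + 3 / 32 * e)"
      using limacon_diff_bounds(1)[OF _ s _ \<theta>] assms by simp
  next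
    have "poly [:8856, 108:] v = 8192 * (27 / 16 * e)" "poly [:65280:] v = 65536 * (255 / 256)" "poly [:82, 1:] v = 128 * e" "poly [:177858, 2661, 6:] v = 1048576 * (e * (1677 / 8192 + 3 / 32 * e))" "poly [:1312, 16:] v = 8192 * (1 / 4 * e)"
      unfolding v_def by (simp_all add: power2_eq_square field_simps)
    then show "list_all (\<lambda>c. 0 \<le> c) (near_coeffs (\<lambda>c. c) (8192 * (27 / 16 * e)) (65536 * (255 / 256)) (128 * e) (1048576 * (e * (1677 / 8192 + 3 / 32 * e))) (8192 * (1 / 4 * e)))"
      using near_coeffs_nonneg[OF near_check_5_1 v] by (simp only:)
    have "poly [:8856, 108:] v = 8192 * (27 / 16 * e)" "poly [:83451, 138, - (1):] v = 65536 * ((65411 + 302 * (128 * e) + - (1) * (128 * e)\<^sup>2) / 65536)" "poly [:82, 1:] v = 128 * e" "poly [:177858, 2661, 6:] v = 1048576 * (e * (1677 / 8192 + 3 / 32 * e))" "poly [:1312, 16:] v = 8192 * (1 / 4 * e)"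
      unfolding v_def by (simp_all add: power2_eq_square field_simps)
    then show "list_all (\<lambda>c. 0 \<le> c) (near_coeffs (\<lambda>c. c) (8192 * (27 / 16 * e)) (65536 * ((65411 + 302 * (128 * e) + - (1) * (128 * e)\<^sup>2) / 65536)) (128 * e) (1048576 * (e * (1677 / 8192 + 3 / 32 * e))) (8192 * (1 / 4 * e)))"
      using near_coeffs_nonneg[OF near_check_5_2 v] by (simp only:)
    have "poly [:11990, 129:] v = 8192 * ((16512 * e + 1412) / 8192)" "poly [:89853, 150, - (1):] v = 65536 * ((70829 + 314 * (128 * e) + - (1) * (128 * e)\<^sup>2) / 65536)" "poly [:82, 1:] v = 128 * e" "poly [:177858, 2661, 6:] v = 1048576 * (e * (1677 / 8192 + 3 / 32 * e))" "poly [:1312, 16:] v = 8192 * (1 / 4 * e)"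
      unfolding v_def by (simp_all add: power2_eq_square field_simps)
    then show "list_all (\<lambda>c. 0 \<le> c) (near_coeffs (\<lambda>c. c) (8192 * ((16512 * e + 1412) / 8192)) (65536 * ((70829 + 314 * (128 * e) + - (1) * (128 * e)\<^sup>2) / 65536)) (128 * e) (1048576 * (e * (1677 / 8192 + 3 / 32 * e))) (8192 * (1 / 4 * e)))"
      using near_coeffs_nonneg[OF near_check_5_3 v] by (simp only:)
    have "0 \<le> poly [:918589623 / 40960000000000, 6969468223 / 81920000000000, - (1413 / 163840000), - (1 / 8388608):] v"
      by (rule order_trans[OF _ horner_low_le[OF v]]) (simp add: horner_low_pCons)
    then show "99731 / 100000 * (e + 10027 / 10000 + 27 / 16 * e * (42074 / 100000)) \<le> (65411 + 302 * (128 * e) + - (1) * (128 * e)\<^sup>2) / 65536 * (e + 10027 / 10000)"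
      unfolding e by (simp add: power2_eq_square field_simps)
    have "0 \<le> poly [:40484183 / 1638400000000, 6021150499 / 81920000000000, - (9429 / 1310720000), - (1 / 8388608):] v"
      by (rule order_trans[OF _ horner_low_le[OF v]]) (simp add: horner_low_pCons)
    then show "99731 / 100000 * (e + 10027 / 10000 + (16512 * e + 1412) / 8192 * (42074 / 100000)) \<le> (70829 + 314 * (128 * e) + - (1) * (128 * e)\<^sup>2) / 65536 * (e + 10027 / 10000)"
      unfolding e by (simp add: power2_eq_square field_simps)
  qed (use assms in \<open>simp_all add: mult_le_cancel_left1\<close>)
  then show ?thesis by blast
qed

section \<open>Comparison of \<open>p\<close> with limacons and with a disc\<close>

text \<open>By homogeneity \<open>(M, P)\<close> may be replaced by \<open>(1, P / M)\<close>, and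
  \<open>P / M\<close> lies on the segment from \<open>0\<close> to \<open>P\<close> because
  \<open>M \<ge> 1\<close>. Convexity then reduces all \<open>M\<close> to the two end points,
  tested by \<open>form0\<close> and \<open>form1\<close>.\<close>

lemma briot_bouquet_limacon:
  fixes \<eta> \<gamma> \<sigma> s :: real and D :: "complex \<Rightarrow> real"
  assumes \<sigma>: "0 < \<sigma>" "\<sigma> < 1" and s: "0 < s" "s \<le> 1"
    and hp: "p holomorphic_on unit_disc" and p0: "p 0 = 1" and ne: "\<gamma> \<noteq> - \<eta>"
    and hF: "(\<lambda>z. p z + z * deriv p z / (of_real \<eta> * p z + of_real \<gamma>)) holomorphic_on unit_disc"
    and T: "\<And>z. z \<in> unit_disc \<Longrightarrow> p z + z * deriv p z / (of_real \<eta> * p z + of_real \<gamma>) \<in> qcurve (2 * s) (s\<^sup>2) ` unit_disc"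
    and D: "\<And>\<zeta>. norm \<zeta> = 1 \<Longrightarrow> 0 < 1 + 2 * \<sigma> * Re \<zeta> + \<sigma>\<^sup>2 + D \<zeta>"
    and coef: "\<And>\<zeta>. norm \<zeta> = 1 \<Longrightarrow> 0 \<le> (1 + 2 * \<sigma> * Re \<zeta> + \<sigma>\<^sup>2 + D \<zeta>) * (s\<^sup>2 - \<sigma>\<^sup>2) * (4 * (1 + \<sigma> * Re \<zeta>) - (s\<^sup>2 - \<sigma>\<^sup>2)) + s\<^sup>2 * (D \<zeta>)\<^sup>2"
    and form0: "\<And>\<zeta>. norm \<zeta> = 1 \<Longrightarrow> 0 \<le> limacon_form \<sigma> s (D \<zeta>) \<zeta> 1 0"
    and form1: "\<And>\<zeta>. norm \<zeta> = 1 \<Longrightarrow> 0 \<le> limacon_form \<sigma> s (D \<zeta>) \<zeta> 1 (of_real \<eta> * qcurve (2 * \<sigma>) (\<sigma>\<^sup>2) \<zeta> + of_real \<gamma>)"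
  shows "p ` unit_disc \<subseteq> qcurve (2 * \<sigma>) (\<sigma>\<^sup>2) ` unit_disc"
proof (rule briot_bouquet_curve[OF _ _ hp p0 ne hF T])
  show "0 \<le> \<sigma>\<^sup>2" "2 * \<sigma>\<^sup>2 < 2 * \<sigma>" using \<sigma> by (simp_all add: power2_eq_square)
  fix \<zeta> P :: complex and M :: real
  assume \<zeta>: "norm \<zeta> = 1" and M: "M \<ge> 1" and P: "P = of_real \<eta> * qcurve (2 * \<sigma>) (\<sigma>\<^sup>2) \<zeta> + of_real \<gamma>" and "P \<noteq> 0"
  have "(1 - 1 / M) *\<^sub>R 0 + (1 / M) *\<^sub>R P \<in> {P. 0 \<le> limacon_form \<sigma> s (D \<zeta>) \<zeta> 1 P}"
    by (rule convexD_alt[OF convex_limacon_form[OF coef[OF \<zeta>]]])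
      (use form0[OF \<zeta>] form1[OF \<zeta>] M in \<open>simp_all add: P\<close>)
  then have "0 \<le> limacon_form \<sigma> s (D \<zeta>) \<zeta> 1 (of_real (1 / M) * P)" by (simp add: scaleR_conv_of_real)
  then have "0 \<le> M\<^sup>2 * limacon_form \<sigma> s (D \<zeta>) \<zeta> 1 (of_real (1 / M) * P)" by simp
  also have "\<dots> = limacon_form \<sigma> s (D \<zeta>) \<zeta> M P"
    unfolding limacon_form_scale[symmetric] using M by simp
  finally show "qcurve (2 * \<sigma>) (\<sigma>\<^sup>2) \<zeta> + of_real M * (of_real (2 * \<sigma>) * \<zeta> + 2 * of_real (\<sigma>\<^sup>2) * \<zeta>\<^sup>2) / P \<notin> qcurve (2 * s) (s\<^sup>2) ` unit_disc"
    by (rule limacon_form_exit[OF \<zeta> s D[OF \<zeta>] \<open>P \<noteq> 0\<close>])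
qed

lemma convex_affine_mem:
  fixes U V :: complex
  assumes "convex S" "of_real c * U + V \<in> S" "of_real d * U + V \<in> S" "c \<le> x" "x \<le> d"
  shows "of_real x * U + V \<in> S"
proof (cases "c = d")
  case False
  define t where "t = (x - c) / (d - c)"
  have t: "0 \<le> t" "t \<le> 1" using assms(4,5) False by (auto simp: t_def divide_simps)
  have "t * (d - c) = x - c" using False by (simp add: t_def)
  then have x: "x = (1 - t) * c + t * d" by (simp add: algebra_simps)
  have "(1 - t) *\<^sub>R (of_real c * U + V) + t *\<^sub>R (of_real d * U + V) \<in> S"
    by (rule convexD_alt[OF assms(1-3) t])
  also have "(1 - t) *\<^sub>R (of_real c * U + V) + t *\<^sub>R (of_real d * U + V) = of_real x * U + V"
    unfolding x by (simp add: scaleR_conv_of_real algebra_simps)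
  finally show ?thesis .
qed (use assms in auto)

lemma near_data_exists:
  assumes "1 / 128 \<le> e" "e \<le> 91 / 128"
  shows "\<exists>k2 k3 q l. near_data e k2 k3 q l"
proof -
  consider "e \<le> 20 / 128" | "20 / 128 \<le> e" "e \<le> 51 / 128" | "51 / 128 \<le> e" "e \<le> 70 / 128"
    | "70 / 128 \<le> e" "e \<le> 82 / 128" | "82 / 128 \<le> e" by linarith
  then show ?thesis
    by cases (use assms near_data_1 near_data_2 near_data_3 near_data_4 near_data_5 in simp_all)
qed

lemma qcurve_limacon_mono:
  assumes "0 \<le> \<sigma>" "\<sigma> \<le> \<tau>"
  shows "qcurve (2 * \<sigma>) (\<sigma>\<^sup>2) ` unit_disc \<subseteq> qcurve (2 * \<tau>) (\<tau>\<^sup>2) ` unit_disc"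
proof (cases "\<tau> = 0")
  case False
  show ?thesis
  proof (rule image_subsetI)
    fix v :: complex assume "v \<in> unit_disc"
    then have "norm v < 1" by simp
    have "norm (of_real (\<sigma> / \<tau>) * v) \<le> 1 * norm v"
      unfolding norm_mult norm_of_real using assms False by (intro mult_right_mono) (auto simp: divide_le_eq)
    then have "of_real (\<sigma> / \<tau>) * v \<in> unit_disc" using \<open>norm v < 1\<close> by simp
    moreover have "qcurve (2 * \<sigma>) (\<sigma>\<^sup>2) v = qcurve (2 * \<tau>) (\<tau>\<^sup>2) (of_real (\<sigma> / \<tau>) * v)"
      using False by (simp add: qcurve_def power2_eq_square)
    ultimately show "qcurve (2 * \<sigma>) (\<sigma>\<^sup>2) v \<in> qcurve (2 * \<tau>) (\<tau>\<^sup>2) ` unit_disc" by blast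
  qed
qed (use assms in auto)

text \<open>\<open>31 / 128\<close> is a rational number just below
  \<open>sqrt (cosh 1) - 1\<close>, and \<open>b\<close> is the value of
  \<open>\<eta> w + \<gamma>\<close> at the vertex of the corresponding limacon. On the curve this
  function equals \<open>b - \<eta> X\<close>, affine in \<open>(b, \<eta>)\<close>. The hypotheses
  confine \<open>(b, \<eta>)\<close> to a quadrilateral inside the convex hull of the origin and the
  points behind \<open>V1\<close>, \<open>V2\<close>, \<open>V3\<close>.\<close>

lemma briot_bouquet_near:
  fixes \<eta> \<gamma> s A :: real
  assumes hp: "p holomorphic_on unit_disc" and p0: "p 0 = 1" and ne: "\<gamma> \<noteq> - \<eta>"
    and hF: "(\<lambda>z. p z + z * deriv p z / (of_real \<eta> * p z + of_real \<gamma>)) holomorphic_on unit_disc"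
    and T: "\<And>z. z \<in> unit_disc \<Longrightarrow> p z + z * deriv p z / (of_real \<eta> * p z + of_real \<gamma>) \<in> qcurve (2 * s) (s\<^sup>2) ` unit_disc"
    and s: "0 < s" "s \<le> 1 / 2"
  defines "e \<equiv> (1 + s)\<^sup>2 - (1 + 31 / 128)\<^sup>2" and "b \<equiv> \<eta> * (1 + 31 / 128)\<^sup>2 + \<gamma>"
  assumes e: "1 / 128 \<le> e" and b: "0 \<le> b" "b * (27 / 16 * e) \<le> 1" "1 \<le> b * ((16512 * e + 1412) / 8192)"
    and \<eta>: "255 / 256 * b \<le> \<eta>" "\<eta> \<le> 99731 / 100000 * (b + A)" and A: "0 \<le> A" "A * (e + 10027 / 10000) \<le> 42074 / 100000"
  shows "p ` unit_disc \<subseteq> cosh_sqrt ` unit_disc"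
proof -
  define \<sigma> where "\<sigma> = (31 / 128 :: real)"
  define y1 where "y1 = 27 / 16 * e"
  define y3 where "y3 = (16512 * e + 1412) / 8192"
  define q where "q = s\<^sup>2 - \<sigma>\<^sup>2"
  have "(1 + s)\<^sup>2 \<le> (1 + 1 / 2)\<^sup>2" using s by (intro power_mono) auto
  then have e1: "e \<le> 91 / 128" by (simp add: e_def power2_eq_square)
  obtain k2 k3 q' l where nd: "near_data e k2 k3 q' l" using near_data_exists[OF e e1] by blast
  have y: "0 < y1" "0 < y3" using e by (simp_all add: y1_def y3_def)
  have "(1 + \<sigma>)\<^sup>2 < (1 + s)\<^sup>2" using e by (simp add: e_def \<sigma>_def)
  then have "1 + \<sigma> < 1 + s" by (rule power2_less_imp_less) (use s in simp)
  then have s\<sigma>: "\<sigma> \<le> s" by simp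
  have ql: "l \<le> q" "q \<le> q'" and lq: "0 \<le> l" "l \<le> 1" "q' \<le> e"
    using nd s\<sigma> unfolding near_data_def q_def \<sigma>_def e_def by auto
  have k2: "99731 / 100000 * (1 + y1 * A) \<le> k2" and k3: "99731 / 100000 * (1 + y3 * A) \<le> k3"
  proof -
    have *: "99731 / 100000 * (1 + y * A) \<le> k" if "99731 / 100000 * (e + 10027 / 10000 + y * (42074 / 100000)) \<le> k * (e + 10027 / 10000)" "0 < y" for y k
    proof -
      have "y * (A * (e + 10027 / 10000)) \<le> y * (42074 / 100000)" using A that by (intro mult_left_mono) auto
      then have "99731 / 100000 * (1 + y * A) * (e + 10027 / 10000) \<le> k * (e + 10027 / 10000)" using that(1) by (simp add: algebra_simps)
      then show ?thesis by (rule mult_right_le_imp_le) (use e in simp)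
    qed
    show "99731 / 100000 * (1 + y1 * A) \<le> k2" by (rule *[OF _ y(1)]) (use nd in \<open>auto simp: near_data_def y1_def\<close>)
    show "99731 / 100000 * (1 + y3 * A) \<le> k3" by (rule *[OF _ y(2)]) (use nd in \<open>auto simp: near_data_def y3_def\<close>)
  qed
  have "0 \<le> y1 * A" "0 \<le> y3 * A" using y A by simp_all
  then have kpos: "0 \<le> k2" "0 \<le> k3" using k2 k3 by argo+
  have "p ` unit_disc \<subseteq> qcurve (2 * \<sigma>) (\<sigma>\<^sup>2) ` unit_disc"
  proof (rule briot_bouquet_limacon[OF _ _ _ _ hp p0 ne hF T, where D = "\<lambda>\<zeta>. e * (1 + 13 / 32 * (1 - Re \<zeta>))"])
    fix \<zeta> :: complex assume \<zeta>: "norm \<zeta> = 1"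
    define D where "D = e * (1 + 13 / 32 * (1 - Re \<zeta>))"
    have x: "-1 \<le> Re \<zeta>" "Re \<zeta> \<le> 1" using abs_Re_le_cmod[of \<zeta>] \<zeta> by auto
    have D: "e \<le> D" using e x by (simp add: D_def distrib_left)
    have m: "0 < 1 + 2 * \<sigma> * Re \<zeta> + \<sigma>\<^sup>2" using x by (simp add: \<sigma>_def power2_eq_square)
    show "0 < 1 + 2 * \<sigma> * Re \<zeta> + \<sigma>\<^sup>2 + e * (1 + 13 / 32 * (1 - Re \<zeta>))" using m D e unfolding D_def by linarith
    have q0: "0 \<le> q" "q \<le> 1" using ql lq e1 by linarith+
    have r: "0 \<le> 4 * (1 + \<sigma> * Re \<zeta>) - q" using x q0 by (simp add: \<sigma>_def)
    have mD: "0 \<le> 1 + 2 * \<sigma> * Re \<zeta> + \<sigma>\<^sup>2 + D" using m D e by linarith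
    show coef: "0 \<le> (1 + 2 * \<sigma> * Re \<zeta> + \<sigma>\<^sup>2 + e * (1 + 13 / 32 * (1 - Re \<zeta>))) * (s\<^sup>2 - \<sigma>\<^sup>2) * (4 * (1 + \<sigma> * Re \<zeta>) - (s\<^sup>2 - \<sigma>\<^sup>2)) + s\<^sup>2 * (e * (1 + 13 / 32 * (1 - Re \<zeta>)))\<^sup>2"
      unfolding q_def[symmetric] D_def[symmetric] by (rule add_nonneg_nonneg[OF mult_nonneg_nonneg[OF mult_nonneg_nonneg[OF mD q0(1)] r]]) simp
    show f0: "0 \<le> limacon_form \<sigma> s (e * (1 + 13 / 32 * (1 - Re \<zeta>))) \<zeta> 1 0"
    proof -
      have "0 \<le> 2 * (1 + \<sigma> * Re \<zeta>) - 1 + D - q" using x D ql lq by (simp add: \<sigma>_def)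
      then show ?thesis using m unfolding D_def[symmetric] by (simp add: limacon_form_def Let_def q_def)
    qed
    define S where "S = {P. 0 \<le> limacon_form \<sigma> s D \<zeta> 1 P}"
    have cS: "convex S" unfolding S_def by (rule convex_limacon_form[OF coef[folded D_def]])
    have S0: "0 \<in> S" using f0 by (simp add: S_def D_def)
    define X where "X = of_real ((1 + \<sigma>)\<^sup>2) - (1 + of_real \<sigma> * \<zeta>)\<^sup>2"
    have vertex: "of_real (1 / t) * (1 - of_real k * X) \<in> S"
      if "list_all (\<lambda>c. 0 \<le> c) (near_coeffs (\<lambda>c. c) (8192 * t) (65536 * k) (128 * e) (1048576 * q') (8192 * l))" "0 < t" "0 \<le> k" for t k
    proof -
      have "0 \<le> limacon_form \<sigma> s D \<zeta> t (1 - of_real k * X)"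
        unfolding D_def X_def \<sigma>_def
        by (rule limacon_form_vertex[OF \<zeta> that(1) less_imp_le[OF that(2)] that(3) _ lq(3,1) _ _ lq(2)])
          (use e ql in \<open>simp_all add: q_def \<sigma>_def\<close>)
      then have "0 \<le> limacon_form \<sigma> s D \<zeta> (1 / t * t) (of_real (1 / t) * (1 - of_real k * X))"
        unfolding limacon_form_scale by simp
      then show ?thesis using that(2) by (simp add: S_def)
    qed
    have V1: "of_real (1 / y1) * (1 - of_real (255 / 256) * X) + 0 \<in> S"
      unfolding add_0_right by (rule vertex) (use nd y in \<open>auto simp: near_data_def y1_def\<close>)
    have V2: "of_real (k2 / y1) * (- X) + of_real (1 / y1) \<in> S"
    proof -
      have "of_real (1 / y1) * (1 - of_real k2 * X) \<in> S"
        by (rule vertex) (use nd y kpos in \<open>auto simp: near_data_def y1_def\<close>)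
      then show ?thesis by (simp add: algebra_simps)
    qed
    have V3: "of_real (k3 / y3) * (- X) + of_real (1 / y3) \<in> S"
    proof -
      have "of_real (1 / y3) * (1 - of_real k3 * X) \<in> S"
        by (rule vertex) (use nd y kpos in \<open>auto simp: near_data_def y3_def\<close>)
      then show ?thesis by (simp add: algebra_simps)
    qed
    have by1: "b \<le> 1 / y1" using b(2)[folded y1_def] y by (simp add: pos_le_divide_eq)
    have by3: "1 / y3 \<le> b" using b(3)[folded y3_def] y by (simp add: pos_divide_le_eq)
    have eq: "of_real (r * (c + A)) * (- X) + of_real c = of_real c * (1 - of_real r * X) + of_real (- r * A) * X" for r c :: real
      by (simp add: algebra_simps)
    \<comment> \<open>The lower edge \<open>\<eta> = 255 / 256 b\<close> runs from the origin to
      \<open>V1\<close>.\<close>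
    have low: "of_real (255 / 256 * c) * (- X) + of_real c \<in> S" if "0 \<le> c" "c \<le> 1 / y1" for c
    proof -
      have "of_real c * (1 - of_real (255 / 256) * X) + 0 \<in> S"
        by (rule convex_affine_mem[OF cS _ V1 that]) (use S0 in simp)
      then show ?thesis by (simp add: algebra_simps)
    qed
    \<comment> \<open>Points of the upper edge \<open>\<eta> = 99731 / 100000 (b + A)\<close> at its
      two ends: each lies between the lower edge and \<open>V2\<close> or \<open>V3\<close>, because
      \<open>k2\<close> and \<open>k3\<close> are over-estimates.\<close>
    have up: "of_real c * (1 - of_real (99731 / 100000) * X) + of_real (- (99731 / 100000) * A) * X \<in> S"
      if V: "of_real (k / y) * (- X) + of_real (1 / y) \<in> S" and k: "99731 / 100000 * (1 + y * A) \<le> k" and "0 < y" and c: "c = 1 / y" "c \<le> 1 / y1" for k y c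
    proof -
      have "of_real (99731 / 100000 * (c + A)) * (- X) + of_real c \<in> S"
      proof (rule convex_affine_mem[OF cS low])
        show "0 \<le> c" using c \<open>0 < y\<close> by simp
        show "of_real (k / y) * (- X) + of_real c \<in> S" using V c(1) by simp
        show "255 / 256 * c \<le> 99731 / 100000 * (c + A)" using \<open>0 \<le> c\<close> A by simp
        have "99731 / 100000 * (c + A) = 99731 / 100000 * (1 + y * A) / y" using \<open>0 < y\<close> c(1) by (simp add: field_simps)
        also have "\<dots> \<le> k / y" using k \<open>0 < y\<close> by (intro divide_right_mono) auto
        finally show "99731 / 100000 * (c + A) \<le> k / y" .
      qed (rule c(2))
      then show ?thesis unfolding eq .
    qed
    have "of_real b * (1 - of_real (99731 / 100000) * X) + of_real (- (99731 / 100000) * A) * X \<in> S"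
      by (rule convex_affine_mem[OF cS up[OF V3 k3 y(2) refl order_trans[OF by3 by1]] up[OF V2 k2 y(1) refl order_refl] by3 by1])
    then have "of_real (99731 / 100000 * (b + A)) * (- X) + of_real b \<in> S" unfolding eq .
    from convex_affine_mem[OF cS low[OF b(1) by1] this \<eta>]
    have "of_real \<eta> * (- X) + of_real b \<in> S" .
    also have "of_real \<eta> * (- X) + of_real b = of_real \<eta> * qcurve (2 * \<sigma>) (\<sigma>\<^sup>2) \<zeta> + of_real \<gamma>"
      by (simp add: X_def b_def \<sigma>_def qcurve_def power2_eq_square algebra_simps)
    finally show "0 \<le> limacon_form \<sigma> s (e * (1 + 13 / 32 * (1 - Re \<zeta>))) \<zeta> 1 (of_real \<eta> * qcurve (2 * \<sigma>) (\<sigma>\<^sup>2) \<zeta> + of_real \<gamma>)"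
      by (simp add: S_def D_def)
  qed (use s in \<open>auto simp: \<sigma>_def\<close>)
  also have "\<dots> \<subseteq> qcurve (2 * (sqrt (cosh 1) - 1)) ((sqrt (cosh 1) - 1)\<^sup>2) ` unit_disc"
    by (rule qcurve_limacon_mono) (use cosh_root_bounds(2) in \<open>simp_all add: \<sigma>_def\<close>)
  also have "\<dots> \<subseteq> cosh_sqrt ` unit_disc" by (rule limacon_subset_cosh_sqrt)
  finally show ?thesis .
qed

text \<open>\<open>2 - cosh 1\<close> is the radius of the largest disc about 1 inside the disc with
  diameter \<open>[cosh 1 - 1, cosh 1]\<close>; they touch at \<open>cosh 1 - 1\<close>. As
  \<open>cos 1 < cosh 1 - 1\<close> and \<open>\<eta> \<ge> 0\<close>, the condition at
  \<open>cos 1\<close> carries over to that point.\<close>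

lemma briot_bouquet_disc_cosh:
  fixes \<eta> \<gamma> E :: real
  assumes hp: "p holomorphic_on unit_disc" and p0: "p 0 = 1" and ne: "\<gamma> \<noteq> - \<eta>"
    and hF: "(\<lambda>z. p z + z * deriv p z / (of_real \<eta> * p z + of_real \<gamma>)) holomorphic_on unit_disc"
    and T: "\<And>z. z \<in> unit_disc \<Longrightarrow> p z + z * deriv p z / (of_real \<eta> * p z + of_real \<gamma>) \<in> ball 1 E"
    and E: "0 < E" and \<eta>: "0 \<le> \<eta>"
    and a: "- (\<eta> * cos 1 + \<gamma>) \<le> sin 1 / (2 * (E + (1 - cos 1)))"
    and hi: "(E - (2 - cosh 1)) * (\<eta> * (3 - cosh 1) + \<gamma>) \<le> 2 - cosh 1"
  shows "p ` unit_disc \<subseteq> cosh_sqrt ` unit_disc"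
proof -
  define r where "r = 2 - cosh (1::real)"
  note num = cosh_1_bounds cos_1_bounds sin_1_bounds
  have r: "456919 / 1000000 < r" "r < 45692 / 100000" using num by (auto simp: r_def)
  have "p ` unit_disc \<subseteq> qcurve r 0 ` unit_disc"
  proof (rule briot_bouquet_disc[OF hp p0 ne hF T _ E \<eta>])
    have "sin 1 * (E + r) \<le> r * (2 * (E + (1 - cos 1)))"
    proof -
      have "sin 1 * (E + r) \<le> (2 * r) * (E + (1 - cos 1))" using num r E by (intro mult_mono) auto
      then show ?thesis by (simp only: mult.assoc mult.left_commute[of r 2])
    qed
    then have "sin 1 / (2 * (E + (1 - cos 1))) \<le> r / (E + r)"
      using E r num by (simp add: divide_le_eq le_divide_eq)
    moreover have "\<eta> * cos 1 \<le> \<eta> * (1 - r)" using \<eta> num r by (intro mult_left_mono) auto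
    ultimately show "- (r / (E + r)) \<le> \<eta> * (1 - r) + \<gamma>" using a by linarith
    show "(E - r) * (\<eta> * (1 + r) + \<gamma>) \<le> r" using hi by (simp add: r_def)
  qed (use r in auto)
  also have "\<dots> \<subseteq> cosh_sqrt ` unit_disc"
  proof (rule disc_subset_cosh_sqrt)
    show "connected (qcurve r 0 ` unit_disc)"
      unfolding qcurve_def by (intro connected_continuous_image continuous_intros connected_ball)
    show "1 \<in> qcurve r 0 ` unit_disc" by (rule image_eqI[of _ _ 0]) (auto simp: qcurve_def)
    fix y assume "y \<in> qcurve r 0 ` unit_disc"
    then obtain v where v: "norm v < 1" and y: "y = 1 + of_real r * v" by (auto simp: qcurve_def)
    have C: "of_real (cosh 1) - y = of_real (1 - r) - of_real r * v" by (simp add: y r_def)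
    have "(norm (of_real (1 - r) - of_real r * v))\<^sup>2 - Re (of_real (1 - r) - of_real r * v)
        = - (r\<^sup>2 * (1 - (norm v)\<^sup>2)) - r * ((1 - 2 * r) * (1 + Re v))"
      unfolding cmod_power2 by (simp add: power2_eq_square algebra_simps)
    also have "\<dots> < 0"
    proof -
      have "(norm v)\<^sup>2 < 1" using v by (simp add: power_less_one_iff)
      then have "0 < r\<^sup>2 * (1 - (norm v)\<^sup>2)" using r by simp
      moreover have "0 \<le> 1 + Re v" using abs_Re_le_cmod[of v] v by linarith
      then have "0 \<le> r * ((1 - 2 * r) * (1 + Re v))" using r by simp
      ultimately show ?thesis by linarith
    qed
    finally show "(norm (of_real (cosh 1) - y))\<^sup>2 < Re (of_real (cosh 1) - y)" unfolding C by simp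
  qed
  finally show ?thesis .
qed

section \<open>Discs containing the images of the three target functions\<close>

text \<open>From \<open>f^2 - 1 = 2 f z\<close> follows \<open>|f^2 - 1| < 2 |f|\<close>, which is
  \<open>(|f|^2 - 1)^2 < (2 Re f)^2\<close>. Since \<open>f + 1 / f = 2 c\<close> with
  \<open>Re c > 0\<close>, also \<open>Re f > 0\<close>, and the root of the inequality is
  \<open>|f - 1|^2 < 2\<close>.\<close>

lemma phi_lune_ball:
  assumes "norm z < 1"
  shows "phi_lune z \<in> ball 1 (sqrt 2)"
proof -
  define c where "c = csqrt (1 + z\<^sup>2)"
  define f where "f = z + c"
  have c2: "c\<^sup>2 = 1 + z\<^sup>2" by (simp add: c_def)
  have "norm (z\<^sup>2) < 1" using assms by (simp add: norm_power power_less_one_iff)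
  then have "Re (c\<^sup>2) > 0" using abs_Re_le_cmod[of "z\<^sup>2"] unfolding c2 by simp
  then have "(Im c)\<^sup>2 < (Re c)\<^sup>2" by (simp add: power2_eq_square)
  then have "(Re c)\<^sup>2 > 0" using zero_le_power2[of "Im c"] by linarith
  moreover have "0 \<le> Re c" unfolding c_def by (rule Re_csqrt)
  ultimately have rc: "Re c > 0" by (cases "Re c = 0") auto
  have fc: "f * (c - z) = 1" using c2 by (simp add: f_def power2_eq_square algebra_simps)
  then have f0: "f \<noteq> 0" by auto
  have "c - z = inverse f" using fc f0 by (simp add: field_simps)
  then have "f + inverse f = f + (c - z)" by (simp only:)
  also have "\<dots> = 2 * c" by (simp add: f_def)
  finally have "Re (f + inverse f) = Re (2 * c)" by (simp only:)
  then have "Re f + Re f / (norm f)\<^sup>2 = 2 * Re c" unfolding cmod_power2 by simp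
  then have "Re f * (1 + 1 / (norm f)\<^sup>2) > 0" using rc by (simp add: algebra_simps)
  moreover have "0 < 1 + 1 / (norm f)\<^sup>2" by (simp add: add_pos_nonneg)
  ultimately have rf: "Re f > 0" by (simp add: zero_less_mult_iff)
  have "f\<^sup>2 - 1 = 2 * f * z" using c2 by (simp add: f_def power2_eq_square algebra_simps)
  then have "norm (f\<^sup>2 - 1) = 2 * norm f * norm z" by (simp add: norm_mult)
  also have "\<dots> < 2 * norm f" using assms f0 by simp
  finally have "(norm (f\<^sup>2 - 1))\<^sup>2 < (2 * norm f)\<^sup>2" by (intro power_strict_mono) auto
  moreover have "(norm (f\<^sup>2 - 1))\<^sup>2 = ((norm f)\<^sup>2 + 1)\<^sup>2 - (2 * Re f)\<^sup>2"
    unfolding cmod_power2 by (simp add: power2_eq_square algebra_simps)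
  ultimately have "((norm f)\<^sup>2 - 1)\<^sup>2 < (2 * Re f)\<^sup>2" by (simp add: power2_eq_square algebra_simps)
  then have "(norm f)\<^sup>2 - 1 < 2 * Re f" by (rule power2_less_imp_less) (use rf in simp)
  then have "(norm (1 - f))\<^sup>2 < 2" unfolding cmod_power2 by (simp add: power2_eq_square algebra_simps)
  then have "norm (1 - f) < sqrt 2" by (simp add: real_less_rsqrt)
  then show ?thesis by (simp add: dist_norm phi_lune_def f_def c_def)
qed

lemma exp_ball:
  fixes z :: complex
  assumes "norm z < 1"
  shows "exp z \<in> ball 1 (exp 1 - 1)"
proof -
  have s: "summable (\<lambda>n. inverse (fact (Suc n)) * norm z ^ Suc n)"
    using summable_exp_generic[of "norm z"] by (subst summable_Suc_iff[of "\<lambda>n. inverse (fact n) * norm z ^ n"]) simp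
  have "norm (exp z - 1) = norm (\<Sum>n. inverse (fact (Suc n)) *\<^sub>R z ^ Suc n)"
    using exp_first_term[of z] by simp
  also have "\<dots> \<le> (\<Sum>n. inverse (fact (Suc n)) * norm z ^ Suc n)"
  proof -
    have n: "norm (inverse (fact (Suc n)) *\<^sub>R z ^ Suc n) = inverse (fact (Suc n)) * norm z ^ Suc n" for n
      by (simp add: norm_power norm_mult)
    have "summable (\<lambda>n. norm (inverse (fact (Suc n)) *\<^sub>R z ^ Suc n))" unfolding n by (rule s)
    from summable_norm[OF this] show ?thesis unfolding n .
  qed
  also have "\<dots> = exp (norm z) - 1" using exp_first_term[of "norm z"] by simp
  also have "\<dots> < exp 1 - 1" using assms by simp
  finally show ?thesis by (simp add: dist_norm norm_minus_commute)
qed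

lemma qcurve_limacon_ball:
  assumes "0 < s" "norm z < 1"
  shows "qcurve (2 * s) (s\<^sup>2) z \<in> ball 1 ((1 + s)\<^sup>2 - 1)"
proof -
  have "norm (qcurve (2 * s) (s\<^sup>2) z - 1) \<le> 2 * s * norm z + s\<^sup>2 * (norm z)\<^sup>2"
    unfolding qcurve_def using assms norm_triangle_ineq[of "of_real (2 * s) * z" "of_real (s\<^sup>2) * z\<^sup>2"]
    by (simp add: norm_mult norm_power add.assoc)
  also have "\<dots> < 2 * s * 1 + s\<^sup>2 * 1"
    using assms by (intro add_strict_mono mult_strict_left_mono) (auto simp: power_less_one_iff)
  finally show ?thesis by (simp add: dist_norm norm_minus_commute power2_eq_square algebra_simps)
qed

section \<open>Limacon targets ending just beyond \<open>cosh 1\<close>\<close>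

text \<open>Here \<open>D = 0\<close> suffices; the numbers bound \<open>y = 1 / b\<close>, \<open>q\<close> and \<open>q / y\<close>.\<close>

lemma limacon_form_close:
  fixes \<zeta> :: complex and \<sigma> s b \<eta> :: real
  assumes \<zeta>: "norm \<zeta> = 1" and \<sigma>: "242207 / 1000000 < \<sigma>" "\<sigma> < 242209 / 1000000"
  defines "q \<equiv> s\<^sup>2 - \<sigma>\<^sup>2"
  assumes q: "0 \<le> q" "q \<le> 155 / 100000" and b: "0 < b" "q * b \<le> 1152 / 10000" "1 \<le> b * (2063 / 10000)"
    and \<eta>: "0 \<le> \<eta>" "\<eta> \<le> 9973 / 10000 * b + 42 / 100"
  shows "0 \<le> limacon_form \<sigma> s 0 \<zeta> 1 (of_real b - of_real \<eta> * (of_real ((1 + \<sigma>)\<^sup>2) - (1 + of_real \<sigma> * \<zeta>)\<^sup>2))"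
proof -
  define \<xi> where "\<xi> = 1 - Re \<zeta>"
  have \<xi>: "0 \<le> \<xi>" "\<xi> \<le> 2" using abs_Re_le_cmod[of \<zeta>] \<zeta> by (auto simp: \<xi>_def)
  define y where "y = 1 / b"
  define \<kappa> where "\<kappa> = \<eta> * y"
  define X where "X = of_real ((1 + \<sigma>)\<^sup>2) - (1 + of_real \<sigma> * \<zeta>)\<^sup>2"
  define p where "p = 1 - of_real \<kappa> * X"
  define m where "m = 1 + 2 * \<sigma> * Re \<zeta> + \<sigma>\<^sup>2"
  define \<rho> where "\<rho> = 1 + \<sigma> * Re \<zeta>"
  define W where "W = Re X"
  define N where "N = (norm p)\<^sup>2"
  define R where "R = Re ((\<zeta> + of_real \<sigma>) * cnj p)"
  have y: "0 < y" "y \<le> 2063 / 10000" "y * b = 1" using b by (auto simp: y_def divide_le_eq mult.commute)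
  have \<kappa>: "0 \<le> \<kappa>" "\<kappa> \<le> 9973 / 10000 + 42 / 100 * y"
    using \<eta> y mult_right_mono[OF \<eta>(2), of y] by (auto simp: \<kappa>_def algebra_simps)
  have s1: "2 * \<sigma>\<^sup>2 \<ge> 117328 / 1000000" "2 * \<sigma>\<^sup>2 \<le> 117331 / 1000000"
    using power_mono[of "242207 / 1000000" \<sigma> 2] power_mono[of \<sigma> "242209 / 1000000" 2] \<sigma> by (simp_all add: power2_eq_square)
  note gap = limacon_gap[OF \<zeta>, of \<sigma>, folded X_def, folded \<xi>_def]
  have W: "\<xi> * (71906 / 100000 - 11734 / 100000 * \<xi>) \<le> W"
  proof -
    have W': "W = \<xi> * (2 * \<sigma> + 2 * (2 * \<sigma>\<^sup>2) - 2 * \<sigma>\<^sup>2 * \<xi>)" unfolding W_def gap(1) by (simp add: power2_eq_square algebra_simps)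
    have "2 * \<sigma>\<^sup>2 * \<xi> \<le> 117331 / 1000000 * \<xi>" using s1 \<xi> by (intro mult_right_mono) auto
    then show ?thesis unfolding W' using \<xi> s1 \<sigma> by (intro mult_left_mono) auto
  qed
  have X2: "(norm X)\<^sup>2 \<le> \<xi> * (7243 / 10000 - 1274 / 10000 * \<xi>)"
  proof -
    have X': "(norm X)\<^sup>2 = \<xi> * ((4 * \<sigma>\<^sup>2) * (2 * (1 + \<sigma>)\<^sup>2 - ((1 + \<sigma>)\<^sup>2 - 1) * \<xi>))" unfolding gap(2) by simp
    define c where "c = (1 + \<sigma>)\<^sup>2"
    have c: "1543078 / 1000000 \<le> c" "c \<le> 1543084 / 1000000"
      using s1 \<sigma> unfolding c_def by (simp_all add: power2_sum)
    have c2: "2 * c - (c - 1) * \<xi> \<le> 1543084 / 500000 - 543084 / 1000000 * \<xi>"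
    proof -
      have "c * (2 - \<xi>) \<le> 1543084 / 1000000 * (2 - \<xi>)" using c \<xi> by (intro mult_right_mono) auto
      then show ?thesis by (simp add: algebra_simps)
    qed
    have "(4 * \<sigma>\<^sup>2) * (2 * c - (c - 1) * \<xi>) \<le> (234662 / 1000000) * (1543084 / 500000 - 543084 / 1000000 * \<xi>)"
    proof (rule mult_mono)
      have "(c - 1) * \<xi> \<le> (c - 1) * 2" using c \<xi> by (intro mult_left_mono) auto
      then show "0 \<le> 2 * c - (c - 1) * \<xi>" by (simp add: algebra_simps)
    qed (use s1 c2 in auto)
    also have "\<dots> \<le> 7243 / 10000 - 1274 / 10000 * \<xi>" using \<xi> by simp
    finally show ?thesis unfolding X' c_def[symmetric] using \<xi> by (intro mult_left_mono) auto
  qed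
  have N: "N = 1 - 2 * \<kappa> * W + \<kappa>\<^sup>2 * (norm X)\<^sup>2"
    unfolding N_def p_def W_def cmod_power2 by (simp add: power2_eq_square algebra_simps)
  have Rp: "Re p = 1 - \<kappa> * W" by (simp add: p_def W_def)
  \<comment> \<open>The last bound estimates \<open>1 / \<rho>\<close> by an affine function of
    \<open>\<xi>\<close>; with it \<open>\<rho> - 1 / 2\<close> is bounded below by a multiple of
    \<open>\<rho>\<close>.\<close>
  have \<rho>: "757 / 1000 \<le> \<rho>" "\<rho> = 1 + \<sigma> - \<sigma> * \<xi>" "1 \<le> \<rho> * (8051 / 10000 + 2573 / 10000 * \<xi>)"
  proof -
    show r: "\<rho> = 1 + \<sigma> - \<sigma> * \<xi>" by (simp add: \<rho>_def \<xi>_def algebra_simps)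
    have "\<sigma> * (\<xi> - 1) \<le> \<sigma> * 1" using \<xi> \<sigma> by (intro mult_left_mono) auto
    moreover have sx: "\<sigma> * \<xi> \<le> 242209 / 1000000 * \<xi>" using \<xi> \<sigma> by (intro mult_right_mono) auto
    ultimately show "757 / 1000 \<le> \<rho>" unfolding r using \<sigma> by (simp add: algebra_simps)
    have "1242207 / 1000000 - 242209 / 1000000 * \<xi> \<le> \<rho>" unfolding r using sx \<sigma> by linarith
    then have "(1242207 / 1000000 - 242209 / 1000000 * \<xi>) * (8051 / 10000 + 2573 / 10000 * \<xi>) \<le> \<rho> * (8051 / 10000 + 2573 / 10000 * \<xi>)"
      using \<xi> by (intro mult_right_mono) auto
    moreover have "0 \<le> \<xi> * (2 - \<xi>)" using \<xi> by simp
    ultimately show "1 \<le> \<rho> * (8051 / 10000 + 2573 / 10000 * \<xi>)" using \<xi> by (simp add: algebra_simps)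
  qed
  define wl where "wl = 113069 / 1000000 * (71906 / 100000 - 11734 / 100000 * \<xi>)"
  define xu where "xu = 1152 / 10000 * (7243 / 10000 - 1274 / 10000 * \<xi>)"
  have xu: "0 \<le> xu" using \<xi> by (simp add: xu_def)
  \<comment> \<open>Essentially the form divided by \<open>4 m b \<rho>\<close>, without the small
    terms that contain a separate factor \<open>q\<close>. The slack \<open>70 / 100000\<close> pays
    for those in \<open>J\<close>.\<close>
  have main: "70 / 100000 \<le> 2 * \<sigma>\<^sup>2 * Re p - 1152 / 10000 * N + 2 * \<sigma>\<^sup>2 * y * (11949 / 20000 - 2573 / 20000 * \<xi>)"
  proof -
    define km where "km = 9973 / 10000 + 42 / 100 * y"
    have km: "\<kappa> \<le> km" "0 \<le> km" using \<kappa> by (auto simp: km_def)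
    have "113069 / 1000000 * (\<xi> * (71906 / 100000 - 11734 / 100000 * \<xi>)) \<le> (2304 / 10000 - 2 * \<sigma>\<^sup>2) * W"
      using s1 W \<xi> by (intro mult_mono) auto
    then have 1: "\<kappa> * (\<xi> * wl) \<le> \<kappa> * ((2304 / 10000 - 2 * \<sigma>\<^sup>2) * W)"
      using \<kappa> by (intro mult_left_mono) (auto simp: wl_def mult_ac)
    have 2: "\<kappa>\<^sup>2 * (1152 / 10000 * (norm X)\<^sup>2) \<le> \<kappa>\<^sup>2 * (\<xi> * xu)"
    proof (rule mult_left_mono)
      have "\<xi> * xu = 1152 / 10000 * (\<xi> * (7243 / 10000 - 1274 / 10000 * \<xi>))" by (simp add: xu_def)
      then show "1152 / 10000 * (norm X)\<^sup>2 \<le> \<xi> * xu" using X2 by linarith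
    qed simp
    \<comment> \<open>\<open>\<kappa> (wl - \<kappa> xu)\<close> is concave in
      \<open>\<kappa>\<close>, hence at least the smaller of its values at \<open>0\<close> and
      \<open>km\<close>.\<close>
    have 3: "min 0 (km * (wl - km * xu)) \<le> \<kappa> * (wl - \<kappa> * xu)"
    proof (cases "0 \<le> wl - \<kappa> * xu")
      case True
      then have "0 \<le> \<kappa> * (wl - \<kappa> * xu)" using \<kappa> by simp
      then show ?thesis by simp
    next
      case False
      have "\<kappa> * xu \<le> km * xu" using km xu by (intro mult_right_mono) auto
      then have "km * (wl - km * xu) \<le> km * (wl - \<kappa> * xu)" using km by (intro mult_left_mono) auto
      also have "\<dots> \<le> \<kappa> * (wl - \<kappa> * xu)" using km False by (intro mult_right_mono_neg) auto
      finally show ?thesis by simp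
    qed
    define e1 where "e1 = \<xi> * (42 / 100 * wl - (837732 / 1000000 + 1764 / 10000 * (2063 / 10000)) * xu) + 117328 / 1000000 * (11949 / 20000 - 2573 / 20000 * \<xi>)"
    define e0 where "e0 = 2128 / 1000000 - 70 / 100000 + \<xi> * (9973 / 10000 * wl - 99460729 / 100000000 * xu)"
    have e0: "0 \<le> e0"
      using zero_le_power2[of "\<xi> - 69 / 100"] \<xi> unfolding e0_def wl_def xu_def by (simp add: power2_eq_square algebra_simps)
    have e1: "0 \<le> e0 + 2063 / 10000 * e1"
      using zero_le_power2[of "\<xi> - 2"] \<xi> unfolding e0_def e1_def wl_def xu_def by (simp add: power2_eq_square algebra_simps)
    \<comment> \<open>The claim is affine in \<open>y\<close>, so the end points \<open>0\<close>
      and \<open>2063 / 10000\<close> of its range suffice.\<close>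
    have "0 \<le> (1 - y * (10000 / 2063)) * e0 + y * (10000 / 2063) * (e0 + 2063 / 10000 * e1)"
      by (rule add_nonneg_nonneg[OF mult_nonneg_nonneg[OF _ e0] mult_nonneg_nonneg[OF _ e1]])
        (use y in simp_all)
    then have 4: "0 \<le> e0 + y * e1" by (simp add: algebra_simps)
    have "y * y \<le> 2063 / 10000 * y" using y by (intro mult_right_mono) auto
    then have "\<xi> * xu * (1764 / 10000 * (y * y)) \<le> \<xi> * xu * (1764 / 10000 * (2063 / 10000 * y))"
      using \<xi> xu by (intro mult_left_mono) auto
    then have 5: "0 \<le> 2128 / 1000000 - 70 / 100000 + \<xi> * (km * (wl - km * xu)) + 117328 / 1000000 * (y * (11949 / 20000 - 2573 / 20000 * \<xi>))"
      using 4 unfolding e0_def e1_def km_def by (simp add: algebra_simps)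
    have 6: "117328 / 1000000 * (y * (11949 / 20000 - 2573 / 20000 * \<xi>)) \<le> 2 * \<sigma>\<^sup>2 * (y * (11949 / 20000 - 2573 / 20000 * \<xi>))"
      using s1 y \<xi> by (intro mult_right_mono) auto
    have 7: "0 \<le> 117328 / 1000000 * (y * (11949 / 20000 - 2573 / 20000 * \<xi>))" using y \<xi> by simp
    have "\<xi> * min 0 (km * (wl - km * xu)) \<le> \<xi> * (\<kappa> * (wl - \<kappa> * xu))" using 3 \<xi> by (intro mult_left_mono) auto
    then have 8: "0 \<le> 2128 / 1000000 - 70 / 100000 + \<xi> * (\<kappa> * (wl - \<kappa> * xu)) + 117328 / 1000000 * (y * (11949 / 20000 - 2573 / 20000 * \<xi>))"
      using 5 7 by (cases "0 \<le> km * (wl - km * xu)") (auto simp: min_def split: if_splits)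
    have "2 * \<sigma>\<^sup>2 * Re p - 1152 / 10000 * N = (2 * \<sigma>\<^sup>2 - 1152 / 10000) + \<kappa> * ((2304 / 10000 - 2 * \<sigma>\<^sup>2) * W) - \<kappa>\<^sup>2 * (1152 / 10000 * (norm X)\<^sup>2)"
      unfolding Rp N by (simp add: algebra_simps)
    moreover have "\<xi> * (\<kappa> * (wl - \<kappa> * xu)) = \<kappa> * (\<xi> * wl) - \<kappa>\<^sup>2 * (\<xi> * xu)" by (simp add: power2_eq_square algebra_simps)
    moreover have "2 * \<sigma>\<^sup>2 * y * (11949 / 20000 - 2573 / 20000 * \<xi>) = 2 * \<sigma>\<^sup>2 * (y * (11949 / 20000 - 2573 / 20000 * \<xi>))" by simp
    ultimately show ?thesis using 1 2 6 8 s1 by linarith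
  qed
  have N0: "0 \<le> N" by (simp add: N_def)
  have m: "m = (norm (\<zeta> + of_real \<sigma>))\<^sup>2" "0 \<le> m" "m \<le> 15431 / 10000"
  proof -
    have "(Re \<zeta>)\<^sup>2 + (Im \<zeta>)\<^sup>2 = 1" using \<zeta> by (simp add: cmod_def)
    then show "m = (norm (\<zeta> + of_real \<sigma>))\<^sup>2" unfolding m_def cmod_power2 by simp algebra
    then show "0 \<le> m" by simp
    have "\<sigma> * Re \<zeta> \<le> \<sigma> * 1" using \<xi> \<sigma> by (intro mult_left_mono) (auto simp: \<xi>_def)
    then show "m \<le> 15431 / 10000" unfolding m_def using s1 \<sigma> by linarith
  qed
  have N1: "N \<le> 1"
  proof -
    have "\<kappa> * (\<xi> * (7243 / 10000 - 1274 / 10000 * \<xi>)) \<le> (1084 / 1000) * (\<xi> * (7243 / 10000 - 1274 / 10000 * \<xi>))"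
      using \<kappa> y \<xi> by (intro mult_right_mono) auto
    moreover have "\<xi> * ((1084 / 1000) * (7243 / 10000 - 1274 / 10000 * \<xi>)) \<le> \<xi> * (2 * (71906 / 100000 - 11734 / 100000 * \<xi>))"
      using \<xi> by (intro mult_left_mono) auto
    moreover have "\<kappa> * (norm X)\<^sup>2 \<le> \<kappa> * (\<xi> * (7243 / 10000 - 1274 / 10000 * \<xi>))" using X2 \<kappa> by (intro mult_left_mono) auto
    ultimately have "\<kappa> * (norm X)\<^sup>2 \<le> 2 * W" using W by argo
    then have "\<kappa> * (\<kappa> * (norm X)\<^sup>2) \<le> \<kappa> * (2 * W)" using \<kappa> by (intro mult_left_mono) auto
    then show ?thesis unfolding N by (simp add: power2_eq_square)
  qed
  have R: "R \<le> 1272 / 1000"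
  proof -
    have "0 \<le> (norm (\<zeta> + of_real \<sigma> - p))\<^sup>2" by simp
    also have "\<dots> = m + N - 2 * R" unfolding m(1) N_def R_def cmod_power2 by (simp add: power2_eq_square algebra_simps)
    finally show ?thesis using m N1 by simp
  qed
  have J: "0 \<le> 2 * \<sigma>\<^sup>2 * \<rho> * Re p - q * b * (\<rho> - q / 4) * N + \<sigma>\<^sup>2 * (2 * \<rho> - 1 - q) * y - \<sigma> * q * R"
  proof -
    have "\<rho> * (70 / 100000) \<le> \<rho> * (2 * \<sigma>\<^sup>2 * Re p - 1152 / 10000 * N + 2 * \<sigma>\<^sup>2 * y * (11949 / 20000 - 2573 / 20000 * \<xi>))"
      using main \<rho> by (intro mult_left_mono) auto
    moreover have "2 * \<sigma>\<^sup>2 * y * (\<rho> * (11949 / 20000 - 2573 / 20000 * \<xi>)) \<le> 2 * \<sigma>\<^sup>2 * y * (\<rho> - 1 / 2)"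
      using \<rho>(3) y by (intro mult_left_mono) (auto simp: algebra_simps)
    moreover have "\<sigma>\<^sup>2 * q * y \<le> (58666 / 1000000) * (155 / 100000) * (2063 / 10000)"
      using s1 q y by (intro mult_mono) auto
    moreover have "\<sigma> * q * R \<le> 4777 / 10000000"
    proof -
      have "\<sigma> * q * R \<le> \<sigma> * q * (1272 / 1000)" using R \<sigma> q by (intro mult_left_mono) auto
      also have "\<dots> \<le> (242209 / 1000000) * (155 / 100000) * (1272 / 1000)" using \<sigma> q by (intro mult_mono) auto
      finally show ?thesis by simp
    qed
    moreover have "q * b * ((\<rho> - q / 4) * N) \<le> 1152 / 10000 * (\<rho> * N)"
      using b(2) q N0 \<rho>(1) b(1) by (intro mult_mono mult_right_mono) auto
    ultimately show ?thesis using \<rho>(1) by (simp add: algebra_simps)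
  qed
  have P: "of_real b - of_real \<eta> * X = of_real b * p"
  proof -
    have "b * \<kappa> = \<eta>" using y(3) by (simp add: \<kappa>_def mult_ac)
    then show ?thesis by (simp add: p_def algebra_simps flip: of_real_mult)
  qed
  have "limacon_form \<sigma> s 0 \<zeta> 1 (of_real b * p) = 4 * m * b * (2 * \<sigma>\<^sup>2 * \<rho> * Re p - q * b * (\<rho> - q / 4) * N + \<sigma>\<^sup>2 * (2 * \<rho> - 1 - q) * y - \<sigma> * q * R)"
  proof -
    have "Re ((\<zeta> + of_real \<sigma>) * cnj (of_real b * p)) = b * R" unfolding R_def by (simp add: algebra_simps)
    moreover have "(norm (of_real b * p))\<^sup>2 = b\<^sup>2 * N" by (simp add: N_def norm_mult power_mult_distrib)
    moreover have "Re (of_real b * p) = b * Re p" by simp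
    ultimately have "limacon_form \<sigma> s 0 \<zeta> 1 (of_real b * p) = 4 * \<sigma>\<^sup>2 * m * (2 * \<rho> - 1 - q) * (y * b) + 8 * \<sigma>\<^sup>2 * m * \<rho> * (b * Re p)
        - 4 * \<sigma> * (q * m * (b * R)) - m * q * (4 * \<rho> - q) * (b\<^sup>2 * N)"
      unfolding limacon_form_def Let_def m_def[symmetric] \<rho>_def[symmetric] q_def[symmetric] y(3) by simp
    then show ?thesis by (simp add: power2_eq_square algebra_simps)
  qed
  also have "\<dots> \<ge> 0" using J m(2) b(1) by simp
  finally show ?thesis using P unfolding X_def by simp
qed

section \<open>The case distinction\<close>

lemma Re_limacon_ge:
  fixes \<zeta> :: complex
  assumes "norm \<zeta> = 1" "0 \<le> s" "s \<le> 1 / 2"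
  shows "(1 - s)\<^sup>2 \<le> Re (qcurve (2 * s) (s\<^sup>2) \<zeta>)"
proof -
  define x where "x = Re \<zeta>"
  have xy: "x\<^sup>2 + (Im \<zeta>)\<^sup>2 = 1" using assms(1) by (simp add: cmod_def x_def)
  have x: "-1 \<le> x" "x \<le> 1" using abs_Re_le_cmod[of \<zeta>] assms(1) by (auto simp: x_def)
  have "Re (qcurve (2 * s) (s\<^sup>2) \<zeta>) = 1 + 2 * s * x + s\<^sup>2 * (x\<^sup>2 - (Im \<zeta>)\<^sup>2)"
    by (simp add: qcurve_def x_def power2_eq_square algebra_simps)
  also have "\<dots> = (1 - s)\<^sup>2 + 2 * s * ((1 + x) * (1 - s + s * x))"
    using xy by algebra
  finally have "Re (qcurve (2 * s) (s\<^sup>2) \<zeta>) = (1 - s)\<^sup>2 + 2 * s * ((1 + x) * (1 - s + s * x))" .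
  moreover have "s * (1 - x) \<le> 1 / 2 * 2" using assms x by (intro mult_mono) auto
  then have "0 \<le> 1 - s + s * x" by (simp add: algebra_simps)
  then have "0 \<le> 2 * s * ((1 + x) * (1 - s + s * x))" using assms x by simp
  ultimately show ?thesis by simp
qed

text \<open>The target enters only through \<open>E\<close>, and for \<open>E < 5 / 4\<close>
  through its limacon. The case split is governed by \<open>x\<close>, the value of
  \<open>\<eta> w + \<gamma>\<close> at the right end \<open>3 - cosh 1\<close> of the small disc:
  either the disc criterion holds, or \<open>x\<close> has a positive lower bound, which rules out
  small \<open>\<eta>\<close> when \<open>E\<close> is small.\<close>

lemma subset_cosh_sqrt_disc:
  fixes \<eta> \<gamma> E :: real
  assumes hp: "p holomorphic_on unit_disc" and p0: "p 0 = 1" and ne: "\<gamma> \<noteq> - \<eta>"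
    and hF: "(\<lambda>z. p z + z * deriv p z / (of_real \<eta> * p z + of_real \<gamma>)) holomorphic_on unit_disc"
    and T: "\<And>z. z \<in> unit_disc \<Longrightarrow> p z + z * deriv p z / (of_real \<eta> * p z + of_real \<gamma>) \<in> ball 1 E"
    and E: "0 < E" "E \<le> 192 / 100"
    and a0: "\<eta> * cos 1 + \<gamma> \<le> 0" and a1: "- (\<eta> * cos 1 + \<gamma>) \<le> sin 1 / (2 * (E + (1 - cos 1)))"
    and b0: "0 \<le> \<eta> * cosh 1 + \<gamma>" and b1: "cosh 1 - 1 < E \<Longrightarrow> \<eta> * cosh 1 + \<gamma> \<le> sinh 1 / (2 * (E - (cosh 1 - 1)))"
    and alt: "5 / 4 \<le> E \<or> (\<exists>s>0. E = (1 + s)\<^sup>2 - 1 \<and>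
      (\<forall>z\<in>unit_disc. p z + z * deriv p z / (of_real \<eta> * p z + of_real \<gamma>) \<in> qcurve (2 * s) (s\<^sup>2) ` unit_disc))"
  shows "p ` unit_disc \<subseteq> cosh_sqrt ` unit_disc"
proof -
  note num = cosh_1_bounds sinh_1_bounds cos_1_bounds sin_1_bounds
  define C where "C = cosh (1::real)"
  define k where "k = cos (1::real)"
  have C: "1543080 / 1000000 < C" "C < 1543081 / 1000000" using num by (auto simp: C_def)
  have k: "5403 / 10000 < k" "k < 54031 / 100000" using num by (auto simp: k_def)
  define A where "A = sin 1 / (2 * (E + (1 - k)))"
  have A0: "0 \<le> A" using E k num by (simp add: A_def)
  have AE: "A * (E + (1 - k)) \<le> 420736 / 1000000"
  proof -
    have "A * (E + (1 - k)) = sin 1 / 2" using E k by (simp add: A_def field_simps)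
    then show ?thesis using num by simp
  qed
  note a0' = a0[folded k_def] and b0' = b0[folded C_def]
  have a1': "- (\<eta> * k + \<gamma>) \<le> A" using a1 by (simp add: A_def k_def)
  have "0 \<le> \<eta> * (C - k)" using a0' b0' by (simp add: algebra_simps)
  then have \<eta>0: "0 \<le> \<eta>" using C k by (simp add: zero_le_mult_iff)
  have "\<eta> \<noteq> 0" using a0' b0' ne by auto
  with \<eta>0 have \<eta>: "0 < \<eta>" by simp
  define x where "x = \<eta> * (3 - C) + \<gamma>"
  show ?thesis
  proof (cases "(E - (2 - C)) * x \<le> 2 - C")
    case True
    then show ?thesis
      using briot_bouquet_disc_cosh[OF hp p0 ne hF T E(1) \<eta>0 a1] by (simp add: x_def C_def)
  next
    case False
    have xb: "x = (\<eta> * C + \<gamma>) - \<eta> * (2 * C - 3)" by (simp add: x_def algebra_simps)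
    have xa: "x = (\<eta> * k + \<gamma>) + \<eta> * (3 - C - k)" by (simp add: x_def algebra_simps)
    \<comment> \<open>Otherwise the condition at \<open>cos 1\<close> would give
      \<open>\<eta> \<le> 2\<close>, and \<open>x\<close> would be confined so much that the disc
      criterion holds after all.\<close>
    have "\<eta> + \<gamma> > 0"
    proof (rule ccontr)
      assume "\<not> ?thesis"
      then have c: "\<eta> + \<gamma> \<le> 0" by simp
      have "\<eta> * (1 - k) \<le> A" using a1' c by (simp add: algebra_simps)
      moreover have "A * (1 - k) \<le> A * (E + (1 - k))" using A0 E by (intro mult_left_mono) auto
      moreover have "A * (45969 / 100000) \<le> A * (1 - k)" using A0 k by (intro mult_left_mono) auto
      moreover have "\<eta> * (45969 / 100000) \<le> \<eta> * (1 - k)" using \<eta>0 k by (intro mult_left_mono) auto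
      ultimately have A1: "A \<le> 1" "\<eta> \<le> 2" "\<eta> * (45969 / 100000) \<le> A" using AE by linarith+
      have xu: "x \<le> \<eta> * (2 - C)" using c by (simp add: x_def algebra_simps)
      have "(E - (2 - C)) * x \<le> 2 - C"
      proof (cases "2 - C \<le> E")
        case True
        have "\<eta> * (2 - C) \<le> \<eta> * (45969 / 100000)" using C \<eta>0 by (intro mult_left_mono) auto
        then have "x \<le> A" using xu A1 by linarith
        then have "(E - (2 - C)) * x \<le> (E - (2 - C)) * A" using True by (intro mult_left_mono) auto
        also have "\<dots> \<le> (E + (1 - k)) * A" using A0 C k by (intro mult_right_mono) auto
        also have "\<dots> \<le> 2 - C" using AE C by (simp add: mult.commute)
        finally show ?thesis .
      next
        case F: False
        have "\<eta> * (2 * C - 3) \<le> 2 * (9 / 100)" using A1 \<eta>0 C by (intro mult_mono) auto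
        then have "- (1 / 5) \<le> x" using b0' xb by linarith
        then have le: "((2 - C) - E) * (- x) \<le> ((2 - C) - E) * (1 / 5)" using F by (intro mult_left_mono) auto
        have le': "((2 - C) - E) * (1 / 5) \<le> 2 - C" using F E by simp
        have eq: "(E - (2 - C)) * x = ((2 - C) - E) * (- x)" by (simp add: algebra_simps)
        show ?thesis unfolding eq using le le' by (rule order_trans)
      qed
      with False show False by simp
    qed
    note c = this
    have Er: "2 - C < E"
    proof (rule ccontr)
      assume "\<not> ?thesis"
      then have h: "E - (2 - C) \<le> 0" by simp
      have "0 \<le> \<eta> * (2 - C)" using \<eta>0 C by simp
      then have "0 \<le> x" using c by (simp add: x_def algebra_simps)
      then have "(E - (2 - C)) * x \<le> 0" by (rule mult_nonpos_nonneg[OF h])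
      then show False using False C by simp
    qed
    have big: "2 - C < (E - (2 - C)) * x" using False by simp
    have x0: "0 < x"
    proof (rule ccontr)
      assume "\<not> ?thesis"
      then have "(E - (2 - C)) * x \<le> 0" using Er by (intro mult_nonneg_nonpos) auto
      then show False using big C by linarith
    qed
    show ?thesis
    proof (cases "5 / 4 \<le> E")
      case True
      then show ?thesis
        using briot_bouquet_large[OF hp p0 hF T True E(2) \<eta> c a0 a1 b1] num by simp
    next
      case E54: False
      with alt obtain s where s: "0 < s" "E = (1 + s)\<^sup>2 - 1"
        and Ts: "\<And>z. z \<in> unit_disc \<Longrightarrow> p z + z * deriv p z / (of_real \<eta> * p z + of_real \<gamma>) \<in> qcurve (2 * s) (s\<^sup>2) ` unit_disc"
        by auto
      have "(1 + s)\<^sup>2 < (1 + 1 / 2)\<^sup>2" using E54 s(2) by (simp add: power2_eq_square)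
      then have "1 + s < 1 + 1 / 2" by (rule power2_less_imp_less) simp
      then have s2: "s \<le> 1 / 2" by simp
      define \<sigma> where "\<sigma> = sqrt (cosh 1) - (1::real)"
      note \<sigma> = cosh_root_bounds[folded \<sigma>_def C_def]
      have sub: "qcurve (2 * \<sigma>) (\<sigma>\<^sup>2) ` unit_disc \<subseteq> cosh_sqrt ` unit_disc"
        unfolding \<sigma>_def by (rule limacon_subset_cosh_sqrt)
      show ?thesis
      proof (cases "E \<le> C - 1")
        case True
        then have "(1 + s)\<^sup>2 \<le> (1 + \<sigma>)\<^sup>2" using s(2) \<sigma>(1) by simp
        then have s\<sigma>: "s \<le> \<sigma>" using \<sigma>(2) power2_le_imp_le[of "1 + s" "1 + \<sigma>"] by simp
        \<comment> \<open>The target limacon ends at or before \<open>cosh 1\<close>, so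
          \<open>p\<close> can be compared with the target itself. As \<open>E\<close> is small,
          failure of the disc makes \<open>x\<close> and thus \<open>\<eta>\<close> large; the
          limacon stays to the right of \<open>cos 1\<close> by a fixed margin, so the real part of
          \<open>\<eta> w + \<gamma>\<close> stays above \<open>-1 / 3\<close> on it.\<close>
        have "(E - (2 - C)) * x \<le> 8617 / 100000 * x" using True C x0 by (intro mult_right_mono) auto
        then have "53 / 10 \<le> x" using big C by simp
        moreover have "\<eta> * (3 - C - k) \<le> \<eta> * (917 / 1000)" using \<eta>0 C k by (intro mult_left_mono) auto
        ultimately have \<eta>5: "57 / 10 \<le> \<eta>" using xa a0' by simp
        have "p ` unit_disc \<subseteq> qcurve (2 * s) (s\<^sup>2) ` unit_disc"
        proof (rule briot_bouquet_limacon[OF _ _ s(1) _ hp p0 ne hF Ts, where D = "\<lambda>_. 0"])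
          fix \<zeta> :: complex assume \<zeta>: "norm \<zeta> = 1"
          have xx: "-1 \<le> Re \<zeta>" "Re \<zeta> \<le> 1" using abs_Re_le_cmod[of \<zeta>] \<zeta> by auto
          have "s * (- Re \<zeta>) \<le> s * 1" using s xx by (intro mult_left_mono) auto
          then have \<rho>: "757 / 1000 \<le> 1 + s * Re \<zeta>" using s\<sigma> \<sigma>(3) by simp
          then have m: "0 < 1 + 2 * s * Re \<zeta> + s\<^sup>2" using zero_le_power2[of s] by linarith
          then show "0 < 1 + 2 * s * Re \<zeta> + s\<^sup>2 + 0" by simp
          show "0 \<le> limacon_form s s 0 \<zeta> 1 0" using m \<rho> by (simp add: limacon_form_def Let_def)
          define P where "P = of_real \<eta> * qcurve (2 * s) (s\<^sup>2) \<zeta> + of_real \<gamma>"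
          have "(757 / 1000)\<^sup>2 \<le> (1 - s)\<^sup>2" using s\<sigma> \<sigma>(3) by (intro power_mono) auto
          then have "573 / 1000 \<le> Re (qcurve (2 * s) (s\<^sup>2) \<zeta>)"
            using Re_limacon_ge[OF \<zeta> less_imp_le[OF s(1)] s2] by (simp add: power2_eq_square)
          then have "\<eta> * (573 / 1000) \<le> \<eta> * Re (qcurve (2 * s) (s\<^sup>2) \<zeta>)" using \<eta>0 by (intro mult_left_mono) auto
          moreover have "\<eta> * (k + 326 / 10000) \<le> \<eta> * (573 / 1000)" using \<eta>0 k by (intro mult_left_mono) auto
          moreover have "A * (91 / 100) \<le> A * (E + (1 - k))" using A0 Er C k by (intro mult_left_mono) auto
          then have "A \<le> 463 / 1000" using AE by linarith
          moreover have "Re P = \<eta> * Re (qcurve (2 * s) (s\<^sup>2) \<zeta>) + \<gamma>" by (simp add: P_def)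
          moreover have "\<eta> * (k + 326 / 10000) = \<eta> * k + 326 / 10000 * \<eta>" by (simp add: algebra_simps)
          ultimately have "- (1 / 3) \<le> Re P" using a1' \<eta>5 by linarith
          then have "0 \<le> (1 + s * Re \<zeta>) * (2 * (Re P + 1 / 3))" using \<rho> by simp
          moreover have "0 \<le> 4 / 3 * (1 + s * Re \<zeta>) - 1" using \<rho> by simp
          ultimately have "0 \<le> (1 + s * Re \<zeta>) * (2 * (Re P + 1 / 3)) + (4 / 3 * (1 + s * Re \<zeta>) - 1)"
            by (rule add_nonneg_nonneg)
          also have "(1 + s * Re \<zeta>) * (2 * (Re P + 1 / 3)) + (4 / 3 * (1 + s * Re \<zeta>) - 1)
              = (2 * (1 + s * Re \<zeta>) - 1) + 2 * (1 + s * Re \<zeta>) * Re P" by (simp add: field_simps)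
          finally have "0 \<le> (2 * (1 + s * Re \<zeta>) - 1) + 2 * (1 + s * Re \<zeta>) * Re P" .
          then have "0 \<le> 4 * s\<^sup>2 * (1 + 2 * s * Re \<zeta> + s\<^sup>2) * ((2 * (1 + s * Re \<zeta>) - 1) + 2 * (1 + s * Re \<zeta>) * Re P)"
            using m by simp
          also have "\<dots> = limacon_form s s 0 \<zeta> 1 P" by (simp add: limacon_form_def Let_def algebra_simps)
          finally show "0 \<le> limacon_form s s 0 \<zeta> 1 (of_real \<eta> * qcurve (2 * s) (s\<^sup>2) \<zeta> + of_real \<gamma>)"
            by (simp add: P_def)
        qed (use s s2 in auto)
        also have "\<dots> \<subseteq> qcurve (2 * \<sigma>) (\<sigma>\<^sup>2) ` unit_disc" by (rule qcurve_limacon_mono) (use s s\<sigma> in auto)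
        finally show ?thesis using sub by blast
      next
        case eE: False
        define e where "e = E - (C - 1)"
        define b where "b = \<eta> * C + \<gamma>"
        have e0: "0 < e" using eE by (simp add: e_def)
        have be: "b * e \<le> 587605 / 1000000"
        proof -
          have "b \<le> sinh 1 / (2 * e)" using b1 eE by (simp add: b_def e_def C_def)
          then have "b * (2 * e) \<le> sinh 1" using e0 by (simp add: pos_le_divide_eq)
          then show ?thesis using num by simp
        qed
        have \<eta>C: "\<eta> * (C - k) = b - (\<eta> * k + \<gamma>)" by (simp add: b_def algebra_simps)
        \<comment> \<open>\<open>e\<close> is the excess of the target over \<open>cosh 1\<close>,
          \<open>e'\<close> the excess over the rational vertex \<open>25281 / 16384\<close>; they
          differ by less than \<open>0.0001\<close>.\<close>
        define e' where "e' = (1 + s)\<^sup>2 - (1 + 31 / 128)\<^sup>2"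
        have e': "e' = e + (C - 25281 / 16384)" by (simp add: e'_def e_def s(2) power2_eq_square)
        show ?thesis
        proof (cases "1 / 128 \<le> e'")
          case True
          define b' where "b' = \<eta> * (1 + 31 / 128)\<^sup>2 + \<gamma>"
          have b': "b' = x + \<eta> * (25281 / 16384 - (3 - C))" by (simp add: b'_def x_def power2_eq_square algebra_simps)
          have "0 \<le> \<eta> * (25281 / 16384 - (3 - C))" using \<eta>0 C by simp
          then have b'0: "0 \<le> b'" using b' x0 by simp
          have "\<eta> * (25281 / 16384) \<le> \<eta> * C" using \<eta>0 C by (intro mult_left_mono) auto
          then have b'b: "b' \<le> b" by (simp add: b'_def b_def power2_eq_square)
          have \<eta>C': "\<eta> * (25281 / 16384 - k) = b' - (\<eta> * k + \<gamma>)" by (simp add: b'_def power2_eq_square algebra_simps)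
          have h1: "255 / 256 * b' \<le> \<eta>"
          proof -
            have "\<eta> * (25281 / 16384 - k) \<le> \<eta> * (256 / 255)" using \<eta>0 k by (intro mult_left_mono) auto
            then show ?thesis using \<eta>C' a0' by simp
          qed
          have h2: "\<eta> \<le> 99731 / 100000 * (b' + A)"
          proof -
            have "\<eta> * (100000 / 99731) \<le> \<eta> * (25281 / 16384 - k)" using \<eta>0 k by (intro mult_left_mono) auto
            then show ?thesis using \<eta>C' a1' by simp
          qed
          have "p ` unit_disc \<subseteq> cosh_sqrt ` unit_disc"
          proof (rule briot_bouquet_near[OF hp p0 ne hF Ts s(1) s2 _ _ _ _ _ _ A0])
            show "1 / 128 \<le> (1 + s)\<^sup>2 - (1 + 31 / 128)\<^sup>2" using True by (simp add: e'_def)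
            show "0 \<le> \<eta> * (1 + 31 / 128)\<^sup>2 + \<gamma>" using b'0 by (simp add: b'_def)
            show "255 / 256 * (\<eta> * (1 + 31 / 128)\<^sup>2 + \<gamma>) \<le> \<eta>" using h1 by (simp add: b'_def)
            show "\<eta> \<le> 99731 / 100000 * (\<eta> * (1 + 31 / 128)\<^sup>2 + \<gamma> + A)" using h2 by (simp add: b'_def)
            \<comment> \<open>\<open>587605 / 1000000\<close> bounds \<open>sinh 1 / 2\<close>, and
              \<open>27 / 16\<close> is slightly below its reciprocal.\<close>
            have "27 / 16 * e' \<le> e / (587605 / 1000000)" using e' C True by simp
            then have "b' * (27 / 16 * e') \<le> b * (e / (587605 / 1000000))"
              using b'0 b'b True by (intro mult_mono) auto
            also have "\<dots> \<le> 1" using be by simp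
            finally show "(\<eta> * (1 + 31 / 128)\<^sup>2 + \<gamma>) * (27 / 16 * ((1 + s)\<^sup>2 - (1 + 31 / 128)\<^sup>2)) \<le> 1" by (simp add: b'_def e'_def)
            have "255 / 256 * b' * (861097 / 10000000) \<le> \<eta> * (25281 / 16384 - (3 - C))"
              using h1 \<eta>0 b'0 C by (intro mult_mono) auto
            then have xb': "x \<le> b' * (914227 / 1000000)" using b' b'0 by simp
            \<comment> \<open>The lower bound for \<open>b'\<close> comes from the failure of the
              disc; this is the origin of the affine function
              \<open>(16512 e + 1412) / 8192\<close>.\<close>
            have "456919 / 1000000 \<le> (E - (2 - C)) * x" using big C by simp
            also have "\<dots> \<le> (e' + 861108 / 10000000) * (b' * (914227 / 1000000))"
              using xb' x0 e' C Er by (intro mult_mono) (auto simp: e_def)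
            finally have "499787 / 1000000 \<le> b' * (e' + 861108 / 10000000)" by (simp add: algebra_simps)
            then have "1 \<le> 20009 / 10000 * (b' * (e' + 861108 / 10000000))" by simp
            also have "\<dots> = b' * ((e' + 861108 / 10000000) * (20009 / 10000))" by (simp only: mult_ac)
            also have "\<dots> \<le> b' * ((16512 * e' + 1412) / 8192)"
              using b'0 True by (intro mult_left_mono) auto
            finally show "1 \<le> (\<eta> * (1 + 31 / 128)\<^sup>2 + \<gamma>) * ((16512 * ((1 + s)\<^sup>2 - (1 + 31 / 128)\<^sup>2) + 1412) / 8192)"
              unfolding b'_def[symmetric] e'_def[symmetric] .
            have "A * (e' + 10027 / 10000) \<le> A * (E + (1 - k))" using A0 k C e' by (intro mult_left_mono) (auto simp: e_def)
            then show "A * ((1 + s)\<^sup>2 - (1 + 31 / 128)\<^sup>2 + 10027 / 10000) \<le> 42074 / 100000" using AE by (simp add: e'_def)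
          qed
          then show ?thesis .
        next
          case False
          \<comment> \<open>For such a small excess the comparison limacon ends exactly at
            \<open>cosh 1\<close>, and \<open>D = 0\<close> is enough.\<close>
          then have e1: "e \<le> 1 / 128" using e' C by simp
          define q where "q = s\<^sup>2 - \<sigma>\<^sup>2"
          define h where "h = s - \<sigma>"
          have eh: "e = h * (h + 2 + 2 * \<sigma>)" using s(2) \<sigma>(1) by (simp add: e_def h_def power2_eq_square algebra_simps)
          have h0: "0 < h"
          proof -
            have "(1 + \<sigma>)\<^sup>2 < (1 + s)\<^sup>2" using e0 s(2) \<sigma>(1) by (simp add: e_def)
            then have "1 + \<sigma> < 1 + s" by (rule power2_less_imp_less) (use s in simp)
            then show ?thesis by (simp add: h_def)
          qed
          have "h * (248 / 100) \<le> e" unfolding eh using h0 \<sigma>(2) by (intro mult_left_mono) auto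
          then have h1: "h \<le> 316 / 100000" using e1 by simp
          have qh: "q = h * (h + 2 * \<sigma>)" by (simp add: q_def h_def power2_eq_square algebra_simps)
          have q0: "0 \<le> q" unfolding qh using h0 \<sigma>(2) by simp
          have "h * (h + 2 * \<sigma>) \<le> h * (19603 / 100000 * (h + 2 + 2 * \<sigma>))"
            using h0 h1 \<sigma>(2,3) by (intro mult_left_mono) auto
          \<comment> \<open>\<open>19603 / 100000\<close> bounds
            \<open>q / e = (h + 2 \<sigma>) / (h + 2 + 2 \<sigma>)\<close>; together with
            \<open>be\<close> it gives the constant \<open>1152 / 10000\<close> for
            \<open>q b\<close>.\<close>
          then have qe: "q \<le> 19603 / 100000 * e" unfolding qh eh by (simp only: mult.left_commute[of h])
          have bx: "x \<le> b * 1"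
          proof -
            have "0 \<le> \<eta> * (2 * C - 3)" using \<eta>0 C by simp
            then show ?thesis using xb by (simp add: b_def)
          qed
          have "456919 / 1000000 \<le> (E - (2 - C)) * x" using big C by simp
          also have "\<dots> \<le> (94 / 1000) * b" using bx x0 e1 C Er by (intro mult_mono) (auto simp: e_def)
          finally have b5: "485 / 100 \<le> b" by simp
          have "p ` unit_disc \<subseteq> qcurve (2 * \<sigma>) (\<sigma>\<^sup>2) ` unit_disc"
          proof (rule briot_bouquet_limacon[OF _ _ s(1) _ hp p0 ne hF Ts, where D = "\<lambda>_. 0"])
            fix \<zeta> :: complex assume \<zeta>: "norm \<zeta> = 1"
            have xx: "-1 \<le> Re \<zeta>" "Re \<zeta> \<le> 1" using abs_Re_le_cmod[of \<zeta>] \<zeta> by auto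
            have "\<sigma> * (- Re \<zeta>) \<le> \<sigma> * 1" using \<sigma>(2) xx by (intro mult_left_mono) auto
            then have \<rho>: "757 / 1000 \<le> 1 + \<sigma> * Re \<zeta>" using \<sigma>(3) by simp
            then have m: "0 < 1 + 2 * \<sigma> * Re \<zeta> + \<sigma>\<^sup>2" using zero_le_power2[of \<sigma>] by linarith
            then show "0 < 1 + 2 * \<sigma> * Re \<zeta> + \<sigma>\<^sup>2 + 0" by simp
            have q1: "q \<le> 155 / 100000" using qe e1 by simp
            show "0 \<le> (1 + 2 * \<sigma> * Re \<zeta> + \<sigma>\<^sup>2 + 0) * (s\<^sup>2 - \<sigma>\<^sup>2) * (4 * (1 + \<sigma> * Re \<zeta>) - (s\<^sup>2 - \<sigma>\<^sup>2)) + s\<^sup>2 * 0\<^sup>2"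
              unfolding q_def[symmetric] using m q0 q1 \<rho> by simp
            show "0 \<le> limacon_form \<sigma> s 0 \<zeta> 1 0"
              using m \<rho> q1 by (simp add: limacon_form_def Let_def q_def)
            have "0 \<le> limacon_form \<sigma> s 0 \<zeta> 1 (of_real b - of_real \<eta> * (of_real ((1 + \<sigma>)\<^sup>2) - (1 + of_real \<sigma> * \<zeta>)\<^sup>2))"
            proof (rule limacon_form_close[where s = s, OF \<zeta> \<sigma>(2,3), folded q_def])
              have "q * b \<le> 19603 / 100000 * e * b" using qe b5 by (intro mult_right_mono) auto
              then show "q * b \<le> 1152 / 10000" using be by (simp add: mult_ac)
              have "\<eta> * (10000 / 9973) \<le> \<eta> * (C - k)" using \<eta>0 C k by (intro mult_left_mono) auto
              moreover have "A * (100274 / 100000) \<le> A * (E + (1 - k))" using A0 C k e0 by (intro mult_left_mono) (auto simp: e_def)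
              ultimately show "\<eta> \<le> 9973 / 10000 * b + 42 / 100" using \<eta>C a1' AE by simp
            qed (use q0 q1 b5 \<eta>0 in auto)
            also have "of_real b - of_real \<eta> * (of_real ((1 + \<sigma>)\<^sup>2) - (1 + of_real \<sigma> * \<zeta>)\<^sup>2) = of_real \<eta> * qcurve (2 * \<sigma>) (\<sigma>\<^sup>2) \<zeta> + of_real \<gamma>"
              unfolding b_def \<sigma>(1) by (simp add: qcurve_def power2_eq_square algebra_simps)
            finally show "0 \<le> limacon_form \<sigma> s 0 \<zeta> 1 (of_real \<eta> * qcurve (2 * \<sigma>) (\<sigma>\<^sup>2) \<zeta> + of_real \<gamma>)" .
          qed (use s s2 \<sigma>(2,3) in auto)
          then show ?thesis using sub by blast
        qed
      qed
    qed
  qed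
qed

section \<open>The theorem\<close>

text \<open>Multiplication by \<open>c > 0\<close> turns the quotients in the theorem into
  conditions on the value of \<open>\<eta> w + \<gamma>\<close> at \<open>w = c\<close>.\<close>

lemma le_divide_shift:
  fixes c d \<eta> \<gamma> S :: real
  assumes "0 < c"
  shows "- \<gamma> / c \<le> \<eta> \<longleftrightarrow> 0 \<le> \<eta> * c + \<gamma>" "\<eta> \<le> - \<gamma> / c \<longleftrightarrow> \<eta> * c + \<gamma> \<le> 0"
    and "\<eta> \<le> - \<gamma> / c + S / (2 * c * d) \<longleftrightarrow> \<eta> * c + \<gamma> \<le> S / (2 * d)"
    and "- \<gamma> / c - S / (2 * c * d) \<le> \<eta> \<longleftrightarrow> - (\<eta> * c + \<gamma>) \<le> S / (2 * d)"
proof -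
  show "- \<gamma> / c \<le> \<eta> \<longleftrightarrow> 0 \<le> \<eta> * c + \<gamma>" unfolding pos_divide_le_eq[OF assms] by linarith
  show "\<eta> \<le> - \<gamma> / c \<longleftrightarrow> \<eta> * c + \<gamma> \<le> 0" unfolding pos_le_divide_eq[OF assms] by linarith
  have "S / (2 * c * d) = (S / (2 * d)) / c" by simp
  then have *: "- \<gamma> / c + S / (2 * c * d) = (- \<gamma> + S / (2 * d)) / c" "- \<gamma> / c - S / (2 * c * d) = (- \<gamma> - S / (2 * d)) / c"
    by (simp_all only: add_divide_distrib diff_divide_distrib)
  show "\<eta> \<le> - \<gamma> / c + S / (2 * c * d) \<longleftrightarrow> \<eta> * c + \<gamma> \<le> S / (2 * d)"
    unfolding * pos_le_divide_eq[OF assms] by linarith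
  show "- \<gamma> / c - S / (2 * c * d) \<le> \<eta> \<longleftrightarrow> - (\<eta> * c + \<gamma>) \<le> S / (2 * d)"
    unfolding * pos_divide_le_eq[OF assms] by linarith
qed

theorem theorem2p1:
  fixes \<eta> \<gamma> :: real and \<phi> p :: "complex \<Rightarrow> complex"
  assumes "\<gamma> \<noteq> - \<eta>"
    and cases:
      "(\<phi> = phi_lune \<and>
         - \<gamma> / cosh 1 \<le> \<eta> \<and>
         \<eta> \<le> - \<gamma> / cosh 1 + sinh 1 / (2 * cosh 1 * (1 + sqrt 2 - cosh 1)) \<and>
         - \<gamma> / cos 1 - sin 1 / (2 * cos 1 * (1 + sqrt 2 - cos 1)) \<le> \<eta> \<and>
         \<eta> \<le> - \<gamma> / cos 1) \<or>
       (\<exists>s::real. \<phi> = (\<lambda>z. (1 + complex_of_real s * z)\<^sup>2) \<and>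
         0 < s \<and> s \<le> 1 / sqrt 2 \<and>
         - \<gamma> / cos 1 - sin 1 / (2 * cos 1 * ((1 + s)\<^sup>2 - cos 1)) \<le> \<eta> \<and>
         \<eta> \<le> - \<gamma> / cos 1 \<and>
         (0 < s \<and> s \<le> - 1 + sqrt (cosh 1) \<longrightarrow> - \<gamma> / cosh 1 \<le> \<eta>) \<and>
         (- 1 + sqrt (cosh 1) < s \<and> s \<le> 1 / sqrt 2 \<longrightarrow>
            - \<gamma> / cosh 1 \<le> \<eta> \<and>
            \<eta> \<le> - \<gamma> / cosh 1 + sinh 1 / (2 * cosh 1 * ((1 + s)\<^sup>2 - cosh 1)))) \<or>
       (\<phi> = exp \<and>
         - \<gamma> / cosh 1 < \<eta> \<and>
         \<eta> \<le> - \<gamma> / cosh 1 + sinh 1 / (2 * cosh 1 * (exp 1 - cosh 1)) \<and>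
         - \<gamma> / cos 1 - sin 1 / (2 * cos 1 * (exp 1 - cos 1)) \<le> \<eta> \<and>
         \<eta> < - \<gamma> / cos 1)"
    and "p holomorphic_on unit_disc" and "p 0 = 1"
    and "(\<lambda>z. p z + z * deriv p z / (of_real \<eta> * p z + of_real \<gamma>)) \<prec>\<^sub>D \<phi>"
  shows "p \<prec>\<^sub>D cosh_sqrt"
proof -
  note num = cosh_1_bounds cos_1_bounds exp_1_bounds
  have C0: "0 < cosh (1::real)" and k0: "0 < cos (1::real)" using num by auto
  note shift = le_divide_shift[OF C0] le_divide_shift[OF k0]
  let ?F = "\<lambda>z. p z + z * deriv p z / (of_real \<eta> * p z + of_real \<gamma>)"
  have hp: "p holomorphic_on unit_disc" and p0: "p 0 = 1" by fact+
  have hF: "?F holomorphic_on unit_disc"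
    using \<open>?F \<prec>\<^sub>D \<phi>\<close> unfolding subordinate_def by blast
  have "\<exists>w. w ` unit_disc \<subseteq> unit_disc \<and> (\<forall>z\<in>unit_disc. ?F z = \<phi> (w z))"
    using \<open>?F \<prec>\<^sub>D \<phi>\<close> unfolding subordinate_def by blast
  then obtain w where w: "w ` unit_disc \<subseteq> unit_disc" and Fw: "\<forall>z\<in>unit_disc. ?F z = \<phi> (w z)" by blast
  have wb: "norm (w z) < 1" if "z \<in> unit_disc" for z
  proof -
    have "w z \<in> unit_disc" using w that by blast
    then show ?thesis by simp
  qed
  note main = subset_cosh_sqrt_disc[OF hp p0 \<open>\<gamma> \<noteq> - \<eta>\<close> hF]
  from cases have "p ` unit_disc \<subseteq> cosh_sqrt ` unit_disc"
  proof (elim disjE exE conjE)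
    assume \<phi>: "\<phi> = phi_lune" and h: "- \<gamma> / cosh 1 \<le> \<eta>" "\<eta> \<le> - \<gamma> / cosh 1 + sinh 1 / (2 * cosh 1 * (1 + sqrt 2 - cosh 1))"
      "- \<gamma> / cos 1 - sin 1 / (2 * cos 1 * (1 + sqrt 2 - cos 1)) \<le> \<eta>" "\<eta> \<le> - \<gamma> / cos 1"
    have d: "1 + sqrt 2 - cosh 1 = sqrt 2 - (cosh 1 - 1 :: real)" "1 + sqrt 2 - cos 1 = sqrt 2 + (1 - cos 1 :: real)" by simp_all
    note h' = h[unfolded shift, unfolded d]
    have q: "5 / 4 \<le> sqrt (2::real)" by (rule real_le_rsqrt) (simp add: power2_eq_square)
    have q': "sqrt (2::real) \<le> 192 / 100" by (rule real_le_lsqrt) (simp_all add: power2_eq_square)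
    show ?thesis
    proof (rule main[where E = "sqrt 2"])
      show "?F z \<in> ball 1 (sqrt 2)" if "z \<in> unit_disc" for z
        unfolding Fw[rule_format, OF that] \<phi> by (rule phi_lune_ball[OF wb[OF that]])
      show "5 / 4 \<le> sqrt 2 \<or> (\<exists>s>0. sqrt 2 = (1 + s)\<^sup>2 - 1 \<and> (\<forall>z\<in>unit_disc. ?F z \<in> qcurve (2 * s) (s\<^sup>2) ` unit_disc))"
        using q by (rule disjI1)
    qed (use h' q' in simp_all)
  next
    assume \<phi>: "\<phi> = exp" and h: "- \<gamma> / cosh 1 < \<eta>" "\<eta> \<le> - \<gamma> / cosh 1 + sinh 1 / (2 * cosh 1 * (exp 1 - cosh 1))"
      "- \<gamma> / cos 1 - sin 1 / (2 * cos 1 * (exp 1 - cos 1)) \<le> \<eta>" "\<eta> < - \<gamma> / cos 1"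
    have d: "exp 1 - cosh 1 = (exp 1 - 1) - (cosh 1 - 1 :: real)" "exp 1 - cos 1 = (exp 1 - 1) + (1 - cos 1 :: real)" by simp_all
    note h' = less_imp_le[OF h(1), unfolded shift] h(2,3)[unfolded shift, unfolded d] less_imp_le[OF h(4), unfolded shift]
    show ?thesis
    proof (rule main[where E = "exp 1 - 1"])
      show "?F z \<in> ball 1 (exp 1 - 1)" if "z \<in> unit_disc" for z
        unfolding Fw[rule_format, OF that] \<phi> by (rule exp_ball[OF wb[OF that]])
      have "5 / 4 \<le> exp 1 - (1::real)" using num by simp
      then show "5 / 4 \<le> exp 1 - (1 :: real) \<or> (\<exists>s>0. exp 1 - 1 = (1 + s)\<^sup>2 - 1 \<and> (\<forall>z\<in>unit_disc. ?F z \<in> qcurve (2 * s) (s\<^sup>2) ` unit_disc))"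
        by (rule disjI1)
      show "0 < exp 1 - (1::real)" "exp 1 - 1 \<le> (192 / 100 :: real)" using num by simp_all
    qed (use h' in simp_all)
  next
    fix s :: real
    assume \<phi>: "\<phi> = (\<lambda>z. (1 + complex_of_real s * z)\<^sup>2)" and s: "0 < s" "s \<le> 1 / sqrt 2"
      and h: "- \<gamma> / cos 1 - sin 1 / (2 * cos 1 * ((1 + s)\<^sup>2 - cos 1)) \<le> \<eta>" "\<eta> \<le> - \<gamma> / cos 1"
      and l: "0 < s \<and> s \<le> - 1 + sqrt (cosh 1) \<longrightarrow> - \<gamma> / cosh 1 \<le> \<eta>"
      and g: "- 1 + sqrt (cosh 1) < s \<and> s \<le> 1 / sqrt 2 \<longrightarrow> - \<gamma> / cosh 1 \<le> \<eta> \<and>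
            \<eta> \<le> - \<gamma> / cosh 1 + sinh 1 / (2 * cosh 1 * ((1 + s)\<^sup>2 - cosh 1))"
    have d: "(1 + s)\<^sup>2 - cosh 1 = ((1 + s)\<^sup>2 - 1) - (cosh 1 - 1)" "(1 + s)\<^sup>2 - cos 1 = ((1 + s)\<^sup>2 - 1) + (1 - cos 1)" by simp_all
    have b: "0 \<le> \<eta> * cosh 1 + \<gamma>" using l g s unfolding shift[symmetric] by (cases "s \<le> - 1 + sqrt (cosh 1)") simp_all
    note h' = h[unfolded shift, unfolded d]
    have img: "?F z \<in> qcurve (2 * s) (s\<^sup>2) ` unit_disc" if "z \<in> unit_disc" for z
    proof (rule image_eqI)
      show "?F z = qcurve (2 * s) (s\<^sup>2) (w z)"
        unfolding Fw[rule_format, OF that] \<phi> by (simp add: qcurve_def power2_eq_square algebra_simps)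
      show "w z \<in> unit_disc" using wb[OF that] by simp
    qed
    have "s\<^sup>2 \<le> (1 / sqrt 2)\<^sup>2" using s by (intro power_mono) auto
    then have s2: "s\<^sup>2 \<le> 1 / 2" by (simp add: power_divide)
    then have "s\<^sup>2 \<le> (7072 / 10000)\<^sup>2" by (simp add: power2_eq_square)
    then have "s \<le> 7072 / 10000" by (rule power2_le_imp_le) simp
    \<comment> \<open>The largest \<open>E\<close> of all cases: \<open>s \<le> 1 / sqrt 2\<close>
      gives at most \<open>1.9144\<close>, hence the common ceiling
      \<open>192 / 100\<close>.\<close>
    then have E: "(1 + s)\<^sup>2 - 1 \<le> 192 / 100" using s2 by (simp add: power2_sum)
    show ?thesis
    proof (rule main[where E = "(1 + s)\<^sup>2 - 1"])
      show "?F z \<in> ball 1 ((1 + s)\<^sup>2 - 1)" if "z \<in> unit_disc" for z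
        using img[OF that] qcurve_limacon_ball[OF s(1)] by fastforce
      show "\<eta> * cosh 1 + \<gamma> \<le> sinh 1 / (2 * ((1 + s)\<^sup>2 - 1 - (cosh 1 - 1)))" if "cosh 1 - 1 < (1 + s)\<^sup>2 - 1"
      proof -
        \<comment> \<open>The upper bound at \<open>cosh 1\<close> is assumed exactly when the
          limacon reaches beyond \<open>cosh 1\<close>, that is, when
          \<open>(1 + s)^2 > cosh 1\<close>.\<close>
        have "sqrt (cosh 1) < sqrt ((1 + s)\<^sup>2)" by (rule real_sqrt_less_mono) (use that in simp)
        then have "- 1 + sqrt (cosh 1) < s" using s by simp
        then have "\<eta> \<le> - \<gamma> / cosh 1 + sinh 1 / (2 * cosh 1 * ((1 + s)\<^sup>2 - cosh 1))" using g s by blast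
        then show ?thesis unfolding shift d .
      qed
      show "5 / 4 \<le> (1 + s)\<^sup>2 - 1 \<or> (\<exists>t>0. (1 + s)\<^sup>2 - 1 = (1 + t)\<^sup>2 - 1 \<and> (\<forall>z\<in>unit_disc. ?F z \<in> qcurve (2 * t) (t\<^sup>2) ` unit_disc))"
        using s(1) img by blast
      show "0 < (1 + s)\<^sup>2 - 1" using s by (simp add: power2_sum add_pos_pos)
    qed (use h' b E in simp_all)
  qed
  then show ?thesis by (rule subordinate_cosh_sqrtI[OF hp p0])
qed

end
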